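(* Max Internal Spanning Tree can be solved in time $\mathcal{O}^*(1.8669^n)$ on subcubic graphs.
   Context: Max Internal Spanning Tree (MIST): given a simple undirected graph $G=(V,E)$ with $n$ vertices, find a spanning tree of $G$ with a maximum number of internal (non-leaf) vertices. A subcubic graph is a graph with maximum degree at most three. We write $f(n)=\mathcal{O}^*(g(n))$ if $f(n)\le p(n)\cdot g(n)$ for some polynomial $p(n)$. *)

theory Defs
  imports "HOL-Library.Log_Nat" "HOL-Computational_Algebra.Polynomial"
begin

section \<open>Spanning trees of simple undirected graphs\<close>

text \<open>
  A graph is given by a vertex set and a set of two-element edges. Spanning trees in the AFP entry
  Graph\_Theory are not usable here: there an undirected graph is a symmetric digraph, in which
  a, b, a is already a cycle, so that no symmetric graph with an edge is a tree.
\<close>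

definition simple_graph :: "'a set \<Rightarrow> 'a set set \<Rightarrow> bool" where
  "simple_graph V E \<longleftrightarrow> finite V \<and> (\<forall>e\<in>E. e \<subseteq> V \<and> card e = 2)"

definition vertex_degree :: "'a set set \<Rightarrow> 'a \<Rightarrow> nat" where
  "vertex_degree E v = card {e \<in> E. v \<in> e}"

definition subcubic :: "'a set \<Rightarrow> 'a set set \<Rightarrow> bool" where
  "subcubic V E \<longleftrightarrow> (\<forall>v\<in>V. vertex_degree E v \<le> 3)"

definition connected_graph :: "'a set \<Rightarrow> 'a set set \<Rightarrow> bool" where
  "connected_graph V E \<longleftrightarrow>
     V \<noteq> {} \<and> (\<forall>u\<in>V. \<forall>v\<in>V. (u, v) \<in> {(x, y). {x, y} \<in> E}\<^sup>*)"

definition is_cycle :: "'a set set \<Rightarrow> 'a list \<Rightarrow> bool" where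
  "is_cycle E p \<longleftrightarrow> length p \<ge> 3 \<and> distinct p \<and>
     (\<forall>i<length p. {p ! i, p ! (Suc i mod length p)} \<in> E)"

definition is_tree :: "'a set \<Rightarrow> 'a set set \<Rightarrow> bool" where
  "is_tree V T \<longleftrightarrow> simple_graph V T \<and> connected_graph V T \<and> \<not> (\<exists>p. is_cycle T p)"

definition spanning_tree :: "'a set \<Rightarrow> 'a set set \<Rightarrow> 'a set set \<Rightarrow> bool" where
  "spanning_tree V E T \<longleftrightarrow> T \<subseteq> E \<and> is_tree V T"

definition leaf :: "'a set set \<Rightarrow> 'a \<Rightarrow> bool" where
  "leaf T v \<longleftrightarrow> vertex_degree T v = 1"

definition internal_vertices :: "'a set \<Rightarrow> 'a set set \<Rightarrow> 'a set" where
  "internal_vertices V T = {v \<in> V. \<not> leaf T v}"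

definition max_internal_spanning_tree :: "'a set \<Rightarrow> 'a set set \<Rightarrow> 'a set set \<Rightarrow> bool" where
  "max_internal_spanning_tree V E T \<longleftrightarrow> spanning_tree V E T \<and>
     (\<forall>T'. spanning_tree V E T' \<longrightarrow>
        card (internal_vertices V T') \<le> card (internal_vertices V T))"


section \<open>Random access programs with logarithmic cost\<close>

text \<open>
  The machine model is a random access machine with the logarithmic cost criterion: every operation
  is charged according to the bit lengths of its operands, of the addresses used and of the values
  transferred. Control flow is structured, and the memory is presented as unbounded arrays of
  natural numbers. A program mentions only finitely many array names, so its arrays can be
  interleaved in one linear memory. Scalar variables are arrays used at index 0.
\<close>

type_synonym aname = string
type_synonym state = "aname \<Rightarrow> nat \<Rightarrow> nat"

datatype exp =
    Const nat
  | Read aname exp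
  | Add exp exp
  | Sub exp exp
  | Mul exp exp

datatype com =
    Skip
  | Write aname exp exp
  | Seq com com
  | Cond exp com com
  | Loop exp com

definition bits :: "nat \<Rightarrow> nat" where
  "bits x = max 1 (floorlog 2 x)"

fun val :: "exp \<Rightarrow> state \<Rightarrow> nat" where
  "val (Const k) s = k"
| "val (Read x a) s = s x (val a s)"
| "val (Add a b) s = val a s + val b s"
| "val (Sub a b) s = val a s - val b s"
| "val (Mul a b) s = val a s * val b s"

fun cost :: "exp \<Rightarrow> state \<Rightarrow> nat" where
  "cost (Const k) s = bits k"
| "cost (Read x a) s = cost a s + bits (val a s) + bits (s x (val a s))"
| "cost (Add a b) s = cost a s + cost b s + bits (val a s) + bits (val b s)"
| "cost (Sub a b) s = cost a s + cost b s + bits (val a s) + bits (val b s)"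
| "cost (Mul a b) s = cost a s + cost b s + bits (val a s) * bits (val b s)"

text \<open>
  \<open>exec c s t s'\<close>: started in \<open>s\<close>, the program \<open>c\<close> halts in \<open>s'\<close> at total cost \<open>t\<close>. A
  non-terminating run has no derivation. Guards are true iff nonzero.
\<close>

inductive exec :: "com \<Rightarrow> state \<Rightarrow> nat \<Rightarrow> state \<Rightarrow> bool" where
  Skip: "exec Skip s 1 s"
| Write: "exec (Write x a b) s
     (cost a s + cost b s + bits (val a s) + bits (val b s))
     (s(x := (s x)(val a s := val b s)))"
| Seq: "\<lbrakk> exec c\<^sub>1 s t\<^sub>1 s'; exec c\<^sub>2 s' t\<^sub>2 s'' \<rbrakk> \<Longrightarrow> exec (Seq c\<^sub>1 c\<^sub>2) s (t\<^sub>1 + t\<^sub>2) s''"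
| CondTrue: "\<lbrakk> val b s \<noteq> 0; exec c\<^sub>1 s t s' \<rbrakk>
     \<Longrightarrow> exec (Cond b c\<^sub>1 c\<^sub>2) s (cost b s + bits (val b s) + t) s'"
| CondFalse: "\<lbrakk> val b s = 0; exec c\<^sub>2 s t s' \<rbrakk>
     \<Longrightarrow> exec (Cond b c\<^sub>1 c\<^sub>2) s (cost b s + bits (val b s) + t) s'"
| LoopFalse: "val b s = 0 \<Longrightarrow> exec (Loop b c) s (cost b s + bits (val b s)) s"
| LoopTrue: "\<lbrakk> val b s \<noteq> 0; exec c s t\<^sub>1 s'; exec (Loop b c) s' t\<^sub>2 s'' \<rbrakk>
     \<Longrightarrow> exec (Loop b c) s (cost b s + bits (val b s) + t\<^sub>1 + t\<^sub>2) s''"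

inductive_cases exec_SkipE: "exec Skip s t s'"
inductive_cases exec_WriteE: "exec (Write x a b) s t s'"
inductive_cases exec_SeqE: "exec (Seq c\<^sub>1 c\<^sub>2) s t s'"
inductive_cases exec_CondE: "exec (Cond b c\<^sub>1 c\<^sub>2) s t s'"
inductive_cases exec_LoopE: "exec (Loop b c) s t s'"

lemma exec_deterministic:
  "exec c s t s' \<Longrightarrow> exec c s u s'' \<Longrightarrow> u = t \<and> s'' = s'"
proof (induction arbitrary: u s'' rule: exec.induct)
  case (Skip s)
  from Skip.prems show ?case by (rule exec_SkipE) simp
next
  case (Write x a b s)
  from Write.prems show ?case by (rule exec_WriteE) simp
next
  case (Seq c\<^sub>1 s t\<^sub>1 s' c\<^sub>2 t\<^sub>2 s3)
  from Seq.prems obtain u\<^sub>1 r u\<^sub>2 where u: "u = u\<^sub>1 + u\<^sub>2"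
    and 1: "exec c\<^sub>1 s u\<^sub>1 r" and 2: "exec c\<^sub>2 r u\<^sub>2 s''" by (rule exec_SeqE)
  note eq = conjunct1[OF Seq.IH(1)[OF 1]] conjunct2[OF Seq.IH(1)[OF 1]]
  show ?case using Seq.IH(2)[OF 2[unfolded eq(2)]] unfolding u eq(1) by metis
next
  case (CondTrue b s c\<^sub>1 t s' c\<^sub>2)
  from CondTrue.prems CondTrue.hyps(1)
  obtain u\<^sub>1 where u: "u = cost b s + bits (val b s) + u\<^sub>1" and 1: "exec c\<^sub>1 s u\<^sub>1 s''"
    by (metis exec_CondE)
  show ?case using CondTrue.IH[OF 1] unfolding u by metis
next
  case (CondFalse b s c\<^sub>2 t s' c\<^sub>1)
  from CondFalse.prems CondFalse.hyps(1)
  obtain u\<^sub>1 where u: "u = cost b s + bits (val b s) + u\<^sub>1" and 1: "exec c\<^sub>2 s u\<^sub>1 s''"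
    by (metis exec_CondE less_irrefl)
  show ?case using CondFalse.IH[OF 1] unfolding u by metis
next
  case (LoopFalse b s c)
  from LoopFalse.prems LoopFalse.hyps show ?case by (metis exec_LoopE less_irrefl)
next
  case (LoopTrue b s c t\<^sub>1 s' t\<^sub>2 s3)
  from LoopTrue.prems LoopTrue.hyps(1)
  obtain u\<^sub>1 r u\<^sub>2 where u: "u = cost b s + bits (val b s) + u\<^sub>1 + u\<^sub>2"
    and 1: "exec c s u\<^sub>1 r" and 2: "exec (Loop b c) r u\<^sub>2 s''"
    by (metis exec_LoopE)
  note eq = conjunct1[OF LoopTrue.IH(1)[OF 1]] conjunct2[OF LoopTrue.IH(1)[OF 1]]
  show ?case using LoopTrue.IH(2)[OF 2[unfolded eq(2)]] unfolding u eq(1) by metis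
qed


section \<open>Solving Max Internal Spanning Tree\<close>

text \<open>
  The vertices are \<open>0, \<dots>, n - 1\<close>, and edge sets are passed as adjacency matrices stored row by row.
\<close>

definition adjacency :: "nat \<Rightarrow> nat set set \<Rightarrow> nat \<Rightarrow> nat" where
  "adjacency n E k = of_bool (k < n * n \<and> {k div n, k mod n} \<in> E)"

definition input_state :: "nat \<Rightarrow> nat set set \<Rightarrow> state" where
  "input_state n E = (\<lambda>_ _. 0)(''n'' := (\<lambda>_. 0)(0 := n), ''adj'' := adjacency n E)"

definition correct_output :: "nat \<Rightarrow> nat set set \<Rightarrow> state \<Rightarrow> bool" where
  "correct_output n E s \<longleftrightarrow>
     (if \<exists>T. spanning_tree {..<n} E T
      then s ''found'' 0 = 1 \<and>
        (\<exists>T. max_internal_spanning_tree {..<n} E T \<and>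
             (\<forall>k<n * n. s ''tree'' k = adjacency n T k))
      else s ''found'' 0 = 0)"

definition solves_MIST_on ::
  "(nat set \<Rightarrow> nat set set \<Rightarrow> bool) \<Rightarrow> com \<Rightarrow> (nat \<Rightarrow> nat) \<Rightarrow> bool" where
  "solves_MIST_on C c f \<longleftrightarrow>
     (\<forall>n E. simple_graph {..<n} E \<and> C {..<n} E \<longrightarrow>
        (\<exists>t s. exec c (input_state n E) t s \<and> t \<le> f n \<and> correct_output n E s))"

definition O_star :: "(nat \<Rightarrow> real) \<Rightarrow> (nat \<Rightarrow> real) set" where
  "O_star g = {f. \<exists>p :: real poly. \<forall>n. f n \<le> poly p (real n) * g n}"

end

theory Submission
  imports Defs "HOL-Library.FuncSet" "HOL-Library.Transitive_Closure_Table"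
begin

text \<open>
  A tree with few leaves is traversed by a sequence that extends the current path as long as possible
  and otherwise jumps back to a visited vertex; a tree with \<open>l \<ge> 2\<close> leaves needs \<open>l - 2\<close> jumps, and
  conversely \<open>j\<close> jumps produce at most \<open>j + 2\<close> leaves. So it suffices to search the states
  \<open>(S, v, j)\<close>: visited set, last vertex, number of jumps.

  If the smaller branch is always visited first, then every visited set \<open>S\<close> is separated from its
  complement by only \<open>O(log n)\<close> tree edges. As there are at most \<open>m - n + 1\<close> other edges, the cut
  around \<open>S\<close> has at most \<open>m - n + O(log n)\<close> edges, and all but \<open>O(log n)\<close> vertices have a neighbour
  on their own side. Only such sets are expanded.

  To count them, give the vertices random classes in \<open>{0..7}\<close> and encode the side of each vertex given
  the sides of its neighbours in smaller classes. By Kraft's inequality a family of sets in which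
  the average code length is at most \<open>M\<close> has at most \<open>(101/100) ^ M\<close> members, and here
  \<open>M = 62 n + O(log n)\<close>, while \<open>(101/100) ^ 62 < 1.8669\<close>.
\<close>

section \<open>Counting sparse cuts\<close>

text \<open>Dynamic programming over all visited sets costs about \<open>2 ^ n\<close>, so the gain
  rests on showing that few sets are expanded. How short a code word can be depends on how many
  neighbours are already known, and no fixed order of the vertices serves all sets. Averaging over
  random classes helps: for a vertex of degree \<open>m\<close> with \<open>d\<close> neighbours
  across, the mean length is at most \<open>62 + 24 * (d + 2 - m)\<close>, plus 500 if
  \<open>d = m\<close>. The correction is linear in \<open>d - m\<close>, so its sum over all
  vertices is the very quantity that sparsity bounds; 24 acts as a Lagrange multiplier. Vertices
  with \<open>d = m\<close> escape this estimate, but they are few, because their tree edges lie in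
  the cut. Convexity turns the mean length of a set into a lower bound for its mean share of the
  Kraft sum. Eight classes instead of a random order make every expectation a finite sum of
  integers. 62 is the largest exponent \<open>e\<close> with
  \<open>(101/100) ^ e \<le> 1.8669\<close>.\<close>

definition nbrs :: "'a set set \<Rightarrow> 'a \<Rightarrow> 'a set" where
  "nbrs E v = {u. {v, u} \<in> E}"

definition cut_nbrs :: "'a set set \<Rightarrow> 'a set \<Rightarrow> 'a \<Rightarrow> 'a set" where
  "cut_nbrs E S v = {u \<in> nbrs E v. (u \<in> S) \<noteq> (v \<in> S)}"

text \<open>
  Length, in units of \<open>log 101/100\<close>, of the code word for a vertex with \<open>j\<close> known neighbours of which
  \<open>i\<close> lie on the other side. The values were found numerically; the binding cases of
  \<open>average_cost_local\<close> below are the vertices of degree 3 with at most two neighbours across the cut.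
\<close>

definition code_length :: "nat \<Rightarrow> nat \<Rightarrow> nat" where
  "code_length j i =
     (if j = 0 then 70
      else if j = 1 then (if i = 0 then 42 else 108)
      else if j = 2 then (if i = 0 then 20 else if i = 1 then 70 else 173)
      else (if i = 0 then 1 else if i = 1 then 55 else if i = 2 then 87 else 512))"

section \<open>Numerical Kraft inequalities for the code lengths\<close>

lemma power_double_le: "x ^ k \<le> a \<Longrightarrow> a\<^sup>2 \<le> c \<Longrightarrow> 0 \<le> x \<Longrightarrow> x ^ (2 * k) \<le> c" for x a c :: real
  using power_mono[of "x ^ k" a 2] by (simp add: power_mult[symmetric] mult.commute)

text \<open>Rounding each square up to seven decimals keeps the rationals small; the binary
  expansions of the code lengths combine these powers.\<close>

lemma powers_100_101:
  "(100/101 :: real) ^ 2 \<le> 9802961/10^7" "(100/101 :: real) ^ 4 \<le> 9609805/10^7"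
  "(100/101 :: real) ^ 8 \<le> 9234836/10^7" "(100/101 :: real) ^ 16 \<le> 8528220/10^7"
  "(100/101 :: real) ^ 32 \<le> 7273054/10^7" "(100/101 :: real) ^ 64 \<le> 5289732/10^7"
  "(100/101 :: real) ^ 128 \<le> 2798127/10^7"
proof -
  note sq = power_double_le
  show p2: "(100/101 :: real) ^ 2 \<le> 9802961/10^7" by (simp add: power2_eq_square)
  show p4: "(100/101 :: real) ^ 4 \<le> 9609805/10^7"
    using sq[OF p2, of "9609805/10^7"] by (simp add: power2_eq_square)
  show p8: "(100/101 :: real) ^ 8 \<le> 9234836/10^7"
    using sq[OF p4, of "9234836/10^7"] by (simp add: power2_eq_square)
  show p16: "(100/101 :: real) ^ 16 \<le> 8528220/10^7"
    using sq[OF p8, of "8528220/10^7"] by (simp add: power2_eq_square)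
  show p32: "(100/101 :: real) ^ 32 \<le> 7273054/10^7"
    using sq[OF p16, of "7273054/10^7"] by (simp add: power2_eq_square)
  show p64: "(100/101 :: real) ^ 64 \<le> 5289732/10^7"
    using sq[OF p32, of "5289732/10^7"] by (simp add: power2_eq_square)
  show "(100/101 :: real) ^ 128 \<le> 2798127/10^7"
    using sq[OF p64, of "2798127/10^7"] by (simp add: power2_eq_square)
qed

lemma kraft_100_101:
  "(100/101 :: real) ^ 70 + (100/101) ^ 70 \<le> 1"
  "(100/101 :: real) ^ 42 + (100/101) ^ 108 \<le> 1"
  "(100/101 :: real) ^ 20 + (100/101) ^ 173 \<le> 1"
  "(100/101 :: real) ^ 55 + (100/101) ^ 87 \<le> 1"
  "(100/101 :: real) ^ 1 + (100/101) ^ 512 \<le> 1"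
proof -
  define y :: real where "y = 100/101"
  note p = powers_100_101[folded y_def]
  have y: "0 \<le> y" "y \<le> 1" by (simp_all add: y_def)
  have m: "a * b \<le> a' * b'" if "a \<le> a'" "b \<le> b'" "0 \<le> b" "0 \<le> a" for a b a' b' :: real
    using mult_mono[of a a' b b'] that by linarith
  have e: "y ^ 70 = y ^ 64 * (y ^ 4 * y ^ 2)" "y ^ 42 = y ^ 32 * (y ^ 8 * y ^ 2)"
    "y ^ 108 = y ^ 64 * (y ^ 32 * (y ^ 8 * y ^ 4))" "y ^ 20 = y ^ 16 * y ^ 4"
    "y ^ 173 = y ^ 128 * (y ^ 32 * (y ^ 8 * (y ^ 4 * y)))"
    "y ^ 55 = y ^ 32 * (y ^ 16 * (y ^ 4 * (y ^ 2 * y)))"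
    "y ^ 87 = y ^ 64 * (y ^ 16 * (y ^ 4 * (y ^ 2 * y)))"
    by (simp_all add: power_add[symmetric] power_Suc[symmetric] mult.commute[of _ y] del: power_Suc)
  have "y ^ 70 \<le> 5289732/10^7 * (9609805/10^7 * (9802961/10^7))" unfolding e
    by (intro m p mult_nonneg_nonneg zero_le_power y order_refl)
  then show "(100/101 :: real) ^ 70 + (100/101) ^ 70 \<le> 1" unfolding y_def[symmetric] by simp
  have "y ^ 42 \<le> 7273054/10^7 * (9234836/10^7 * (9802961/10^7))"
    "y ^ 108 \<le> 5289732/10^7 * (7273054/10^7 * (9234836/10^7 * (9609805/10^7)))" unfolding e
    by (intro m p mult_nonneg_nonneg zero_le_power y order_refl)+
  then show "(100/101 :: real) ^ 42 + (100/101) ^ 108 \<le> 1" unfolding y_def[symmetric] by simp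
  have "y ^ 20 \<le> 8528220/10^7 * (9609805/10^7)"
    "y ^ 173 \<le> 2798127/10^7 * (7273054/10^7 * (9234836/10^7 * (9609805/10^7 * (99010/10^5))))" unfolding e
    by (intro m p mult_nonneg_nonneg zero_le_power y order_refl; simp add: y_def)+
  then show "(100/101 :: real) ^ 20 + (100/101) ^ 173 \<le> 1" unfolding y_def[symmetric] by simp
  have "y ^ 55 \<le> 7273054/10^7 * (8528220/10^7 * (9609805/10^7 * (9802961/10^7 * (99010/10^5))))"
    "y ^ 87 \<le> 5289732/10^7 * (8528220/10^7 * (9609805/10^7 * (9802961/10^7 * (99010/10^5))))" unfolding e
    by (intro m p mult_nonneg_nonneg zero_le_power y order_refl; simp add: y_def)+
  then show "(100/101 :: real) ^ 55 + (100/101) ^ 87 \<le> 1" unfolding y_def[symmetric] by simp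
  have "y ^ 512 = (y ^ 128) ^ 4" by (simp add: power_mult[symmetric])
  also have "\<dots> \<le> (2798127/10^7) ^ 4" by (intro power_mono p zero_le_power y)
  finally have "y ^ 512 \<le> (2798127/10^7) ^ 4" .
  then show "(100/101 :: real) ^ 1 + (100/101) ^ 512 \<le> 1" unfolding y_def[symmetric]
    by (simp add: y_def power4_eq_xxxx)
qed

text \<open>Moving a vertex to the other side turns \<open>i\<close> known neighbours across into
  \<open>j - i\<close>, so the two code words that compete in one situation have indices with sum
  \<open>j\<close>. One inequality per pair of lengths suffices: 70/70, 42/108, 20/173, 55/87 and
  1/512.\<close>

lemma code_length_kraft:
  assumes "i + i' = j" "j \<le> 3"
  shows "(100/101 :: real) ^ code_length j i + (100/101) ^ code_length j i' \<le> 1"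
proof -
  have "i \<le> 3" "i' \<le> 3" using assms by auto
  then have "i = 0 \<or> i = 1 \<or> i = 2 \<or> i = 3" "i' = 0 \<or> i' = 1 \<or> i' = 2 \<or> i' = 3"
    "j = 0 \<or> j = 1 \<or> j = 2 \<or> j = 3" using assms by auto
  define f where "f a b \<longleftrightarrow> (100/101 :: real) ^ a + (100/101) ^ b \<le> 1" for a b
  have f: "f 70 70" "f 42 108" "f 20 173" "f 55 87" "f 1 512"
    unfolding f_def by (fact kraft_100_101)+
  have f_sym: "f b a" if "f a b" for a b using that unfolding f_def by (subst add.commute)
  have "code_length j i = 70 \<and> code_length j i' = 70 \<or>
    code_length j i = 42 \<and> code_length j i' = 108 \<or> code_length j i = 108 \<and> code_length j i' = 42 \<or>
    code_length j i = 20 \<and> code_length j i' = 173 \<or> code_length j i = 173 \<and> code_length j i' = 20 \<or>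
    code_length j i = 55 \<and> code_length j i' = 87 \<or> code_length j i = 87 \<and> code_length j i' = 55 \<or>
    code_length j i = 1 \<and> code_length j i' = 512 \<or> code_length j i = 512 \<and> code_length j i' = 1"
    using \<open>i = 0 \<or> _\<close> \<open>i' = 0 \<or> _\<close> \<open>j = 0 \<or> _\<close> assms by (elim disjE; simp add: code_length_def)
  then have "f (code_length j i) (code_length j i')"
    using f f[THEN f_sym] by (elim disjE conjE) (simp_all only:)
  then show ?thesis unfolding f_def .
qed

lemma choose_3_2: "(3::nat) choose 2 = 3" by (simp add: eval_nat_numeral)
lemma choose_3_1: "(3::nat) choose Suc 0 = 3" by (simp)
text \<open>The sum is \<open>8 ^ (m + 1)\<close> times the mean code length when a vertex and its
  \<open>m\<close> neighbours get independent classes: the vertex is in class \<open>i\<close>, and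
  \<open>a\<close> of the \<open>d\<close> neighbours across and \<open>b\<close> of the others fall
  below \<open>i\<close>. The term \<open>24 * m\<close> stands on the left to avoid truncated
  subtraction. Only ten pairs of \<open>m\<close> and \<open>d\<close> are to be evaluated.\<close>

lemma average_cost_local:
  assumes "m \<le> 3" "d \<le> m"
  shows "(\<Sum>i<8. \<Sum>a\<le>d. (d choose a) * (\<Sum>b\<le>m - d. (m - d choose b) *
            (i ^ (a + b) * (8 - i) ^ (m - (a + b)) * code_length (a + b) a))) + 8 ^ (m + 1) * (24 * m)
         \<le> 8 ^ (m + 1) * (62 + 24 * (d + 2) + 500 * of_bool (d = m))"
proof -
  have "m = 0 \<and> d = 0 \<or> m = 1 \<and> d = 0 \<or> m = 1 \<and> d = 1 \<or> m = 2 \<and> d = 0 \<or> m = 2 \<and> d = 1 \<or>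
    m = 2 \<and> d = 2 \<or> m = 3 \<and> d = 0 \<or> m = 3 \<and> d = 1 \<or> m = 3 \<and> d = 2 \<or> m = 3 \<and> d = 3"
    using assms by presburger
  then show ?thesis
    by (elim disjE conjE; simp add: code_length_def lessThan_nat_numeral atMost_nat_numeral atMost_Suc
        choose_3_2 choose_3_1)
qed

text \<open>Only strictly smaller classes count as known, so a set can be decoded class by class; a
  tie merely leaves the neighbour unknown.\<close>

definition known_cost :: "('a \<Rightarrow> 'a set) \<Rightarrow> ('a \<Rightarrow> nat) \<Rightarrow> 'a set \<Rightarrow> 'a \<Rightarrow> nat" where
  "known_cost N \<tau> S v = code_length (card {u \<in> N v. \<tau> u < \<tau> v})
     (card {u \<in> N v. \<tau> u < \<tau> v \<and> (u \<in> S) \<noteq> (v \<in> S)})"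

text \<open>This is Kraft's inequality for fixed classes. Adding a vertex of maximal class splits
  every \<open>S\<close> in two; no other code word refers to this vertex, and its own two words
  contribute at most 1 by \<open>code_length_kraft\<close>. Neighbours outside \<open>V\<close> are
  allowed, since \<open>V\<close> shrinks in the induction while \<open>N\<close> stays.\<close>

lemma sum_code_le_1:
  assumes "finite V" and "\<And>v. v \<in> V \<Longrightarrow> finite (N v) \<and> card (N v) \<le> 3"
  shows "(\<Sum>S\<in>Pow V. \<Prod>v\<in>V. (100/101 :: real) ^ known_cost N \<tau> S v) \<le> 1"
  using assms
proof (induction V rule: finite_ranking_induct[where f = \<tau>])
  case empty
  then show ?case by simp
next
  case (insert v V)
  show ?case
  proof (cases "v \<in> V")
    case True
    then show ?thesis using insert.IH insert.prems by (simp add: insert_absorb)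
  next
    case False
    let ?y = "100/101 :: real"
    \<comment> \<open>The class of \<open>v\<close> is maximal, so \<open>v\<close> is never a known
      neighbour of a vertex \<open>w\<close> in \<open>V\<close>.\<close>
    have *: "(\<Prod>w\<in>V. ?y ^ known_cost N \<tau> (insert v S) w) = (\<Prod>w\<in>V. ?y ^ known_cost N \<tau> S w)" for S
    proof (rule prod.cong[OF refl])
      fix w assume w: "w \<in> V"
      have "{u \<in> N w. \<tau> u < \<tau> w \<and> (u \<in> insert v S) \<noteq> (w \<in> insert v S)} =
            {u \<in> N w. \<tau> u < \<tau> w \<and> (u \<in> S) \<noteq> (w \<in> S)}"
        using False insert.hyps(2)[OF w] w by auto
      then show "?y ^ known_cost N \<tau> (insert v S) w = ?y ^ known_cost N \<tau> S w"
        by (simp add: known_cost_def)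
    qed
    have kraft: "?y ^ known_cost N \<tau> S v + ?y ^ known_cost N \<tau> (insert v S) v \<le> 1"
      if "S \<subseteq> V" for S
    proof -
      have fin: "finite (N v)" and c3: "card (N v) \<le> 3" using insert.prems by auto
      have v: "v \<notin> S" using that False by auto
      let ?K = "{u \<in> N v. \<tau> u < \<tau> v}"
      let ?Kd = "{u \<in> N v. \<tau> u < \<tau> v \<and> (u \<in> S) \<noteq> (v \<in> S)}"
      let ?Ke = "{u \<in> N v. \<tau> u < \<tau> v \<and> (u \<in> insert v S) \<noteq> (v \<in> insert v S)}"
      have K0: "?Kd = {u \<in> N v. \<tau> u < \<tau> v \<and> u \<in> S}" using v by auto
      have K1: "?Ke = {u \<in> N v. \<tau> u < \<tau> v \<and> u \<notin> S}"
        using v by (intro Collect_cong) (simp; metis order_less_irrefl)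
      have K: "?K = {u \<in> N v. \<tau> u < \<tau> v \<and> u \<in> S} \<union> {u \<in> N v. \<tau> u < \<tau> v \<and> u \<notin> S}" by blast
      have "card ?Kd + card ?Ke = card ?K"
        unfolding K0 K1 K using fin by (intro card_Un_disjoint[symmetric]) auto
      moreover have "card ?K \<le> 3"
        using card_mono[OF fin, of ?K] c3 by auto
      ultimately show ?thesis
        unfolding known_cost_def by (intro code_length_kraft[of "card ?Kd" "card ?Ke" "card ?K"])
    qed
    have "(\<Sum>S\<in>Pow (insert v V). \<Prod>w\<in>insert v V. ?y ^ known_cost N \<tau> S w) =
          (\<Sum>S\<in>Pow V. \<Prod>w\<in>insert v V. ?y ^ known_cost N \<tau> S w) +
          (\<Sum>S\<in>insert v ` Pow V. \<Prod>w\<in>insert v V. ?y ^ known_cost N \<tau> S w)"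
      unfolding Pow_insert using insert.hyps(1) False by (intro sum.union_disjoint) auto
    also have "(\<Sum>S\<in>insert v ` Pow V. \<Prod>w\<in>insert v V. ?y ^ known_cost N \<tau> S w) =
          (\<Sum>S\<in>Pow V. \<Prod>w\<in>insert v V. ?y ^ known_cost N \<tau> (insert v S) w)"
      using False by (subst sum.reindex) (auto simp: inj_on_def intro!: sum.cong)
    also have "(\<Sum>S\<in>Pow V. \<Prod>w\<in>insert v V. ?y ^ known_cost N \<tau> S w) + \<dots> =
          (\<Sum>S\<in>Pow V. (?y ^ known_cost N \<tau> S v + ?y ^ known_cost N \<tau> (insert v S) v) *
             (\<Prod>w\<in>V. ?y ^ known_cost N \<tau> S w))"
      unfolding sum.distrib[symmetric] using insert.hyps(1) False
      by (intro sum.cong refl) (simp only: * prod.insert distrib_right not_False_eq_True)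
    also have "\<dots> \<le> (\<Sum>S\<in>Pow V. 1 * (\<Prod>w\<in>V. ?y ^ known_cost N \<tau> S w))"
      using kraft by (intro sum_mono mult_right_mono prod_nonneg) auto
    also have "\<dots> \<le> 1" using insert.IH insert.prems by simp
    finally show ?thesis .
  qed
qed

section \<open>Averaging code lengths over random vertex classes\<close>

lemma card_class_pattern:
  assumes "finite V" "v \<in> V" "N \<subseteq> V - {v}" "A \<subseteq> N" "i < k"
  shows "card {\<tau> \<in> PiE V (\<lambda>_. {..<k}). \<tau> v = i \<and> {u \<in> N. \<tau> u < \<tau> v} = A} =
         i ^ card A * (k - i) ^ (card N - card A) * k ^ (card V - 1 - card N)"
proof -
  have finN: "finite N" using assms finite_subset by blast
  \<comment> \<open>Once the class of \<open>v\<close> is fixed, the pattern constrains every vertex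
    separately, so it is a product set.\<close>
  let ?B = "\<lambda>u. if u = v then {i} else if u \<in> A then {..<i} else if u \<in> N then {i..<k} else {..<k}"
  have "{\<tau> \<in> PiE V (\<lambda>_. {..<k}). \<tau> v = i \<and> {u \<in> N. \<tau> u < \<tau> v} = A} = PiE V ?B"
  proof (intro set_eqI iffI)
    fix \<tau> assume "\<tau> \<in> {\<tau> \<in> PiE V (\<lambda>_. {..<k}). \<tau> v = i \<and> {u \<in> N. \<tau> u < \<tau> v} = A}"
    then show "\<tau> \<in> PiE V ?B"
      using assms(3,5) by (fastforce simp: PiE_iff not_less)
  next
    fix \<tau> assume *: "\<tau> \<in> PiE V ?B"
    have B: "\<tau> u \<in> ?B u" if "u \<in> V" for u using * that by (auto simp: PiE_iff)
    have "\<tau> v = i" using B[OF assms(2)] by simp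
    moreover have "\<tau> u < k" if "u \<in> V" for u using B[OF that] assms by (auto split: if_splits)
    moreover have "\<tau> u < i \<longleftrightarrow> u \<in> A" if "u \<in> N" for u
    proof -
      have "u \<in> V" "u \<noteq> v" using that assms(3) by auto
      from B[OF this(1)] this(2) that show ?thesis by (auto split: if_splits)
    qed
    ultimately show "\<tau> \<in> {\<tau> \<in> PiE V (\<lambda>_. {..<k}). \<tau> v = i \<and> {u \<in> N. \<tau> u < \<tau> v} = A}"
      using * assms(4) by (auto simp: PiE_iff)
  qed
  then have "card {\<tau> \<in> PiE V (\<lambda>_. {..<k}). \<tau> v = i \<and> {u \<in> N. \<tau> u < \<tau> v} = A} =
     (\<Prod>u\<in>V. card (?B u))"
    using assms(1) by (simp add: card_PiE)
  also have "\<dots> = card (?B v) * (\<Prod>u\<in>V - {v}. card (?B u))"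
    using assms(1,2) by (rule prod.remove)
  also have "(\<Prod>u\<in>V - {v}. card (?B u)) = (\<Prod>u\<in>V - {v} - N. card (?B u)) * (\<Prod>u\<in>N. card (?B u))"
    using assms(1,3) by (intro prod.subset_diff) auto
  also have "(\<Prod>u\<in>N. card (?B u)) = (\<Prod>u\<in>N - A. card (?B u)) * (\<Prod>u\<in>A. card (?B u))"
    using assms(4) finN by (intro prod.subset_diff)
  also have "(\<Prod>u\<in>A. card (?B u)) = (\<Prod>u\<in>A. i)" using assms by (intro prod.cong) auto
  also have "(\<Prod>u\<in>N - A. card (?B u)) = (\<Prod>u\<in>N - A. k - i)" using assms by (intro prod.cong) auto
  also have "(\<Prod>u\<in>V - {v} - N. card (?B u)) = (\<Prod>u\<in>V - {v} - N. k)" using assms by (intro prod.cong) auto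
  finally have "card {\<tau> \<in> PiE V (\<lambda>_. {..<k}). \<tau> v = i \<and> {u \<in> N. \<tau> u < \<tau> v} = A} =
      k ^ card (V - {v} - N) * ((k - i) ^ card (N - A) * i ^ card A)" by simp
  moreover have "card (N - A) = card N - card A"
    using assms(4) finN by (meson card_Diff_subset finite_subset)
  moreover have "card (V - {v} - N) = card V - 1 - card N"
    using assms(1-3) finN by (simp add: card_Diff_subset)
  ultimately show ?thesis by (simp add: mult.commute mult.left_commute)
qed

lemma sum_classes:
  fixes f :: "'a set \<Rightarrow> nat"
  assumes "finite V" "v \<in> V" "N \<subseteq> V - {v}"
  shows "(\<Sum>\<tau>\<in>PiE V (\<lambda>_. {..<k}). f {u \<in> N. \<tau> u < \<tau> v}) =
         k ^ (card V - 1 - card N) *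
         (\<Sum>i<k. \<Sum>A\<in>Pow N. i ^ card A * (k - i) ^ (card N - card A) * f A)"
proof -
  let ?T = "PiE V (\<lambda>_. {..<k})"
  let ?g = "\<lambda>\<tau>. (\<tau> v, {u \<in> N. \<tau> u < \<tau> v})"
  have finN: "finite N" using assms finite_subset by blast
  have finT: "finite ?T" using assms by (intro finite_PiE) auto
  have "(\<Sum>\<tau>\<in>?T. f {u \<in> N. \<tau> u < \<tau> v}) =
     (\<Sum>p\<in>{..<k} \<times> Pow N. \<Sum>\<tau>\<in>{\<tau>\<in>?T. ?g \<tau> = p}. f {u \<in> N. \<tau> u < \<tau> v})"
    using finT finN assms(2) by (intro sum.group[symmetric]) (auto simp: PiE_iff)
  also have "\<dots> = (\<Sum>p\<in>{..<k} \<times> Pow N. k ^ (card V - 1 - card N) *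
       (fst p ^ card (snd p) * (k - fst p) ^ (card N - card (snd p)) * f (snd p)))"
  proof (rule sum.cong[OF refl])
    fix p assume p: "p \<in> {..<k} \<times> Pow N"
    have "(\<Sum>\<tau>\<in>{\<tau>\<in>?T. ?g \<tau> = p}. f {u \<in> N. \<tau> u < \<tau> v}) = (\<Sum>\<tau>\<in>{\<tau>\<in>?T. ?g \<tau> = p}. f (snd p))"
      by (intro sum.cong) auto
    also have "\<dots> = card {\<tau> \<in> ?T. \<tau> v = fst p \<and> {u \<in> N. \<tau> u < \<tau> v} = snd p} * f (snd p)"
      by (simp add: prod_eq_iff)
    also have "\<dots> = k ^ (card V - 1 - card N) *
       (fst p ^ card (snd p) * (k - fst p) ^ (card N - card (snd p)) * f (snd p))"
      using p by (subst card_class_pattern[OF assms]) auto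
    finally show "(\<Sum>\<tau>\<in>{\<tau>\<in>?T. ?g \<tau> = p}. f {u \<in> N. \<tau> u < \<tau> v}) = k ^ (card V - 1 - card N) *
       (fst p ^ card (snd p) * (k - fst p) ^ (card N - card (snd p)) * f (snd p))" .
  qed
  finally show ?thesis
    by (simp add: sum_distrib_left sum.cartesian_product case_prod_beta)
qed

lemma sum_Pow_card:
  fixes h :: "nat \<Rightarrow> nat"
  assumes "finite D"
  shows "(\<Sum>A\<in>Pow D. h (card A)) = (\<Sum>a\<le>card D. (card D choose a) * h a)"
proof -
  have "(\<Sum>A\<in>Pow D. h (card A)) = (\<Sum>a\<le>card D. \<Sum>A\<in>{A\<in>Pow D. card A = a}. h (card A))"
    using assms by (intro sum.group[symmetric]) (auto intro: card_mono)
  also have "\<dots> = (\<Sum>a\<le>card D. card {A. A \<subseteq> D \<and> card A = a} * h a)"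
    by (intro sum.cong) auto
  finally show ?thesis by (simp add: n_subsets[OF assms])
qed

text \<open>Subsets are sorted by their share in \<open>D\<close> and in \<open>N - D\<close>: for
  known neighbours, those across the cut and those on the own side.\<close>

lemma sum_Pow_split:
  fixes h :: "nat \<Rightarrow> nat \<Rightarrow> nat"
  assumes "finite N" "D \<subseteq> N"
  shows "(\<Sum>A\<in>Pow N. h (card A) (card (A \<inter> D))) =
    (\<Sum>a\<le>card D. (card D choose a) *
       (\<Sum>b\<le>card N - card D. (card N - card D choose b) * h (a + b) a))"
proof -
  have finD: "finite D" using assms finite_subset by blast
  have "(\<Sum>A\<in>Pow N. h (card A) (card (A \<inter> D))) =
        (\<Sum>(A, B)\<in>Pow D \<times> Pow (N - D). h (card A + card B) (card A))"
  proof (rule sum.reindex_bij_witness[where j = "\<lambda>A. (A \<inter> D, A - D)" and i = "\<lambda>(A, B). A \<union> B"])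
    fix A assume A: "A \<in> Pow N"
    then have "finite A" using assms finite_subset by blast
    have "(A \<inter> D) \<union> (A - D) = A" "(A \<inter> D) \<inter> (A - D) = {}" by auto
    then have "card (A \<inter> D) + card (A - D) = card A"
      using card_Un_disjoint[of "A \<inter> D" "A - D"] \<open>finite A\<close> by simp
    then show "(case (A \<inter> D, A - D) of (A, B) \<Rightarrow> h (card A + card B) (card A)) =
      h (card A) (card (A \<inter> D))" by simp
  qed (use assms in auto)
  also have "\<dots> = (\<Sum>A\<in>Pow D. \<Sum>B\<in>Pow (N - D). h (card A + card B) (card A))"
    by (simp add: sum.cartesian_product)
  also have "\<dots> = (\<Sum>A\<in>Pow D. \<Sum>b\<le>card (N - D). (card (N - D) choose b) * h (card A + b) (card A))"
    using assms(1) by (intro sum.cong refl sum_Pow_card) auto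
  also have "card (N - D) = card N - card D" using assms finD by (intro card_Diff_subset) auto
  also have "(\<Sum>A\<in>Pow D. \<Sum>b\<le>card N - card D. (card N - card D choose b) * h (card A + b) (card A)) =
    (\<Sum>a\<le>card D. (card D choose a) * (\<Sum>b\<le>card N - card D. (card N - card D choose b) * h (a + b) a))"
    by (rule sum_Pow_card[OF finD, of "\<lambda>a. \<Sum>b\<le>card N - card D. (card N - card D choose b) * h (a + b) a"])
  finally show ?thesis .
qed

lemma average_cost:
  assumes "finite V" "v \<in> V" "N v \<subseteq> V - {v}" "card (N v) \<le> 3"
    and "D = {u \<in> N v. (u \<in> S) \<noteq> (v \<in> S)}"
  shows "(\<Sum>\<tau>\<in>PiE V (\<lambda>_. {..<8}). known_cost N \<tau> S v) + 8 ^ card V * (24 * card (N v))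
         \<le> 8 ^ card V * (62 + 24 * (card D + 2) + 500 * of_bool (card D = card (N v)))"
proof -
  have fin: "finite (N v)" using assms finite_subset by blast
  have D: "D \<subseteq> N v" using assms(5) by auto
  let ?f = "\<lambda>A. code_length (card A) (card (A \<inter> D))"
  let ?m = "card (N v)"
  have "?m \<le> card (V - {v})" using assms by (intro card_mono) auto
  \<comment> \<open>The classes of the vertices other than \<open>v\<close> and its neighbours are
    free, which gives the common factor \<open>8 ^ (card V - 1 - ?m)\<close>.\<close>
  then have mV: "card V = (card V - 1 - ?m) + (?m + 1)"
    using assms(1,2) card_gt_0_iff[of V] by auto
  have "known_cost N \<tau> S v = ?f {u \<in> N v. \<tau> u < \<tau> v}" for \<tau>
  proof -
    have "{u \<in> N v. \<tau> u < \<tau> v} \<inter> D = {u \<in> N v. \<tau> u < \<tau> v \<and> (u \<in> S) \<noteq> (v \<in> S)}"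
      using assms(5) by auto
    then show ?thesis by (simp add: known_cost_def)
  qed
  then have "(\<Sum>\<tau>\<in>PiE V (\<lambda>_. {..<8}). known_cost N \<tau> S v) =
    8 ^ (card V - 1 - ?m) * (\<Sum>i<8. \<Sum>A\<in>Pow (N v). i ^ card A * (8 - i) ^ (?m - card A) * ?f A)"
    using sum_classes[OF assms(1-3), of ?f 8] by simp
  also have "(\<Sum>i<8. \<Sum>A\<in>Pow (N v). i ^ card A * (8 - i) ^ (?m - card A) * ?f A) =
    (\<Sum>i<8. \<Sum>a\<le>card D. (card D choose a) * (\<Sum>b\<le>?m - card D. (?m - card D choose b) *
            (i ^ (a + b) * (8 - i) ^ (?m - (a + b)) * code_length (a + b) a)))"
    by (intro sum.cong refl sum_Pow_split[OF fin D,
          where h = "\<lambda>p q. i ^ p * (8 - i) ^ (?m - p) * code_length p q" for i])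
  finally have eq: "(\<Sum>\<tau>\<in>PiE V (\<lambda>_. {..<8}). known_cost N \<tau> S v) = 8 ^ (card V - 1 - ?m) * \<dots>" .
  have "card D \<le> ?m" using fin D by (rule card_mono)
  from mult_le_mono2[OF average_cost_local[OF assms(4) this], of "8 ^ (card V - 1 - ?m)"]
  have "8 ^ (card V - 1 - ?m) * (\<Sum>i<8. \<Sum>a\<le>card D. (card D choose a) * (\<Sum>b\<le>?m - card D. (?m - card D choose b) *
            (i ^ (a + b) * (8 - i) ^ (?m - (a + b)) * code_length (a + b) a))) +
     (8 ^ (card V - 1 - ?m) * 8 ^ (?m + 1)) * (24 * ?m) \<le>
     (8 ^ (card V - 1 - ?m) * 8 ^ (?m + 1)) * (62 + 24 * (card D + 2) + 500 * of_bool (card D = ?m))"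
    by (simp only: ring_distribs mult.assoc)
  also have "8 ^ (card V - 1 - ?m) * 8 ^ (?m + 1) = (8::nat) ^ card V"
    by (metis mV power_add)
  finally show ?thesis unfolding eq .
qed

text \<open>The arithmetic-geometric mean inequality, proved by the tangent of \<open>exp\<close> at the mean.\<close>

lemma mean_power_ge:
  fixes c :: "'a \<Rightarrow> nat" and y :: real
  assumes "finite T" "0 < y" "y < 1" "(\<Sum>t\<in>T. c t) \<le> card T * M"
  shows "card T * y ^ M \<le> (\<Sum>t\<in>T. y ^ c t)"
proof -
  have lny: "ln y < 0" using assms by simp
  have le: "y ^ M * (1 + (real (c t) - real M) * ln y) \<le> y ^ c t" for t
  proof -
    have "1 + (real (c t) - real M) * ln y \<le> exp ((real (c t) - real M) * ln y)"
      by (rule exp_ge_add_one_self)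
    also have "\<dots> = y powr (real (c t) - real M)" using assms by (simp add: powr_def)
    also have "\<dots> = y ^ c t / y ^ M" using assms by (simp add: powr_diff powr_realpow)
    finally show ?thesis using assms by (simp add: field_simps)
  qed
  have "real (\<Sum>t\<in>T. c t) \<le> real (card T * M)" using assms(4) by (rule of_nat_mono)
  then have "(\<Sum>t\<in>T. real (c t) - real M) \<le> 0" by (simp add: sum_subtractf)
  then have "0 \<le> (\<Sum>t\<in>T. real (c t) - real M) * ln y"
    using lny by (simp add: mult_nonpos_nonpos)
  then have "0 \<le> y ^ M * ((\<Sum>t\<in>T. real (c t) - real M) * ln y)"
    using assms by (intro mult_nonneg_nonneg[of "y ^ M"]) auto
  then have "card T * y ^ M \<le> y ^ M * (card T + (\<Sum>t\<in>T. real (c t) - real M) * ln y)"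
    unfolding distrib_left mult.commute[of "real (card T)"] by linarith
  also have "\<dots> = (\<Sum>t\<in>T. y ^ M * (1 + (real (c t) - real M) * ln y))"
    by (simp add: sum_distrib_left sum_distrib_right sum.distrib ring_distribs)
  also have "\<dots> \<le> (\<Sum>t\<in>T. y ^ c t)" using le by (rule sum_mono)
  finally show ?thesis .
qed

text \<open>By handshaking, the first inequality says that the cut has at most
  \<open>card E - card V + 1 + L\<close> edges; the doubled form can be summed vertex by vertex. The
  second bounds the vertices without a neighbour on their own side, isolated ones included.\<close>

definition sparse_cut :: "'a set \<Rightarrow> 'a set set \<Rightarrow> nat \<Rightarrow> 'a set \<Rightarrow> bool" where
  "sparse_cut V E L S \<longleftrightarrow>
     (\<Sum>v\<in>V. card (cut_nbrs E S v)) + 2 * card V \<le> (\<Sum>v\<in>V. card (nbrs E v)) + 2 + 2 * L \<and>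
     card {v \<in> V. card (cut_nbrs E S v) = card (nbrs E v)} \<le> 2 * L"

section \<open>Neighbourhoods and the number of sparse cuts\<close>

lemma simple_graph_finite_edges: "simple_graph V E \<Longrightarrow> finite E"
  unfolding simple_graph_def by (meson Pow_iff finite_Pow_iff finite_subset subsetI)

lemma nbrs_subset: "simple_graph V E \<Longrightarrow> nbrs E v \<subseteq> V - {v}"
  by (fastforce simp: simple_graph_def nbrs_def)

lemma card_nbrs: "card (nbrs E v) = vertex_degree E v" if "simple_graph V E"
proof -
  have "bij_betw (\<lambda>u. {v, u}) (nbrs E v) {e \<in> E. v \<in> e}"
  proof (rule bij_betw_imageI)
    show "inj_on (\<lambda>u. {v, u}) (nbrs E v)" by (auto simp: inj_on_def doubleton_eq_iff)
    have "e \<in> (\<lambda>u. {v, u}) ` nbrs E v" if e: "e \<in> E" "v \<in> e" for e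
    proof -
      have "card e = 2" using e \<open>simple_graph V E\<close> by (auto simp: simple_graph_def)
      then obtain a b where "e = {a, b}" by (auto simp: card_2_iff)
      then show ?thesis using e by (auto simp: nbrs_def insert_commute)
    qed
    then show "(\<lambda>u. {v, u}) ` nbrs E v = {e \<in> E. v \<in> e}" by (auto simp: nbrs_def)
  qed
  then show ?thesis unfolding vertex_degree_def by (rule bij_betw_same_card)
qed

text \<open>The Kraft sum is averaged over all classes: each choice of classes contributes at most
  1, while each sparse set has mean share at least \<open>(100/101) ^ ?M\<close>, because its mean
  total length is at most \<open>?M\<close>. In the exponent, \<open>48 * L + 48\<close> is 24 times
  the slack \<open>2 + 2 * L\<close>, and \<open>1000 * L\<close> charges 500 to each of
  \<open>2 * L\<close> exceptional vertices.\<close>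

theorem card_sparse_cut:
  assumes "simple_graph V E" "subcubic V E"
  shows "real (card {S \<in> Pow V. sparse_cut V E L S}) \<le> (101/100) ^ (62 * card V + 1048 * L + 48)"
proof -
  let ?F = "{S \<in> Pow V. sparse_cut V E L S}"
  let ?N = "nbrs E"
  let ?y = "100/101 :: real"
  let ?T = "PiE V (\<lambda>_. {..<8::nat})"
  let ?M = "62 * card V + 1048 * L + 48"
  have finV: "finite V" using assms(1) by (simp add: simple_graph_def)
  have N: "?N v \<subseteq> V - {v}" for v using assms(1) by (rule nbrs_subset)
  have N3: "card (?N v) \<le> 3" if "v \<in> V" for v
    using that assms by (simp add: card_nbrs subcubic_def)
  have finN: "finite (?N v)" for v using N[of v] finV finite_subset by blast
  have finT: "finite ?T" using finV by (intro finite_PiE) auto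
  have cardT: "card ?T = 8 ^ card V" using finV by (simp add: card_PiE)
  have avg: "card ?T * ?y ^ ?M \<le> (\<Sum>\<tau>\<in>?T. ?y ^ (\<Sum>v\<in>V. known_cost ?N \<tau> S v))" if "S \<in> ?F" for S
  proof (rule mean_power_ge[OF finT])
    have sp: "sparse_cut V E L S" using that by simp
    let ?d = "\<lambda>v. card (cut_nbrs E S v)"
    let ?bad = "{v \<in> V. ?d v = card (?N v)}"
    have "(\<Sum>\<tau>\<in>?T. \<Sum>v\<in>V. known_cost ?N \<tau> S v) + 8 ^ card V * (24 * (\<Sum>v\<in>V. card (?N v))) =
       (\<Sum>v\<in>V. (\<Sum>\<tau>\<in>?T. known_cost ?N \<tau> S v) + 8 ^ card V * (24 * card (?N v)))"
      by (subst sum.swap) (simp add: sum.distrib sum_distrib_left)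
    also have "\<dots> \<le> (\<Sum>v\<in>V. 8 ^ card V * (62 + 24 * (?d v + 2) + 500 * of_bool (?d v = card (?N v))))"
      using finV N N3 by (intro sum_mono average_cost) (auto simp: cut_nbrs_def)
    also have "\<dots> = 8 ^ card V * (62 * card V + 24 * ((\<Sum>v\<in>V. ?d v) + 2 * card V) + 500 * card ?bad)"
    proof -
      have "(\<Sum>v\<in>V. of_bool (?d v = card (?N v))) = card ?bad"
        using finV by (simp add: of_bool_def sum.If_cases Int_def)
      then show ?thesis
        by (simp add: sum_distrib_left[symmetric] sum.distrib ring_distribs)
    qed
    \<comment> \<open>Sparsity replaces the sum of all \<open>?d v + 2\<close> by the degree sum
      plus slack; the degree sum then cancels against the summand on the left-hand side.\<close>
    also have "\<dots> \<le> 8 ^ card V * (62 * card V + 24 * ((\<Sum>v\<in>V. card (?N v)) + 2 + 2 * L) + 500 * (2 * L))"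
      by (rule mult_le_mono2, rule add_mono, rule add_mono, rule order_refl, rule mult_le_mono2,
          rule sp[unfolded sparse_cut_def, THEN conjunct1], rule mult_le_mono2,
          rule sp[unfolded sparse_cut_def, THEN conjunct2])
    finally show "(\<Sum>\<tau>\<in>?T. \<Sum>v\<in>V. known_cost ?N \<tau> S v) \<le> card ?T * ?M"
      unfolding cardT by (simp add: ring_distribs)
  qed auto
  have "card ?F * (card ?T * ?y ^ ?M) = (\<Sum>S\<in>?F. card ?T * ?y ^ ?M)" by simp
  also have "\<dots> \<le> (\<Sum>S\<in>?F. \<Sum>\<tau>\<in>?T. ?y ^ (\<Sum>v\<in>V. known_cost ?N \<tau> S v))"
    using avg by (rule sum_mono)
  also have "\<dots> \<le> (\<Sum>S\<in>Pow V. \<Sum>\<tau>\<in>?T. ?y ^ (\<Sum>v\<in>V. known_cost ?N \<tau> S v))"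
    using finV by (intro sum_mono2 sum_nonneg) auto
  also have "\<dots> = (\<Sum>\<tau>\<in>?T. \<Sum>S\<in>Pow V. \<Prod>v\<in>V. ?y ^ known_cost ?N \<tau> S v)"
    by (subst sum.swap) (simp add: power_sum)
  also have "\<dots> \<le> (\<Sum>\<tau>\<in>?T. 1)"
    using finV finN N3 by (intro sum_mono sum_code_le_1) auto
  finally have "(real (card ?F) * ?y ^ ?M) * real (card ?T) \<le> 1 * real (card ?T)"
    by (simp only: sum_constant mult.assoc mult.commute[of "real (card ?T)"] of_nat_1 mult_1 mult_1_right)
  moreover have "0 < real (card ?T)" unfolding cardT by simp
  ultimately have "real (card ?F) * ?y ^ ?M \<le> 1"
    by (simp only: mult_le_cancel_right_pos)
  then have "real (card ?F) * ?y ^ ?M * (101/100) ^ ?M \<le> 1 * (101/100) ^ ?M"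
    by (rule mult_right_mono) simp
  moreover have "?y ^ ?M * (101/100) ^ ?M = 1"
    unfolding power_mult_distrib[symmetric] by simp
  ultimately show ?thesis by (simp only: mult.assoc mult_1 mult_1_right)
qed

section \<open>Traversals of trees\<close>

abbreviation edge_rel :: "'a set set \<Rightarrow> ('a \<times> 'a) set" where
  "edge_rel E \<equiv> {(x, y). {x, y} \<in> E}"

text \<open>A rooted tree is cut at one edge of its root: \<open>B\<close> is the subtree of the
  child \<open>b\<close>, and \<open>A\<close> is the rest, still rooted at \<open>a\<close>. Trees
  of any degree thus become binary objects, and every induction handles two pieces and one joining
  edge.\<close>

inductive rtree :: "'a set \<Rightarrow> 'a set set \<Rightarrow> 'a \<Rightarrow> bool" where
  single: "rtree {r} {} r"
| join: "rtree A TA a \<Longrightarrow> rtree B TB b \<Longrightarrow> A \<inter> B = {} \<Longrightarrow> rtree (A \<union> B) (insert {a, b} (TA \<union> TB)) a"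

lemma rtree_props:
  assumes "rtree V T r"
  shows "finite V" "r \<in> V" "finite T" "\<forall>e\<in>T. e \<subseteq> V \<and> card e = 2" "card V = Suc (card T)"
proof -
  have "finite V \<and> r \<in> V \<and> finite T \<and> (\<forall>e\<in>T. e \<subseteq> V \<and> card e = 2) \<and> card V = Suc (card T)"
    using assms
  proof (induction rule: rtree.induct)
    case (single r)
    then show ?case by simp
  next
    case (join A TA a B TB b)
    then have ab: "a \<noteq> b" by auto
    have "TA \<inter> TB = {}"
    proof (rule ccontr)
      assume "TA \<inter> TB \<noteq> {}"
      then obtain e where "e \<in> TA" "e \<in> TB" by auto
      then have "e \<subseteq> A" "e \<subseteq> B" "card e = 2" using join.IH by blast+
      then have "e = {}" using join.hyps(3) by blast
      then show False using \<open>card e = 2\<close> by simp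
    qed
    moreover have "{a, b} \<notin> TA" "{a, b} \<notin> TB" using join.IH join.hyps(3) by blast+
    ultimately have "card (insert {a, b} (TA \<union> TB)) = Suc (card TA + card TB)"
      using join by (simp add: card_Un_disjoint)
    moreover have "card (A \<union> B) = card A + card B" using join by (simp add: card_Un_disjoint)
    ultimately show ?case using join ab by auto
  qed
  then show "finite V" "r \<in> V" "finite T" "\<forall>e\<in>T. e \<subseteq> V \<and> card e = 2" "card V = Suc (card T)"
    by auto
qed

text \<open>The rule \<open>join\<close> decomposes at the root, whereas connectivity supplies new
  leaves anywhere; this lemma lets \<open>tree_imp_rtree\<close> grow a tree vertex by
  vertex.\<close>

lemma rtree_pendant:
  assumes "rtree A T r" "x \<in> A" "w \<notin> A"
  shows "rtree (insert w A) (insert {x, w} T) r"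
  using assms
proof (induction rule: rtree.induct)
  case (single r)
  then show ?case using rtree.join[OF rtree.single[of r] rtree.single[of w]]
    by (simp add: insert_commute)
next
  case (join A TA a B TB b)
  show ?case
  proof (cases "x \<in> A")
    case True
    then have "rtree (insert w A \<union> B) (insert {a, b} (insert {x, w} TA \<union> TB)) a"
      using join by (intro rtree.join) auto
    then show ?thesis by (simp add: insert_commute)
  next
    case False
    then have "rtree (A \<union> insert w B) (insert {a, b} (TA \<union> insert {x, w} TB)) a"
      using join by (intro rtree.join) auto
    then show ?thesis by (simp add: insert_commute)
  qed
qed

section \<open>Every connected acyclic graph is a rooted tree\<close>

lemma sym_edge_rel: "sym (edge_rel E)"
  by (auto simp: sym_def insert_commute)

lemma rtrancl_edge_rel_sym: "(x, y) \<in> (edge_rel E)\<^sup>* \<Longrightarrow> (y, x) \<in> (edge_rel E)\<^sup>*"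
  by (rule symD[OF sym_rtrancl[OF sym_edge_rel]])

lemma rtree_connected:
  assumes "rtree V T r" "x \<in> V" "y \<in> V"
  shows "(x, y) \<in> (edge_rel T)\<^sup>*"
proof -
  have *: "\<forall>x\<in>V. (r, x) \<in> (edge_rel T)\<^sup>*" using assms(1)
  proof (induction rule: rtree.induct)
    case (single r)
    then show ?case by simp
  next
    case (join A TA a B TB b)
    let ?R = "edge_rel (insert {a, b} (TA \<union> TB))"
    have "(edge_rel TA)\<^sup>* \<subseteq> ?R\<^sup>*" "(edge_rel TB)\<^sup>* \<subseteq> ?R\<^sup>*" by (auto intro!: rtrancl_mono)
    moreover have "(a, b) \<in> ?R" by simp
    ultimately show ?case using join.IH
      by (auto intro: converse_rtrancl_into_rtrancl)
  qed
  have "(x, r) \<in> (edge_rel T)\<^sup>*"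
    using * assms(2) by (blast intro: rtrancl_edge_rel_sym)
  with * assms(3) show ?thesis by (blast intro: rtrancl_trans)
qed

lemma is_cycle_mono: "is_cycle E p \<Longrightarrow> E \<subseteq> F \<Longrightarrow> is_cycle F p"
  by (auto simp: is_cycle_def)

lemma cycle_from_path:
  assumes "(x, y) \<in> (edge_rel T)\<^sup>*" "{x, y} \<notin> T" "x \<noteq> y"
  shows "\<exists>p. is_cycle (insert {x, y} T) p"
proof -
  let ?r = "\<lambda>x y. {x, y} \<in> T"
  have "?r\<^sup>*\<^sup>* x y" using assms(1) by (simp add: rtrancl_def)
  then obtain xs0 where "rtrancl_path ?r x xs0 y" by (auto simp: rtranclp_eq_rtrancl_path)
  then obtain xs where xs: "rtrancl_path ?r x xs y" "distinct (x # xs)"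
    by (rule rtrancl_path_distinct)
  have ne: "xs \<noteq> []" using xs(1) assms(3) by (auto elim: rtrancl_path.cases)
  have last: "last xs = y" using xs(1) ne by (rule rtrancl_path_last)
  have nth: "{(x # xs) ! i, xs ! i} \<in> T" if "i < length xs" for i
    using rtrancl_path_nth[OF xs(1) that] .
  \<comment> \<open>A path of one edge would be \<open>{x, y}\<close> itself, which is not in
    \<open>T\<close>; so the cycle has at least three vertices.\<close>
  have "length xs \<noteq> 1"
  proof
    assume "length xs = 1"
    then obtain z where "xs = [z]" by (auto simp: length_Suc_conv)
    then show False using nth[of 0] last assms(2) by simp
  qed
  with ne have len: "length (x # xs) \<ge> 3" by (cases xs; cases "tl xs") auto
  have "{(x # xs) ! i, (x # xs) ! (Suc i mod length (x # xs))} \<in> insert {x, y} T"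
    if "i < length (x # xs)" for i
  proof (cases "i = length xs")
    case True
    then have "(x # xs) ! i = y" using ne last by (simp add: last_conv_nth nth_Cons')
    then show ?thesis using True by (simp add: insert_commute)
  next
    case False
    then show ?thesis using that nth[of i] by simp
  qed
  then have "is_cycle (insert {x, y} T) (x # xs)"
    using len xs(2) unfolding is_cycle_def by blast
  then show ?thesis by blast
qed

lemma rtrancl_leaves_set:
  assumes "(a, b) \<in> R\<^sup>*" "a \<in> S" "b \<notin> S"
  shows "\<exists>x w. x \<in> S \<and> w \<notin> S \<and> (x, w) \<in> R"
  using assms by (induction rule: rtrancl_induct) auto

text \<open>A subtree of \<open>T\<close> grows from \<open>r\<close> along edges that leave it
  until it spans \<open>V\<close>. Any further edge of \<open>T\<close> would close a cycle in
  \<open>T\<close>, so the grown tree is all of \<open>T\<close>.\<close>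

lemma tree_imp_rtree:
  assumes "is_tree V T" "r \<in> V"
  shows "rtree V T r"
proof -
  have T: "finite V" "\<forall>e\<in>T. e \<subseteq> V \<and> card e = 2" "\<not> (\<exists>p. is_cycle T p)"
    "\<And>x y. x \<in> V \<Longrightarrow> y \<in> V \<Longrightarrow> (x, y) \<in> (edge_rel T)\<^sup>*"
    using assms by (auto simp: is_tree_def simple_graph_def connected_graph_def)
  have "\<exists>S T'. S \<subseteq> V \<and> T' \<subseteq> T \<and> rtree S T' r \<and> card S = Suc k" if "Suc k \<le> card V" for k
    using that
  proof (induction k)
    case 0
    then show ?case using assms(2) by (intro exI[of _ "{r}"] exI[of _ "{}"]) (auto intro: rtree.single)
  next
    case (Suc k)
    then obtain S T' where S: "S \<subseteq> V" "T' \<subseteq> T" "rtree S T' r" "card S = Suc k" by auto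
    then have "S \<noteq> V" using Suc by auto
    then obtain y where y: "y \<in> V" "y \<notin> S" using S by auto
    have "r \<in> S" using rtree_props(2)[OF S(3)] .
    obtain x w where x: "x \<in> S" "w \<notin> S" "{x, w} \<in> T"
      using rtrancl_leaves_set[OF T(4)[OF assms(2) y(1)] \<open>r \<in> S\<close> y(2)] by auto
    then have "w \<in> V" using T by auto
    have "finite S" using S T finite_subset by blast
    show ?case
      using rtree_pendant[OF S(3) x(1,2)] S x \<open>w \<in> V\<close> \<open>finite S\<close>
      by (intro exI[of _ "insert w S"] exI[of _ "insert {x, w} T'"]) auto
  qed
  moreover have "0 < card V" using assms(2) T(1) by (auto simp: card_gt_0_iff)
  ultimately obtain S T' where S: "S \<subseteq> V" "T' \<subseteq> T" "rtree S T' r" "card S = card V"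
    by (metis Suc_pred order_refl)
  then have [simp]: "S = V" using T(1) by (simp add: card_subset_eq)
  have "T \<subseteq> T'"
  proof
    fix e assume e: "e \<in> T"
    show "e \<in> T'"
    proof (rule ccontr)
      assume ne: "e \<notin> T'"
      obtain x y where xy: "e = {x, y}" "x \<noteq> y" using T(2) e by (auto simp: card_2_iff)
      then have "x \<in> V" "y \<in> V" using T(2) e by auto
      then have "\<exists>p. is_cycle (insert {x, y} T') p"
        using rtree_connected[OF S(3)] ne xy by (intro cycle_from_path) auto
      moreover have "insert {x, y} T' \<subseteq> T" using S e xy by auto
      ultimately show False using T(3) is_cycle_mono by blast
    qed
  qed
  with S show ?thesis by auto
qed

section \<open>Leaves other than the root\<close>

definition outer_leaves :: "'a set \<Rightarrow> 'a set set \<Rightarrow> 'a \<Rightarrow> 'a set" where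
  "outer_leaves V T r = {u \<in> V - {r}. leaf T u}"

text \<open>The new edge changes degrees only at the two roots, which are not counted in their own
  trees. So no leaf is lost, and \<open>b\<close> becomes a new one if it is alone in
  \<open>B\<close>.\<close>

lemma outer_leaves_join:
  assumes "rtree A TA a" "rtree B TB b" "A \<inter> B = {}"
  defines "T \<equiv> insert {a, b} (TA \<union> TB)"
  shows "card (outer_leaves A TA a) + card (outer_leaves B TB b) + of_bool (card B = 1)
    \<le> card (outer_leaves (A \<union> B) T a)"
proof -
  note A = rtree_props[OF assms(1)] and B = rtree_props[OF assms(2)]
  have Asub: "e \<subseteq> A" if "e \<in> TA" for e using A that by blast
  have Bsub: "e \<subseteq> B" if "e \<in> TB" for e using B that by blast
  have eqA: "{e \<in> T. u \<in> e} = {e \<in> TA. u \<in> e}" if "u \<in> A" "u \<noteq> a" for u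
    using that A(2) Bsub B(2) assms(3) unfolding T_def by blast
  have eqB: "{e \<in> T. u \<in> e} = {e \<in> TB. u \<in> e}" if "u \<in> B" "u \<noteq> b" for u
    using that A(2) Asub B(2) assms(3) unfolding T_def by blast
  let ?C = "if card B = 1 then {b} else {}"
  have C: "?C \<subseteq> outer_leaves (A \<union> B) T a"
  proof (cases "card B = 1")
    case True
    then have "B = {b}" using B(2) by (elim card_1_singletonE) simp
    then have "TB = {}" using B(4) by (auto dest!: subset_singletonD)
    have "{e \<in> T. b \<in> e} = {{a, b}}"
      using Asub assms(3) \<open>TB = {}\<close> \<open>B = {b}\<close> unfolding T_def by blast
    then have "leaf T b" by (simp add: leaf_def vertex_degree_def)
    then show ?thesis using B A assms(3) True by (auto simp: outer_leaves_def)
  qed simp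
  have sub: "outer_leaves A TA a \<subseteq> outer_leaves (A \<union> B) T a" "outer_leaves B TB b \<subseteq> outer_leaves (A \<union> B) T a"
    using eqA eqB A(2) assms(3) by (auto simp: outer_leaves_def leaf_def vertex_degree_def)
  have fin: "finite (outer_leaves A TA a)" "finite (outer_leaves B TB b)" "finite (outer_leaves (A \<union> B) T a)"
    using A B by (auto simp: outer_leaves_def)
  have "card (outer_leaves A TA a) + card (outer_leaves B TB b) + card ?C =
    card (outer_leaves A TA a \<union> (outer_leaves B TB b \<union> ?C))"
    using fin A B assms(3)
    by (subst card_Un_disjoint; (subst card_Un_disjoint)?; auto simp: outer_leaves_def)
  also have "\<dots> \<le> card (outer_leaves (A \<union> B) T a)"
    using C sub fin by (intro card_mono) auto
  finally show ?thesis by (simp split: if_splits)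
qed

lemma card_outer_leaves_pos:
  assumes "rtree V T r" "2 \<le> card V"
  shows "1 \<le> card (outer_leaves V T r)"
  using assms
proof (induction rule: rtree.induct)
  case (single r)
  then show ?case by simp
next
  case (join A TA a B TB b)
  have "1 \<le> card (outer_leaves B TB b) + of_bool (card B = 1)"
    using join rtree_props(5)[OF join.hyps(2)] by (cases "card B = 1") auto
  then show ?case using outer_leaves_join[OF join.hyps] by linarith
qed

section \<open>Traversals with few open edges and few jumps\<close>

definition crossing :: "'a set set \<Rightarrow> 'a set \<Rightarrow> 'a set set" where
  "crossing T S = {e \<in> T. e \<inter> S \<noteq> {} \<and> \<not> e \<subseteq> S}"

text \<open>The bound \<open>c\<close> on open tree edges holds at every moment, start and end
  included. A new vertex may hang on any visited vertex; \<open>jumps\<close> records how often it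
  does not hang on the last one.\<close>

fun layout :: "nat \<Rightarrow> 'a set set \<Rightarrow> 'a set \<Rightarrow> 'a list \<Rightarrow> bool" where
  "layout c T S [] \<longleftrightarrow> card (crossing T S) \<le> c"
| "layout c T S (w # ws) \<longleftrightarrow>
     card (crossing T S) \<le> c \<and> w \<notin> S \<and> (\<exists>x\<in>S. {x, w} \<in> T) \<and> layout c T (insert w S) ws"

fun jumps :: "'a set set \<Rightarrow> 'a \<Rightarrow> 'a list \<Rightarrow> nat" where
  "jumps T v [] = 0"
| "jumps T v (w # ws) = of_bool ({v, w} \<notin> T) + jumps T w ws"

lemma layout_append: "layout c T S (xs @ ys) \<longleftrightarrow> layout c T S xs \<and> layout c T (S \<union> set xs) ys"
proof (induction xs arbitrary: S)
  case Nil
  then show ?case by (cases ys) auto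
qed auto

lemma jumps_append: "jumps T v (xs @ ys) = jumps T v xs + jumps T (last (v # xs)) ys"
  by (induction xs arbitrary: v) auto

lemma jumps_mono: "TA \<subseteq> T \<Longrightarrow> jumps T v ws \<le> jumps TA v ws"
  by (induction ws arbitrary: v) (auto intro!: add_mono le_SucI)

lemma jumps_start: "jumps T x ws \<le> of_bool (ws \<noteq> []) + jumps T y ws"
  by (cases ws) auto

text \<open>A traversal of one branch is reused in a larger tree while a disjoint set
  \<open>D\<close> is already visited; the last premise carries all information about edges outside
  \<open>TA\<close>.\<close>

lemma layout_extend:
  assumes "layout c TA S ws" "TA \<subseteq> T" "set ws \<subseteq> A" "S \<subseteq> A" "A \<inter> D = {}"
    and "\<And>P. S \<subseteq> P \<Longrightarrow> P \<subseteq> A \<Longrightarrow> card (crossing TA P) \<le> c \<Longrightarrow> card (crossing T (P \<union> D)) \<le> c'"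
  shows "layout c' T (S \<union> D) ws"
  using assms
proof (induction ws arbitrary: S)
  case (Cons w ws)
  have "layout c' T (insert w S \<union> D) ws"
    using Cons.prems by (intro Cons.IH) auto
  then show ?case using Cons.prems by auto
qed simp

text \<open>The smaller branch goes first; it has at most \<open>2 ^ (L - 1)\<close> vertices, which pays for the at most
  two edges of the larger branch that stay open meanwhile.\<close>

lemma rtree_layout:
  assumes "rtree V T r" "\<And>u. vertex_degree T u \<le> 3" "card V \<le> 2 ^ L"
  shows "\<exists>ws. layout (2 * L + 3) T {r} ws \<and> set ws = V - {r} \<and>
    Suc (jumps T r ws) \<le> max 1 (card (outer_leaves V T r))"
  using assms
proof (induction arbitrary: L rule: rtree.induct)
  case (single r)
  then show ?case by (intro exI[of _ "[]"]) (auto simp: crossing_def)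
next
  case (join A TA a B TB b)
  note A = rtree_props[OF join.hyps(1)] and B = rtree_props[OF join.hyps(2)]
  have Asub: "e \<subseteq> A" if "e \<in> TA" for e using A that by blast
  have Bsub: "e \<subseteq> B" if "e \<in> TB" for e using B that by blast
  let ?T = "insert {a, b} (TA \<union> TB)"
  have finT: "finite ?T" using A B by auto
  have deg: "vertex_degree T' u \<le> vertex_degree ?T u" if "T' \<subseteq> ?T" for T' u
    unfolding vertex_degree_def using finT that by (intro card_mono) auto
  have degA: "vertex_degree TA u \<le> 3" and degB: "vertex_degree TB u \<le> 3" for u
    by (rule order.trans[OF deg join.prems(1)], blast)+
  have cardAB: "card (A \<union> B) = card A + card B" using A B join.hyps by (simp add: card_Un_disjoint)
  have "L \<noteq> 0"
  proof
    assume "L = 0"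
    then show False using join.prems(2) A B cardAB by auto
  qed
  then obtain K where K: "L = Suc K" by (cases L) auto
  have fin: "finite (crossing T' S)" if "finite T'" for T' and S :: "'a set" using that by (simp add: crossing_def)
  have joinleaves: "card (outer_leaves A TA a) + max 1 (card (outer_leaves B TB b)) \<le> card (outer_leaves (A \<union> B) ?T a)"
    using outer_leaves_join[OF join.hyps] card_outer_leaves_pos[OF join.hyps(2)] B(5)
    by (cases "card B = 1") auto
  have cross_AB: "crossing ?T (P \<union> B) \<subseteq> crossing TA P" if "a \<in> P" "P \<subseteq> A" for P
    using that Asub Bsub A(2) B(2) join.hyps(3) unfolding crossing_def by blast
  have cross_BA: "crossing ?T (P \<union> A) \<subseteq> crossing TB P" if "b \<in> P" "P \<subseteq> B" for P
    using that Asub Bsub A(2) B(2) join.hyps(3) unfolding crossing_def by blast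
  \<comment> \<open>At most one jump joins the branches, and the outer leaves of \<open>A\<close>
    pay for it: if \<open>A\<close> has a vertex besides \<open>a\<close>, then
    \<open>jA + 1\<close> is at most their number. If \<open>A = {a}\<close>, then \<open>b\<close>
    follows \<open>a\<close> without a jump. The \<open>max 1\<close> covers a branch of one
    vertex.\<close>
  have jump_total: "Suc j \<le> max 1 (card (outer_leaves (A \<union> B) ?T a))"
    if "j \<le> jA + jB + of_bool (wsA \<noteq> [])" "Suc jA \<le> max 1 (card (outer_leaves A TA a))"
      "Suc jB \<le> max 1 (card (outer_leaves B TB b))" "set wsA = A - {a}" "wsA = [] \<Longrightarrow> jA = 0"
    for j jA jB and wsA :: "'a list"
  proof -
    have "Suc j \<le> card (outer_leaves A TA a) + max 1 (card (outer_leaves B TB b))"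
    proof (cases "wsA = []")
      case True
      then show ?thesis using that(1,3) that(5)[OF True] by simp
    next
      case False
      have "card A \<noteq> 1"
      proof
        assume "card A = 1"
        then obtain x where "A = {x}" by (rule card_1_singletonE)
        then show False using A(2) that(4) False by simp
      qed
      then have "1 \<le> card (outer_leaves A TA a)"
        using card_outer_leaves_pos[OF join.hyps(1)] A(5) by simp
      then have "Suc jA \<le> card (outer_leaves A TA a)" using that(2) by simp
      moreover have "j \<le> jA + jB + 1" using that(1) False by simp
      ultimately show ?thesis using that(3) by linarith
    qed
    then show ?thesis using joinleaves by linarith
  qed
  show ?case
  \<comment> \<open>If \<open>A\<close> is not the larger part, it is finished before
    \<open>b\<close> is entered. Meanwhile \<open>{a, b}\<close> is the only additional open edge,
    and the smaller exponent \<open>K\<close> leaves room for two.\<close>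
  proof (cases "card A \<le> card B")
    case True
    then have "card A \<le> 2 ^ K" "card B \<le> 2 ^ L" using join.prems(2) K cardAB by auto
    then obtain wsA wsB where
      wsA: "layout (2 * K + 3) TA {a} wsA" "set wsA = A - {a}"
        "Suc (jumps TA a wsA) \<le> max 1 (card (outer_leaves A TA a))" and
      wsB: "layout (2 * L + 3) TB {b} wsB" "set wsB = B - {b}"
        "Suc (jumps TB b wsB) \<le> max 1 (card (outer_leaves B TB b))"
      using join.IH degA degB by meson
    have cross: "card (crossing ?T P) \<le> 2 * L + 3" if "P \<subseteq> A" "card (crossing TA P) \<le> 2 * K + 3" for P
    proof -
      have "crossing ?T P \<subseteq> insert {a, b} (crossing TA P)"
        using that(1) Bsub B(2) join.hyps(3) unfolding crossing_def by blast
      then have "card (crossing ?T P) \<le> card (insert {a, b} (crossing TA P))"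
        using fin A by (intro card_mono) auto
      also have "\<dots> \<le> Suc (card (crossing TA P))" by (rule card_insert_le_m1) auto
      finally show ?thesis using that K by simp
    qed
    have 1: "layout (2 * L + 3) ?T ({a} \<union> {}) wsA"
      using wsA A(2) cross by (intro layout_extend[OF wsA(1), of ?T A]) auto
    have "layout (2 * L + 3) ?T ({b} \<union> A) wsB"
    proof (rule layout_extend[OF wsB(1), of ?T B])
      fix P assume "{b} \<subseteq> P" "P \<subseteq> B" "card (crossing TB P) \<le> 2 * L + 3"
      then show "card (crossing ?T (P \<union> A)) \<le> 2 * L + 3"
        using card_mono[OF fin[OF B(3)] cross_BA[of P]] by simp
    qed (use wsB B join.hyps(3) in auto)
    moreover have "crossing TA A = {}" using A by (auto simp: crossing_def)
    then have "card (crossing ?T A) \<le> 2 * L + 3" using cross[of A] by simp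
    moreover have "b \<notin> A" using B join.hyps(3) by auto
    ultimately have 2: "layout (2 * L + 3) ?T A (b # wsB)" using A(2) by auto
    have "layout (2 * L + 3) ?T {a} (wsA @ b # wsB)"
      using 1 2 wsA(2) A(2) by (simp add: layout_append insert_absorb)
    moreover have "set (wsA @ b # wsB) = A \<union> B - {a}" using wsA wsB B A join.hyps(3) by auto
    moreover have "jumps ?T a (wsA @ b # wsB) \<le> jumps TA a wsA + jumps TB b wsB + of_bool (wsA \<noteq> [])"
    proof -
      have "jumps ?T a wsA \<le> jumps TA a wsA" "jumps ?T b wsB \<le> jumps TB b wsB"
        by (rule jumps_mono, blast)+
      moreover have "of_bool ({last (a # wsA), b} \<notin> ?T) \<le> (of_bool (wsA \<noteq> []) :: nat)" by simp
      moreover have "jumps ?T a (wsA @ b # wsB) =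
          jumps ?T a wsA + (of_bool ({last (a # wsA), b} \<notin> ?T) + jumps ?T b wsB)"
        by (simp only: jumps_append jumps.simps)
      ultimately show ?thesis by linarith
    qed
    then have "Suc (jumps ?T a (wsA @ b # wsB)) \<le> max 1 (card (outer_leaves (A \<union> B) ?T a))"
      by (rule jump_total) (use wsA wsB in auto)
    ultimately show ?thesis by blast
  next
    case False
    then have "card B \<le> 2 ^ K" "card A \<le> 2 ^ L" using join.prems(2) K cardAB by auto
    then obtain wsA wsB where
      wsA: "layout (2 * L + 3) TA {a} wsA" "set wsA = A - {a}"
        "Suc (jumps TA a wsA) \<le> max 1 (card (outer_leaves A TA a))" and
      wsB: "layout (2 * K + 3) TB {b} wsB" "set wsB = B - {b}"
        "Suc (jumps TB b wsB) \<le> max 1 (card (outer_leaves B TB b))"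
      using join.IH degA degB by meson
    \<comment> \<open>While \<open>B\<close> is visited, \<open>a\<close> already belongs to the
      visited set. Besides \<open>{a, b}\<close> it has at most two edges, whence the slope 2 in
      \<open>2 * L + 3\<close>; the 3 is the degree of the root at the start.\<close>
    have "{e \<in> ?T. a \<in> e} = insert {a, b} {e \<in> TA. a \<in> e}"
      using Asub Bsub A(2) B(2) join.hyps(3) by blast
    moreover have "{a, b} \<notin> {e \<in> TA. a \<in> e}" using Asub B(2) join.hyps(3) by blast
    ultimately have "vertex_degree ?T a = Suc (card {e \<in> TA. a \<in> e})"
      using A(3) by (simp add: vertex_degree_def)
    then have deg2: "card {e \<in> TA. a \<in> e} \<le> 2" using join.prems(1)[of a] by simp
    have 1: "layout (2 * L + 3) ?T ({b} \<union> {a}) wsB"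
    proof (rule layout_extend[OF wsB(1), of ?T B])
      fix P assume P: "{b} \<subseteq> P" "P \<subseteq> B" "card (crossing TB P) \<le> 2 * K + 3"
      have "crossing ?T (P \<union> {a}) \<subseteq> crossing TB P \<union> {e \<in> TA. a \<in> e}"
      proof
        fix e assume e: "e \<in> crossing ?T (P \<union> {a})"
        then have "e \<noteq> {a, b}" using P(1) by (auto simp: crossing_def)
        then consider "e \<in> TA" | "e \<in> TB" using e by (auto simp: crossing_def)
        then show "e \<in> crossing TB P \<union> {e \<in> TA. a \<in> e}"
        proof cases
          case 1
          then have "e \<inter> P = {}" using Asub[of e] P(2) join.hyps(3) by blast
          then show ?thesis using e 1 by (auto simp: crossing_def)
        next
          case 2
          then have "a \<notin> e" using Bsub[of e] A(2) join.hyps(3) by blast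
          then show ?thesis using e 2 by (auto simp: crossing_def)
        qed
      qed
      then have "card (crossing ?T (P \<union> {a})) \<le> card (crossing TB P \<union> {e \<in> TA. a \<in> e})"
        using fin A B by (intro card_mono) auto
      also have "\<dots> \<le> card (crossing TB P) + card {e \<in> TA. a \<in> e}" by (rule card_Un_le)
      finally show "card (crossing ?T (P \<union> {a})) \<le> 2 * L + 3" using P deg2 K by simp
    qed (use wsB A B join.hyps(3) in auto)
    have 2: "layout (2 * L + 3) ?T ({a} \<union> B) wsA"
    proof (rule layout_extend[OF wsA(1), of ?T A])
      fix P assume "{a} \<subseteq> P" "P \<subseteq> A" "card (crossing TA P) \<le> 2 * L + 3"
      then show "card (crossing ?T (P \<union> B)) \<le> 2 * L + 3"
        using card_mono[OF fin[OF A(3)] cross_AB[of P]] by simp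
    qed (use wsA A join.hyps(3) in auto)
    have "card (crossing ?T {a}) \<le> card {e \<in> ?T. a \<in> e}"
      using finT by (intro card_mono) (auto simp: crossing_def)
    then have "card (crossing ?T {a}) \<le> 2 * L + 3" using join.prems(1)[of a] by (simp add: vertex_degree_def)
    moreover have "b \<noteq> a" using A B join.hyps(3) by auto
    moreover have "insert b {a} \<union> set wsB = {a} \<union> B" using wsB(2) B(2) by auto
    ultimately have "layout (2 * L + 3) ?T {a} (b # wsB @ wsA)"
      using 1 2 by (simp add: layout_append insert_commute)
    moreover have "set (b # wsB @ wsA) = A \<union> B - {a}" using wsA wsB B A join.hyps(3) by auto
    moreover have "jumps ?T a (b # wsB @ wsA) \<le> jumps TA a wsA + jumps TB b wsB + of_bool (wsA \<noteq> [])"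
    proof -
      have "jumps ?T a wsA \<le> jumps TA a wsA" "jumps ?T b wsB \<le> jumps TB b wsB"
        by (rule jumps_mono, blast)+
      moreover have "jumps ?T (last (b # wsB)) wsA \<le> of_bool (wsA \<noteq> []) + jumps ?T a wsA"
        by (rule jumps_start)
      moreover have "jumps ?T a (b # wsB @ wsA) = jumps ?T b wsB + jumps ?T (last (b # wsB)) wsA"
        by (simp only: jumps_append jumps.simps) simp
      ultimately show ?thesis by linarith
    qed
    then have "Suc (jumps ?T a (b # wsB @ wsA)) \<le> max 1 (card (outer_leaves (A \<union> B) ?T a))"
      by (rule jump_total) (use wsA wsB in auto)
    ultimately show ?thesis by blast
  qed
qed

section \<open>Visited sets of a traversal are sparse cuts\<close>

lemma sum_card_nbrs:
  assumes "simple_graph V E"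
  shows "(\<Sum>v\<in>V. card (nbrs E v)) = 2 * card E"
proof -
  have finV: "finite V" and E: "\<And>e. e \<in> E \<Longrightarrow> e \<subseteq> V \<and> card e = 2"
    using assms by (auto simp: simple_graph_def)
  have finE: "finite E" using assms by (rule simple_graph_finite_edges)
  have "(\<Sum>v\<in>V. card (nbrs E v)) = (\<Sum>v\<in>V. \<Sum>e\<in>E. of_bool (v \<in> e))"
    using finE by (simp add: card_nbrs[OF assms] vertex_degree_def of_bool_def sum.If_cases Int_def)
  also have "\<dots> = (\<Sum>e\<in>E. \<Sum>v\<in>V. of_bool (v \<in> e))" by (rule sum.swap)
  also have "\<dots> = (\<Sum>e\<in>E. 2)"
  proof (rule sum.cong[OF refl])
    fix e assume "e \<in> E"
    then have "V \<inter> e = e" "card e = 2" using E by auto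
    then show "(\<Sum>v\<in>V. of_bool (v \<in> e)) = (2 :: nat)"
      using finV by (simp add: of_bool_def sum.If_cases Int_def)
  qed
  finally show ?thesis by simp
qed

lemma cut_nbrs_eq: "simple_graph V E \<Longrightarrow> cut_nbrs E S v = nbrs (crossing E S) v"
  by (auto simp: cut_nbrs_def nbrs_def crossing_def)

lemma simple_graph_subset: "simple_graph V E \<Longrightarrow> F \<subseteq> E \<Longrightarrow> simple_graph V F"
  by (auto simp: simple_graph_def)

lemma rtree_covers:
  assumes "rtree V T r" "2 \<le> card V" "v \<in> V"
  shows "\<exists>e\<in>T. v \<in> e"
  using assms
proof (induction arbitrary: v rule: rtree.induct)
  case (join A TA a B TB b)
  have singleton: "S = {s}" if "rtree S TS s" "\<not> 2 \<le> card S" for S TS and s :: 'a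
  proof -
    have "card S = 1" "s \<in> S" using that rtree_props(2,5)[OF that(1)] by auto
    then show ?thesis by (elim card_1_singletonE) simp
  qed
  show ?case
  proof (cases "v \<in> A")
    case True
    then show ?thesis using join.IH(1)[of v] singleton[OF join.hyps(1)] by fastforce
  next
    case False
    then have "v \<in> B" using join.prems by auto
    then show ?thesis using join.IH(2)[of v] singleton[OF join.hyps(2)] by fastforce
  qed
qed simp

text \<open>A cut edge of \<open>E\<close> is a cut edge of \<open>T\<close> or one of the
  \<open>card E - card V + 1\<close> edges outside \<open>T\<close>. A vertex with all neighbours
  across is an end of a cut tree edge, and \<open>L\<close> edges have at most \<open>2 * L\<close>
  ends; a single vertex has no tree edge at all, hence \<open>1 \<le> L\<close>.\<close>

lemma sparse_cut_of_tree:
  assumes "simple_graph V E" "T \<subseteq> E" "rtree V T r" "card (crossing T S) \<le> L" "1 \<le> L"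
  shows "sparse_cut V E L S"
proof -
  note T = rtree_props[OF assms(3)]
  have finE: "finite E" using assms(1) by (rule simple_graph_finite_edges)
  have fin: "finite (crossing F S)" if "F \<subseteq> E" for F
    using finite_subset[OF that finE] by (simp add: crossing_def)
  have "crossing E S \<subseteq> crossing T S \<union> (E - T)" by (auto simp: crossing_def)
  then have "card (crossing E S) \<le> card (crossing T S \<union> (E - T))"
    using fin[OF assms(2)] finE by (intro card_mono) auto
  also have "\<dots> \<le> card (crossing T S) + card (E - T)" by (rule card_Un_le)
  also have "card (E - T) = card E - card T" using assms(2) T(3) by (simp add: card_Diff_subset)
  finally have "card (crossing E S) + card T \<le> L + card E"
    using assms(4) card_mono[OF finE assms(2)] by linarith
  moreover have "(\<Sum>v\<in>V. card (cut_nbrs E S v)) = 2 * card (crossing E S)"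
    using sum_card_nbrs[OF simple_graph_subset[OF assms(1), of "crossing E S"]]
    by (simp add: cut_nbrs_eq[OF assms(1)] crossing_def)
  ultimately have 1: "(\<Sum>v\<in>V. card (cut_nbrs E S v)) + 2 * card V \<le> (\<Sum>v\<in>V. card (nbrs E v)) + 2 + 2 * L"
    using T(5) by (simp add: sum_card_nbrs[OF assms(1)])
  let ?bad = "{v \<in> V. card (cut_nbrs E S v) = card (nbrs E v)}"
  have 2: "card ?bad \<le> 2 * L"
  proof (cases "2 \<le> card V")
    case True
    have "?bad \<subseteq> \<Union> (crossing T S)"
    proof
      fix v assume v: "v \<in> ?bad"
      have "finite (nbrs E v)"
        using nbrs_subset[OF assms(1), of v] assms(1) unfolding simple_graph_def by (meson finite_Diff finite_subset)
      then have eq: "cut_nbrs E S v = nbrs E v"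
        using v by (intro card_subset_eq) (auto simp: cut_nbrs_def)
      obtain e where e: "e \<in> T" "v \<in> e" using rtree_covers[OF assms(3) True] v by auto
      then have "card e = 2" using T(4) by auto
      then obtain u where u: "e = {v, u}" using e(2) by (auto simp: card_2_iff)
      then have "u \<in> nbrs E v" using e(1) assms(2) by (auto simp: nbrs_def)
      then have "(u \<in> S) \<noteq> (v \<in> S)" using eq by (auto simp: cut_nbrs_def)
      then have "e \<in> crossing T S" using e u by (auto simp: crossing_def)
      then show "v \<in> \<Union> (crossing T S)" using e by auto
    qed
    moreover have "finite (\<Union> (crossing T S))"
      using T(1,4) by (intro finite_subset[OF _ T(1)]) (auto simp: crossing_def)
    ultimately have "card ?bad \<le> card (\<Union> (crossing T S))" by (intro card_mono)
    also have "\<dots> \<le> (\<Sum>e\<in>crossing T S. card e)" by (rule card_Union_le_sum_card)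
    also have "\<dots> = (\<Sum>e\<in>crossing T S. 2)" using T(4) by (intro sum.cong) (auto simp: crossing_def)
    finally show ?thesis using assms(4) by simp
  next
    case False
    then have "card ?bad \<le> 1" using card_mono[OF T(1), of ?bad] by auto
    then show ?thesis using assms(5) by linarith
  qed
  show ?thesis unfolding sparse_cut_def using 1 2 by blast
qed

section \<open>Growing trees edge by edge while counting jumps\<close>

inductive search :: "'a set \<Rightarrow> 'a set set \<Rightarrow> 'a set \<Rightarrow> 'a \<Rightarrow> nat \<Rightarrow> 'a set set \<Rightarrow> bool" for V E where
  start: "v \<in> V \<Longrightarrow> search V E {v} v 0 {}"
| step: "search V E S v j T \<Longrightarrow> x \<in> S \<Longrightarrow> w \<in> V \<Longrightarrow> w \<notin> S \<Longrightarrow> {x, w} \<in> E \<Longrightarrow>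
    search V E (insert w S) w (j + of_bool (x \<noteq> v)) (insert {x, w} T)"

lemma search_props:
  assumes "search V E S v j T"
  shows "S \<subseteq> V" "v \<in> S" "finite S" "finite T" "j < card S" "T \<subseteq> E" "\<forall>e\<in>T. e \<subseteq> S"
    "card S = Suc (card T)"
proof -
  have "S \<subseteq> V \<and> v \<in> S \<and> finite S \<and> finite T \<and> j < card S \<and> T \<subseteq> E \<and> (\<forall>e\<in>T. e \<subseteq> S) \<and> card S = Suc (card T)" using assms
  proof (induction rule: search.induct)
    case (step S v j T x w)
    then have "{x, w} \<notin> T" by auto
    then show ?case using step by auto
  qed simp
  then show "S \<subseteq> V" "v \<in> S" "finite S" "finite T" "j < card S" "T \<subseteq> E" "\<forall>e\<in>T. e \<subseteq> S"
    "card S = Suc (card T)" by auto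
qed

text \<open>A cycle through \<open>w\<close> would use two edges at \<open>w\<close>, and
  \<open>{x, w}\<close> is the only one. With \<open>w\<close> rotated to the front, both its
  neighbours on the cycle equal \<open>x\<close>, against distinctness.\<close>

lemma is_cycle_pendant:
  assumes "is_cycle (insert {x, w} T) p" "w \<notin> \<Union> T" "x \<noteq> w"
  shows "is_cycle T p"
proof -
  let ?n = "length p"
  have p: "3 \<le> ?n" "distinct p" and e: "\<And>i. i < ?n \<Longrightarrow> {p ! i, p ! (Suc i mod ?n)} \<in> insert {x, w} T"
    using assms(1) by (auto simp: is_cycle_def)
  have "w \<notin> set p"
  proof
    assume "w \<in> set p"
    then obtain k where k: "k < ?n" "p ! k = w" by (auto simp: in_set_conv_nth)
    define q where "q = rotate k p"
    have "0 < ?n" using p(1) by linarith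
    then have q: "length q = ?n" "distinct q" "q ! 0 = w"
      using k p(2) nth_rotate[of 0 p k] unfolding q_def by simp_all
    have eq: "{q ! i, q ! (Suc i mod ?n)} \<in> insert {x, w} T" if "i < ?n" for i
    proof -
      have "q ! i = p ! ((k + i) mod ?n)" using that unfolding q_def by (simp add: nth_rotate)
      moreover have "q ! (Suc i mod ?n) = p ! (Suc ((k + i) mod ?n) mod ?n)"
        using nth_rotate[of "Suc i mod ?n" p k] \<open>0 < ?n\<close> unfolding q_def by (simp add: mod_simps)
      moreover have "(k + i) mod ?n < ?n" using p(1) by (intro mod_less_divisor) linarith
      ultimately show ?thesis using e by metis
    qed
    have edge_w: "e = {x, w}" if "e \<in> insert {x, w} T" "w \<in> e" for e
      using that assms(2) by blast
    have "Suc (?n - 1) = ?n" using p(1) by linarith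
    then have "Suc 0 mod ?n = 1" "Suc (?n - 1) mod ?n = 0" using p(1) by simp_all
    then have e01: "{q ! 0, q ! 1} \<in> insert {x, w} T" and e10: "{q ! (?n - 1), q ! 0} \<in> insert {x, w} T"
      using eq[of 0] eq[of "?n - 1"] \<open>0 < ?n\<close> by auto
    have "{q ! 0, q ! 1} = {x, w}" by (rule edge_w[OF e01]) (simp add: q(3))
    moreover have "{q ! (?n - 1), q ! 0} = {x, w}" by (rule edge_w[OF e10]) (simp add: q(3))
    ultimately have "q ! 1 = x" "q ! (?n - 1) = x" using q(3) assms(3) by (simp_all add: doubleton_eq_iff)
    then have "q ! 1 = q ! (?n - 1)" by simp
    then have "1 = ?n - 1" using q(1,2) p(1) by (subst (asm) nth_eq_iff_index_eq) auto
    then show False using p(1) by linarith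
  qed
  then have "{p ! i, p ! (Suc i mod ?n)} \<in> T" if "i < ?n" for i
  proof -
    have "p ! i \<noteq> w" "p ! (Suc i mod ?n) \<noteq> w"
      using \<open>w \<notin> set p\<close> that p(1) by (metis nth_mem, metis mod_less_divisor nth_mem gr_implies_not0 neq0_conv)
    then have "w \<notin> {p ! i, p ! (Suc i mod ?n)}" by simp
    then have "{p ! i, p ! (Suc i mod ?n)} \<noteq> {x, w}" by blast
    then show ?thesis using e[OF that] by simp
  qed
  then show ?thesis using p by (auto simp: is_cycle_def)
qed

lemma search_tree:
  assumes "search V E S v j T" "\<forall>e\<in>E. card e = 2"
  shows "is_tree S T"
proof -
  have "(\<forall>y\<in>S. (y, v) \<in> (edge_rel T)\<^sup>*) \<and> \<not> (\<exists>p. is_cycle T p)"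
    using assms(1)
  proof (induction rule: search.induct)
    case (start v)
    have "\<not> is_cycle {} p" for p :: "'a list" by (force simp: is_cycle_def)
    then show ?case by simp
  next
    case (step S v j T x w)
    note T = search_props[OF step.hyps(1)]
    let ?R = "edge_rel (insert {x, w} T)"
    have mono: "(edge_rel T)\<^sup>* \<subseteq> ?R\<^sup>*" by (intro rtrancl_mono) auto
    have "(v, x) \<in> (edge_rel T)\<^sup>*"
      using step.IH step.hyps(2) rtrancl_edge_rel_sym[of x v T] by blast
    then have "(v, w) \<in> ?R\<^sup>*" using mono by (auto intro: rtrancl_into_rtrancl)
    then have "\<forall>y\<in>S. (y, w) \<in> ?R\<^sup>*" using step.IH subsetD[OF mono] by (blast intro: rtrancl_trans)
    moreover have "w \<notin> \<Union> T" using T step.hyps by blast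
    then have "\<not> (\<exists>p. is_cycle (insert {x, w} T) p)"
      using is_cycle_pendant[of x w T] step.IH step.hyps by auto
    ultimately show ?case by auto
  qed
  note main = this
  have "(y, z) \<in> (edge_rel T)\<^sup>*" if "y \<in> S" "z \<in> S" for y z
    using main that rtrancl_edge_rel_sym[of z v T] rtrancl_trans[of y v _ z] by blast
  then have "connected_graph S T"
    using search_props(2)[OF assms(1)] by (auto simp: connected_graph_def)
  moreover have "simple_graph S T"
    using search_props[OF assms(1)] assms(2) by (auto simp: simple_graph_def)
  ultimately show ?thesis using main by (simp add: is_tree_def)
qed

lemma vertex_degree_pendant:
  assumes "finite T" "\<forall>e\<in>T. e \<subseteq> S" "w \<notin> S"
  shows "vertex_degree (insert {x, w} T) u = vertex_degree T u + of_bool (u \<in> {x, w})"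
proof -
  have "{x, w} \<notin> T" using assms(2,3) by auto
  then have new: "card (insert {x, w} {e \<in> T. u \<in> e}) = Suc (card {e \<in> T. u \<in> e})"
    using assms(1) by (intro card_insert_disjoint) auto
  show ?thesis
  proof (cases "u \<in> {x, w}")
    case True
    then have "{e \<in> insert {x, w} T. u \<in> e} = insert {x, w} {e \<in> T. u \<in> e}" by auto
    then show ?thesis unfolding vertex_degree_def using new True by simp
  next
    case False
    then have "{e \<in> insert {x, w} T. u \<in> e} = {e \<in> T. u \<in> e}" by auto
    then show ?thesis unfolding vertex_degree_def using False by simp
  qed
qed

text \<open>Growing from the last vertex \<open>v\<close>, itself a leaf, trades the leaf
  \<open>v\<close> for the leaf \<open>w\<close>; only a jump can raise the number of leaves, and
  only by one. The lower bound on degrees ensures that \<open>x\<close> is no leaf after gaining an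
  edge; it fails for a single vertex, hence \<open>2 \<le> card S\<close>.\<close>

lemma search_leaves:
  assumes "search V E S v j T"
  shows "2 \<le> card S \<Longrightarrow> card {u \<in> S. leaf T u} \<le> j + 2 \<and> leaf T v \<and> (\<forall>u\<in>S. 1 \<le> vertex_degree T u)"
  using assms
proof (induction rule: search.induct)
  case (step S v j T x w)
  note T = search_props[OF step.hyps(1)]
  note deg = vertex_degree_pendant[OF T(4,7) step.hyps(4), of x]
  let ?T = "insert {x, w} T"
  have "{e \<in> T. w \<in> e} = {}" using T(7) step.hyps(4) by auto
  then have w0: "vertex_degree T w = 0" unfolding vertex_degree_def by (simp only: card.empty)
  have leafw: "leaf ?T w" using w0 deg[of w] by (simp add: leaf_def)
  have fin: "finite {u \<in> S. P u}" for P using T(3) by simp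
  show ?case
  proof (cases "2 \<le> card S")
    case False
    then have "card S = 1" using T(5) by linarith
    then have S: "S = {v}" using T(2) by (elim card_1_singletonE) simp
    then have x: "x = v" "v \<noteq> w" using step.hyps by auto
    have "T = {}" using T(4,8) \<open>card S = 1\<close> by simp
    then have "vertex_degree T v = 0" by (simp add: vertex_degree_def)
    then have "vertex_degree ?T v = 1" using deg[of v] x by simp
    moreover have "card {u \<in> insert w S. leaf ?T u} \<le> card {v, w}" using S by (intro card_mono) auto
    ultimately show ?thesis using leafw S x by (auto simp: leaf_def)
  next
    case True
    then have IH: "card {u \<in> S. leaf T u} \<le> j + 2" "leaf T v" "\<forall>u\<in>S. 1 \<le> vertex_degree T u"
      using step.IH by auto
    have nx: "\<not> leaf ?T x" using IH(3) step.hyps(2) deg[of x] by (auto simp: leaf_def)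
    have sub: "{u \<in> insert w S. leaf ?T u} \<subseteq> insert w ({u \<in> S. leaf T u} - {x})"
      using nx deg by (auto simp: leaf_def)
    have "card {u \<in> insert w S. leaf ?T u} \<le> card (insert w ({u \<in> S. leaf T u} - {x}))"
      using fin by (intro card_mono[OF _ sub]) simp
    also have "\<dots> \<le> Suc (card ({u \<in> S. leaf T u} - {x}))" by (rule card_insert_le_m1) auto
    also have "\<dots> \<le> j + of_bool (x \<noteq> v) + 2"
    proof (cases "x = v")
      case True
      then have "card ({u \<in> S. leaf T u} - {x}) < card {u \<in> S. leaf T u}"
        using IH(2) T(2) fin by (intro card_Diff1_less) auto
      then show ?thesis using IH(1) by linarith
    next
      case False
      have "card ({u \<in> S. leaf T u} - {x}) \<le> card {u \<in> S. leaf T u}"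
        using fin by (intro card_mono) auto
      then show ?thesis using IH(1) False by simp
    qed
    finally show ?thesis using leafw IH(3) deg w0 by auto
  qed
qed simp

text \<open>\<open>X\<close> stands for any closed set of states, later the states that the program
  has expanded. Closure is demanded only for good sets, and all visited sets of a layout are
  good.\<close>

lemma layout_search_closed:
  assumes closed: "\<And>S v j x w. (S, v, j) \<in> X \<Longrightarrow> x \<in> S \<Longrightarrow> w \<in> V \<Longrightarrow> w \<notin> S \<Longrightarrow> {x, w} \<in> E \<Longrightarrow>
      good (insert w S) \<Longrightarrow> (insert w S, w, j + of_bool (x \<noteq> v)) \<in> X"
    and good: "\<And>P. card (crossing T P) \<le> c \<Longrightarrow> good P"
    and "T \<subseteq> E" "(S, v, j) \<in> X" "layout c T S ws" "v \<in> S" "set ws \<subseteq> V"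
  shows "(S \<union> set ws, last (v # ws), j + jumps T v ws) \<in> X"
  using assms(4-7)
proof (induction ws arbitrary: S v j)
  case (Cons w ws)
  \<comment> \<open>Hanging \<open>w\<close> on \<open>v\<close> whenever \<open>T\<close> has that
    edge makes the counter of the search agree with \<open>jumps\<close>.\<close>
  from Cons.prems(2) obtain x where x: "x \<in> S" "{x, w} \<in> T" "(\<forall>y\<in>S. {v, w} \<in> T \<longrightarrow> x = v)"
    using Cons.prems(3) by (cases "{v, w} \<in> T") auto
  have w: "w \<in> V" "w \<notin> S" "layout c T (insert w S) ws" using Cons.prems by auto
  have "card (crossing T (insert w S)) \<le> c" using w(3) by (cases ws) auto
  then have "(insert w S, w, j + of_bool (x \<noteq> v)) \<in> X"
    using x w assms(3) Cons.prems by (intro closed good) auto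
  moreover have "of_bool (x \<noteq> v) = (of_bool ({v, w} \<notin> T) :: nat)"
    using x Cons.prems(3) by auto
  ultimately have "(insert w S, w, j + of_bool ({v, w} \<notin> T)) \<in> X" by simp
  from Cons.IH[OF this w(3)] show ?case using Cons.prems by (auto simp: add.assoc)
qed simp

lemma search_complete:
  fixes E :: "'a set set"
  assumes "simple_graph V E" "subcubic V E" "card V \<le> 2 ^ k" "spanning_tree V E T"
    and start: "\<And>v. v \<in> V \<Longrightarrow> sparse_cut V E (2 * k + 3) {v} \<Longrightarrow> ({v}, v, 0) \<in> X"
    and closed: "\<And>S v j x w. (S, v, j) \<in> X \<Longrightarrow> x \<in> S \<Longrightarrow> w \<in> V \<Longrightarrow> w \<notin> S \<Longrightarrow> {x, w} \<in> E \<Longrightarrow>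
      sparse_cut V E (2 * k + 3) (insert w S) \<Longrightarrow> (insert w S, w, j + of_bool (x \<noteq> v)) \<in> X"
  shows "\<exists>v j. (V, v, j) \<in> X \<and> (2 \<le> card V \<longrightarrow> j + 2 \<le> card {u \<in> V. leaf T u})"
proof -
  have T: "T \<subseteq> E" "is_tree V T" using assms(4) by (auto simp: spanning_tree_def)
  have finV: "finite V" using assms(1) by (simp add: simple_graph_def)
  have finE: "finite E" using assms(1) by (rule simple_graph_finite_edges)
  have "V \<noteq> {}" using T(2) by (auto simp: is_tree_def connected_graph_def)
  then obtain r0 where r0: "r0 \<in> V" by auto
  \<comment> \<open>The root is taken among the leaves, so there is one leaf more than
    \<open>rtree_layout\<close> counts. This improves \<open>jumps + 1\<close> to the
    \<open>j + 2\<close> that matches the upper bound in \<open>search_leaves\<close>.\<close>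
  have "\<exists>r. r \<in> V \<and> (2 \<le> card V \<longrightarrow> leaf T r)"
  proof (cases "2 \<le> card V")
    case True
    then have "1 \<le> card (outer_leaves V T r0)"
      by (rule card_outer_leaves_pos[OF tree_imp_rtree[OF T(2) r0]])
    then have "outer_leaves V T r0 \<noteq> {}" by auto
    then show ?thesis by (auto simp: outer_leaves_def)
  qed (use r0 in auto)
  then obtain r where r: "r \<in> V" "2 \<le> card V \<longrightarrow> leaf T r" by blast
  have rt: "rtree V T r" using T(2) r(1) by (rule tree_imp_rtree)
  have deg: "vertex_degree T u \<le> 3" for u
  proof (cases "u \<in> V")
    case True
    have "vertex_degree T u \<le> vertex_degree E u"
      unfolding vertex_degree_def using finE T(1) by (intro card_mono) auto
    then show ?thesis using assms(2) True by (auto simp: subcubic_def intro: order.trans)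
  next
    case False
    then have "{e \<in> T. u \<in> e} = {}" using rtree_props(4)[OF rt] by auto
    then show ?thesis unfolding vertex_degree_def by (simp only: card.empty)
  qed
  obtain ws where ws: "layout (2 * k + 3) T {r} ws" "set ws = V - {r}"
    "Suc (jumps T r ws) \<le> max 1 (card (outer_leaves V T r))"
    using rtree_layout[OF rt deg assms(3)] by blast
  have good: "sparse_cut V E (2 * k + 3) P" if "card (crossing T P) \<le> 2 * k + 3" for P
    using assms(1) T(1) rt that by (rule sparse_cut_of_tree) simp
  have "card (crossing T {r}) \<le> 2 * k + 3" using ws(1) by (cases ws) auto
  then have "({r}, r, 0) \<in> X" using start[OF r(1)] good by blast
  then have "({r} \<union> set ws, last (r # ws), 0 + jumps T r ws) \<in> X"
    using layout_search_closed[where X = X and V = V and E = E and T = T and c = "2 * k + 3"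
        and good = "sparse_cut V E (2 * k + 3)", OF closed good T(1) _ ws(1)] ws(2) by blast
  moreover have "{r} \<union> set ws = V" using ws(2) r(1) by auto
  moreover have "jumps T r ws + 2 \<le> card {u \<in> V. leaf T u}" if "2 \<le> card V"
  proof -
    have "1 \<le> card (outer_leaves V T r)" using card_outer_leaves_pos[OF rt that] .
    then have "Suc (jumps T r ws) \<le> card (outer_leaves V T r)" using ws(3) by simp
    moreover have "{u \<in> V. leaf T u} = insert r (outer_leaves V T r)"
      using r that by (auto simp: outer_leaves_def)
    moreover have "r \<notin> outer_leaves V T r" "finite (outer_leaves V T r)"
      using finV by (auto simp: outer_leaves_def)
    ultimately show ?thesis by simp
  qed
  ultimately show ?thesis by auto
qed

text \<open>The tree has at most \<open>j + 2\<close> leaves, and by assumption no spanning tree has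
  fewer. The case of one vertex stands apart: its degree is 0, so it counts as internal.\<close>

lemma search_optimal:
  assumes "simple_graph V E" "search V E V v j T"
    and "\<And>T'. spanning_tree V E T' \<Longrightarrow> 2 \<le> card V \<Longrightarrow> j + 2 \<le> card {u \<in> V. leaf T' u}"
  shows "max_internal_spanning_tree V E T"
proof -
  note T = search_props[OF assms(2)]
  have "\<forall>e\<in>E. card e = 2" using assms(1) by (auto simp: simple_graph_def)
  then have "spanning_tree V E T"
    using search_tree[OF assms(2)] T(6) by (auto simp: spanning_tree_def)
  moreover have "card (internal_vertices V T') \<le> card (internal_vertices V T)"
    if T': "spanning_tree V E T'" for T'
  proof -
    have int: "card (internal_vertices V F) = card V - card {u \<in> V. leaf F u}" for F
    proof -
      have "internal_vertices V F = V - {u \<in> V. leaf F u}" by (auto simp: internal_vertices_def)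
      then show ?thesis using T(3) by (simp add: card_Diff_subset)
    qed
    show ?thesis
    proof (cases "2 \<le> card V")
      case True
      then have "card {u \<in> V. leaf T u} \<le> j + 2" using search_leaves[OF assms(2)] by blast
      also have "\<dots> \<le> card {u \<in> V. leaf T' u}" using assms(3)[OF T' True] .
      finally show ?thesis unfolding int by simp
    next
      case False
      then have "card V = 1" using T(5) by linarith
      then have "card T = 0" using T(8) by simp
      then have "T = {}" using T(4) by simp
      then have "{u \<in> V. leaf T u} = {}" by (simp add: leaf_def vertex_degree_def)
      then show ?thesis unfolding int by (simp only: card.empty)
    qed
  qed
  ultimately show ?thesis by (simp add: max_internal_spanning_tree_def)
qed

section \<open>Running times of programs\<close>

lemma bits_le: "x < 2 ^ k \<Longrightarrow> 1 \<le> k \<Longrightarrow> bits x \<le> k"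
  unfolding bits_def by (simp add: floorlog_leI)

lemma less_two_power_bits: "x < 2 ^ bits x"
proof (cases "x = 0")
  case False
  then have "x < 2 ^ floorlog 2 x" using floorlog_bounds[of x 2] by simp
  also have "\<dots> \<le> 2 ^ bits x" by (simp add: bits_def power_increasing)
  finally show ?thesis .
qed simp

lemma bits_pos: "1 \<le> bits x"
  by (simp add: bits_def)

lemma bits_mono: "x \<le> y \<Longrightarrow> bits x \<le> bits y"
  using floorlog_mono[of x y 2] by (simp add: bits_def max.coboundedI2)

lemma bits_add_le: "bits (x + y) \<le> bits x + bits y"
proof (rule bits_le)
  have le: "a + b \<le> a * b" if "2 \<le> a" "2 \<le> b" for a b :: nat
  proof -
    obtain c d where "a = c + 2" "b = d + 2" using \<open>2 \<le> a\<close> \<open>2 \<le> b\<close> by (metis le_add_diff_inverse2)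
    then show ?thesis by (simp add: algebra_simps)
  qed
  \<comment> \<open>Bit lengths are at least 1, even for 0; so both powers are at least 2, and their
    sum is at most their product.\<close>
  have "2 \<le> (2::nat) ^ bits z" for z
    using power_increasing[OF bits_pos[of z], of "2::nat"] by simp
  then have "(2::nat) ^ bits x + 2 ^ bits y \<le> 2 ^ bits x * 2 ^ bits y" by (intro le)
  then show "x + y < 2 ^ (bits x + bits y)"
    using less_two_power_bits[of x] less_two_power_bits[of y] by (simp add: power_add)
qed (use bits_pos[of x] in linarith)

lemma bits_mult_le: "bits (x * y) \<le> bits x + bits y"
proof (rule bits_le)
  show "x * y < 2 ^ (bits x + bits y)"
    unfolding power_add by (intro mult_strict_mono less_two_power_bits) auto
qed (use bits_pos[of x] in linarith)

definition bounded :: "nat \<Rightarrow> state \<Rightarrow> bool" where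
  "bounded b s \<longleftrightarrow> (\<forall>x i. s x i < 2 ^ b)"

text \<open>One number per expression bounds the bit length by \<open>weight e * b\<close> and the
  cost by \<open>weight e * b\<^sup>2\<close>. The square and the product of weights come from
  multiplication, which is charged the product of two bit lengths. A literal is estimated in
  unary.\<close>

fun weight :: "exp \<Rightarrow> nat" where
  "weight (Const k) = 2 * (k + 1)"
| "weight (Read x a) = weight a + 2"
| "weight (Add a b) = 2 * (weight a + weight b)"
| "weight (Sub a b) = 2 * (weight a + weight b)"
| "weight (Mul a b) = 2 * (weight a + weight b) + weight a * weight b"

lemma weight_bound:
  assumes "bounded b s" "1 \<le> b"
  shows "bits (val e s) \<le> weight e * b \<and> cost e s + bits (val e s) \<le> weight e * b\<^sup>2"
proof (induction e)
  case (Const k)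
  have "k < 2 ^ (k + 1)" by (rule less_trans[OF less_exp]) simp
  then have "bits k \<le> k + 1" by (intro bits_le) auto
  moreover define m where "m = 2 * (k + 1)"
  ultimately have "bits k + bits k \<le> m" by simp
  moreover have "m \<le> m * b" "m \<le> m * b\<^sup>2" using assms(2) by simp_all
  ultimately have "bits k \<le> m * b \<and> bits k + bits k \<le> m * b\<^sup>2" by linarith
  then show ?case by (simp only: val.simps cost.simps weight.simps m_def)
next
  case (Read x a)
  have "bits (s x (val a s)) \<le> b" using assms by (intro bits_le) (auto simp: bounded_def)
  moreover have "b \<le> b\<^sup>2" using assms(2) by (simp add: power2_eq_square)
  ultimately show ?case using Read by (auto simp: ring_distribs intro: trans_le_add1)
next
  case (Add e1 e2)
  have "b \<le> b\<^sup>2" using assms(2) by (simp add: power2_eq_square)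
  then have "weight e1 * b \<le> weight e1 * b\<^sup>2" "weight e2 * b \<le> weight e2 * b\<^sup>2" by (auto intro: mult_le_mono2)
  then show ?case using Add bits_add_le[of "val e1 s" "val e2 s"] by (simp add: ring_distribs)
next
  case (Sub e1 e2)
  have "b \<le> b\<^sup>2" using assms(2) by (simp add: power2_eq_square)
  then have "weight e1 * b \<le> weight e1 * b\<^sup>2" "weight e2 * b \<le> weight e2 * b\<^sup>2" by (auto intro: mult_le_mono2)
  then show ?case using Sub bits_mono[of "val e1 s - val e2 s" "val e1 s"] by (simp add: ring_distribs)
next
  case (Mul e1 e2)
  have "b \<le> b\<^sup>2" using assms(2) by (simp add: power2_eq_square)
  then have 1: "weight e1 * b \<le> weight e1 * b\<^sup>2" "weight e2 * b \<le> weight e2 * b\<^sup>2" by (auto intro: mult_le_mono2)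
  have "bits (val e1 s) * bits (val e2 s) \<le> (weight e1 * b) * (weight e2 * b)"
    using Mul by (intro mult_le_mono) auto
  also have "\<dots> = weight e1 * weight e2 * b\<^sup>2" by (simp add: power2_eq_square)
  finally have 2: "bits (val e1 s) * bits (val e2 s) \<le> weight e1 * weight e2 * b\<^sup>2" .
  have 3: "bits (val e1 s * val e2 s) \<le> weight e1 * b + weight e2 * b"
    using Mul bits_mult_le[of "val e1 s" "val e2 s"] by linarith
  then have "bits (val e1 s * val e2 s) \<le> weight (Mul e1 e2) * b" by (simp add: ring_distribs)
  moreover have "cost e1 s + cost e2 s + bits (val e1 s) * bits (val e2 s) + bits (val e1 s * val e2 s)
     \<le> weight (Mul e1 e2) * b\<^sup>2"
    using 1 2 3 Mul unfolding weight.simps ring_distribs by linarith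
  ultimately show ?case by simp
qed

text \<open>In \<open>runs\<close> the time \<open>t\<close> counts executed statements, each of them charged \<open>K * b\<^sup>2\<close>; this is
  sound as long as all memory cells stay below \<open>2 ^ b\<close>.\<close>

locale machine =
  fixes b K :: nat
  assumes b: "1 \<le> b" and K: "1 \<le> K"
begin

definition runs :: "com \<Rightarrow> state \<Rightarrow> nat \<Rightarrow> (state \<Rightarrow> bool) \<Rightarrow> bool" where
  "runs c s t Q \<longleftrightarrow> (bounded b s \<longrightarrow>
     (\<exists>u s'. exec c s u s' \<and> u \<le> K * b\<^sup>2 * t \<and> bounded b s' \<and> Q s'))"

lemma runs_mono:
  assumes "runs c s t Q" "t \<le> t'" "\<And>s'. Q s' \<Longrightarrow> Q' s'"
  shows "runs c s t' Q'"
  unfolding runs_def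
proof
  assume "bounded b s"
  then obtain u s' where *: "exec c s u s'" "u \<le> K * b\<^sup>2 * t" "bounded b s'" "Q s'"
    using assms(1) unfolding runs_def by blast
  have "u \<le> K * b\<^sup>2 * t'" using *(2) assms(2) by (meson le_trans mult_le_mono2)
  then show "\<exists>u s'. exec c s u s' \<and> u \<le> K * b\<^sup>2 * t' \<and> bounded b s' \<and> Q' s'"
    using * assms(3) by blast
qed

lemma runs_Skip:
  assumes "Q s"
  shows "runs Skip s 1 Q"
proof -
  have "1 \<le> K * b\<^sup>2 * 1" using b K by simp
  then show ?thesis using assms exec.Skip unfolding runs_def by blast
qed

lemma runs_Write:
  assumes "weight a + weight e \<le> K" "val e s < 2 ^ b" "Q (s(x := (s x)(val a s := val e s)))"
  shows "runs (Write x a e) s 1 Q"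
  unfolding runs_def
proof
  assume s: "bounded b s"
  have "cost a s + cost e s + bits (val a s) + bits (val e s) \<le> (weight a + weight e) * b\<^sup>2"
    using weight_bound[OF s b, of a] weight_bound[OF s b, of e] unfolding ring_distribs by linarith
  also have "\<dots> \<le> K * b\<^sup>2" using assms(1) by (rule mult_le_mono1)
  finally have "cost a s + cost e s + bits (val a s) + bits (val e s) \<le> K * b\<^sup>2 * 1" by simp
  moreover have "bounded b (s(x := (s x)(val a s := val e s)))"
    using s assms(2) by (auto simp: bounded_def)
  ultimately show "\<exists>u s'. exec (Write x a e) s u s' \<and> u \<le> K * b\<^sup>2 * 1 \<and> bounded b s' \<and> Q s'"
    using exec.Write assms(3) by blast
qed

lemma runs_Seq:
  assumes "runs c1 s t1 R" "\<And>s'. R s' \<Longrightarrow> runs c2 s' t2 Q"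
  shows "runs (Seq c1 c2) s (t1 + t2) Q"
  unfolding runs_def
proof
  assume s: "bounded b s"
  then obtain u1 s1 where 1: "exec c1 s u1 s1" "u1 \<le> K * b\<^sup>2 * t1" "bounded b s1" "R s1"
    using assms(1) unfolding runs_def by blast
  then obtain u2 s2 where 2: "exec c2 s1 u2 s2" "u2 \<le> K * b\<^sup>2 * t2" "bounded b s2" "Q s2"
    using assms(2) unfolding runs_def by blast
  have "u1 + u2 \<le> K * b\<^sup>2 * (t1 + t2)" using 1(2) 2(2) by (simp add: distrib_left)
  then show "\<exists>u s'. exec (Seq c1 c2) s u s' \<and> u \<le> K * b\<^sup>2 * (t1 + t2) \<and> bounded b s' \<and> Q s'"
    using exec.Seq[OF 1(1) 2(1)] 2 by blast
qed

lemma runs_Seq_Write: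
  assumes "weight a + weight e \<le> K" "val e s < 2 ^ b" "runs c (s(x := (s x)(val a s := val e s))) t Q"
  shows "runs (Seq (Write x a e) c) s (Suc t) Q"
  using runs_Seq[OF runs_Write[OF assms(1,2), of "\<lambda>s'. s' = s(x := (s x)(val a s := val e s))"]] assms(3)
  by auto

lemma guard_cost:
  assumes "bounded b s" "weight e \<le> K"
  shows "cost e s + bits (val e s) \<le> K * b\<^sup>2"
  using weight_bound[OF assms(1) b, of e] mult_le_mono1[OF assms(2), of "b\<^sup>2"] by linarith

lemma runs_Cond:
  assumes "weight e \<le> K" "val e s \<noteq> 0 \<Longrightarrow> runs c1 s t Q" "val e s = 0 \<Longrightarrow> runs c2 s t Q"
  shows "runs (Cond e c1 c2) s (Suc t) Q"
  unfolding runs_def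
proof
  assume s: "bounded b s"
  note g = guard_cost[OF s assms(1)]
  show "\<exists>u s'. exec (Cond e c1 c2) s u s' \<and> u \<le> K * b\<^sup>2 * Suc t \<and> bounded b s' \<and> Q s'"
  proof (cases "val e s = 0")
    case True
    then obtain u s' where *: "exec c2 s u s'" "u \<le> K * b\<^sup>2 * t" "bounded b s'" "Q s'"
      using assms(3) s unfolding runs_def by blast
    then have "cost e s + bits (val e s) + u \<le> K * b\<^sup>2 * Suc t" using g by simp
    then show ?thesis using exec.CondFalse[OF True *(1)] * by blast
  next
    case False
    then obtain u s' where *: "exec c1 s u s'" "u \<le> K * b\<^sup>2 * t" "bounded b s'" "Q s'"
      using assms(2) s unfolding runs_def by blast
    then have "cost e s + bits (val e s) + u \<le> K * b\<^sup>2 * Suc t" using g by simp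
    then show ?thesis using exec.CondTrue[OF False *(1)] * by blast
  qed
qed

lemma runs_Loop:
  fixes m :: "state \<Rightarrow> nat"
  assumes "weight e \<le> K"
    and "\<And>s. I s \<Longrightarrow> val e s \<noteq> 0 \<Longrightarrow> runs c s t (\<lambda>s'. I s' \<and> m s' < m s)"
    and "\<And>s. I s \<Longrightarrow> val e s = 0 \<Longrightarrow> Q s"
    and "I s" "m s \<le> N"
  shows "runs (Loop e c) s (N * Suc t + 1) Q"
  using assms(4,5)
proof (induction N arbitrary: s rule: less_induct)
  case (less N)
  show ?case unfolding runs_def
  proof
    assume s: "bounded b s"
    note g = guard_cost[OF s assms(1)]
    show "\<exists>u s'. exec (Loop e c) s u s' \<and> u \<le> K * b\<^sup>2 * (N * Suc t + 1) \<and> bounded b s' \<and> Q s'"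
    proof (cases "val e s = 0")
      case True
      have "cost e s + bits (val e s) \<le> K * b\<^sup>2 * (N * Suc t + 1)"
        using g by (simp add: distrib_left)
      then show ?thesis using exec.LoopFalse[OF True] s assms(3)[OF less.prems(1) True] by blast
    next
      case False
      then obtain u s' where *: "exec c s u s'" "u \<le> K * b\<^sup>2 * t" "bounded b s'" "I s'" "m s' < m s"
        using assms(2)[OF less.prems(1)] s unfolding runs_def by blast
      then have N: "m s' < N" "1 \<le> N" using less.prems(2) by auto
      have "m s' \<le> N - 1" using N by linarith
      then obtain u' s'' where **: "exec (Loop e c) s' u' s''" "u' \<le> K * b\<^sup>2 * ((N - 1) * Suc t + 1)"
          "bounded b s''" "Q s''"
        using less.IH[of "N - 1" s'] *(3,4) N unfolding runs_def by auto
      have "N * Suc t + 1 = (N - 1) * Suc t + 1 + t + 1"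
        using N(2) by (cases N) auto
      then have "cost e s + bits (val e s) + u + u' \<le> K * b\<^sup>2 * (N * Suc t + 1)"
        using g *(2) **(2) by (simp only: distrib_left mult_1_right)
      then show ?thesis using exec.LoopTrue[OF False *(1) **(1)] ** by blast
    qed
  qed
qed

end

section \<open>Counting loops\<close>

abbreviation Var :: "aname \<Rightarrow> exp" where
  "Var x \<equiv> Read x (Const 0)"

abbreviation Assign :: "aname \<Rightarrow> exp \<Rightarrow> com" where
  "Assign x e \<equiv> Write x (Const 0) e"

definition For :: "aname \<Rightarrow> exp \<Rightarrow> com \<Rightarrow> com" where
  "For x e c = Seq (Assign x (Const 0)) (Loop (Sub e (Var x)) (Seq c (Assign x (Add (Var x) (Const 1)))))"

context machine
begin

text \<open>Truncated subtraction makes the guard nonzero exactly while the counter is below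
  \<open>N\<close>. The invariant is demanded after the increment, because it may mention the
  counter's array.\<close>

lemma runs_For:
  assumes K: "2 * (weight e + 4) \<le> K" "20 \<le> K" and "N < 2 ^ b"
    and init: "I 0 (s(x := (s x)(0 := 0)))"
    and guard: "\<And>i s. I i s \<Longrightarrow> val e s = N"
    and step: "\<And>i s. i < N \<Longrightarrow> I i s \<Longrightarrow> s x 0 = i \<Longrightarrow>
      runs c s t (\<lambda>s'. s' x 0 = i \<and> I (Suc i) (s'(x := (s' x)(0 := Suc i))))"
    and final: "\<And>s. I N s \<Longrightarrow> s x 0 = N \<Longrightarrow> Q s"
  shows "runs (For x e c) s (N * (t + 2) + 2) Q"
proof -
  let ?I = "\<lambda>s. s x 0 \<le> N \<and> I (s x 0) s"
  let ?e = "Sub e (Var x)"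
  let ?c = "Seq c (Assign x (Add (Var x) (Const 1)))"
  have ve: "val ?e s = N - s x 0" if "?I s" for s using that guard by auto
  have "runs (Loop ?e ?c) (s(x := (s x)(0 := 0))) (N * Suc (t + 1) + 1) Q"
  proof (rule runs_Loop[where I = ?I and m = "\<lambda>s. N - s x 0"])
    fix s assume s: "?I s" "val ?e s \<noteq> 0"
    then have lt: "s x 0 < N" using ve[OF s(1)] by simp
    have "runs ?c s (t + 1) (\<lambda>s'. ?I s' \<and> s' x 0 = Suc (s x 0))"
    proof (rule runs_Seq)
      show "runs c s t (\<lambda>s'. s' x 0 = s x 0 \<and> I (Suc (s x 0)) (s'(x := (s' x)(0 := Suc (s x 0)))))"
        using s lt by (intro step) auto
    next
      fix s' assume "s' x 0 = s x 0 \<and> I (Suc (s x 0)) (s'(x := (s' x)(0 := Suc (s x 0))))"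
      then show "runs (Assign x (Add (Var x) (Const 1))) s' 1 (\<lambda>s'. ?I s' \<and> s' x 0 = Suc (s x 0))"
        using lt K \<open>N < 2 ^ b\<close> by (intro runs_Write) auto
    qed
    then show "runs ?c s (t + 1) (\<lambda>s'. ?I s' \<and> N - s' x 0 < N - s x 0)"
      by (rule runs_mono) (use lt in auto)
  next
    fix s assume "?I s" "val ?e s = 0"
    then have "I N s" "s x 0 = N" using ve[of s] by auto
    then show "Q s" by (rule final)
  qed (use K init in auto)
  then have "runs (For x e c) s (Suc (N * Suc (t + 1) + 1)) Q"
    unfolding For_def using K by (intro runs_Seq_Write) auto
  then show ?thesis by simp
qed

end

section \<open>The search program\<close>

text \<open>
  The queue entry number \<open>i\<close> is the block of \<open>n * n\<close> cells of \<open>m\<close> starting at \<open>i * (n * n)\<close>, together with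
  the cells \<open>v\<close> and \<open>j\<close> at index \<open>i\<close>. The block holds the adjacency matrix of the tree built so far,
  with the visited set on its diagonal. Entries \<open>h, ..., q - 1\<close> are waiting, \<open>V\<close> marks the codes of
  the expanded states, and \<open>i\<close> is the best complete entry found.
\<close>

abbreviation size_exp :: exp where "size_exp \<equiv> Var ''n''"

definition cell_exp :: "exp \<Rightarrow> exp \<Rightarrow> exp \<Rightarrow> exp" where
  "cell_exp i x w = Read ''m'' (Add (Mul i (Mul size_exp size_exp)) (Add (Mul x size_exp) w))"

definition adj_exp :: "exp \<Rightarrow> exp \<Rightarrow> exp" where
  "adj_exp x w = Read ''adj'' (Add (Mul x size_exp) w)"

abbreviation member_exp :: "aname \<Rightarrow> exp" where
  "member_exp x \<equiv> cell_exp (Var ''h'') (Var x) (Var x)"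

text \<open>The two truncated differences add up to the absolute difference, which for membership
  bits is the exclusive or.\<close>

definition differ_exp :: exp where
  "differ_exp = Add (Sub (member_exp ''x'') (member_exp ''w'')) (Sub (member_exp ''w'') (member_exp ''x''))"

definition row_com :: com where
  "row_com = For ''w'' size_exp
     (Seq (Assign ''A'' (Add (Var ''A'') (Mul (adj_exp (Var ''x'') (Var ''w'')) differ_exp)))
     (Seq (Assign ''B'' (Add (Var ''B'') (adj_exp (Var ''x'') (Var ''w''))))
          (Assign ''s'' (Add (Var ''s'') (Mul (adj_exp (Var ''x'') (Var ''w'')) (Sub (Const 1) differ_exp))))))"

definition vertex_com :: com where
  "vertex_com =
     Seq (Assign ''c'' (Add (Add (Var ''c'') (Var ''c'')) (member_exp ''x''))) (
     Seq (Assign ''z'' (Add (Var ''z'') (member_exp ''x''))) (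
     Seq (Assign ''s'' (Const 0)) (
     Seq row_com
       (Assign ''D'' (Add (Var ''D'') (Sub (Const 1) (Var ''s'')))))))"

text \<open>\<open>A\<close> and \<open>B\<close> end as the two sides of the first inequality of
  \<open>sparse_cut\<close>, their constant terms being the initial values. \<open>D\<close> counts
  the vertices without a neighbour on their own side, \<open>z\<close> is the size of the set, and
  \<open>c\<close> is its code with \<open>v\<close> and \<open>j\<close> appended as digits in base
  \<open>n\<close>.\<close>

definition check_com :: com where
  "check_com =
     Seq (Assign ''c'' (Const 0)) (
     Seq (Assign ''A'' (Add size_exp size_exp)) (
     Seq (Assign ''B'' (Add (Add (Var ''L'') (Var ''L'')) (Const 2))) (
     Seq (Assign ''D'' (Const 0)) (
     Seq (Assign ''z'' (Const 0)) (
     Seq (For ''x'' size_exp vertex_com)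
       (Assign ''c'' (Add (Mul (Add (Mul (Var ''c'') size_exp) (Read ''v'' (Var ''h''))) size_exp) (Read ''j'' (Var ''h'')))))))))"

definition copy_com :: com where
  "copy_com = For ''k'' (Mul size_exp size_exp)
     (Write ''m'' (Add (Mul (Var ''q'') (Mul size_exp size_exp)) (Var ''k''))
        (Read ''m'' (Add (Mul (Var ''h'') (Mul size_exp size_exp)) (Var ''k''))))"

text \<open>The edge is entered symmetrically and the new vertex on the diagonal. Subtracting twice
  from 1 turns the distance of \<open>x\<close> and the last vertex into 0 or 1, so the counter
  grows exactly at a jump.\<close>

definition extend_com :: com where
  "extend_com =
     Seq (Write ''m'' (Add (Mul (Var ''q'') (Mul size_exp size_exp)) (Add (Mul (Var ''x'') size_exp) (Var ''w''))) (Const 1)) (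
     Seq (Write ''m'' (Add (Mul (Var ''q'') (Mul size_exp size_exp)) (Add (Mul (Var ''w'') size_exp) (Var ''x''))) (Const 1)) (
     Seq (Write ''m'' (Add (Mul (Var ''q'') (Mul size_exp size_exp)) (Add (Mul (Var ''w'') size_exp) (Var ''w''))) (Const 1)) (
     Seq (Write ''v'' (Var ''q'') (Var ''w'')) (
     Seq (Write ''j'' (Var ''q'') (Add (Read ''j'' (Var ''h''))
       (Sub (Const 1) (Sub (Const 1) (Add (Sub (Var ''x'') (Read ''v'' (Var ''h''))) (Sub (Read ''v'' (Var ''h'')) (Var ''x''))))))) (
          (Assign ''q'' (Add (Var ''q'') (Const 1))))))))"

definition push_com :: com where
  "push_com = Seq copy_com extend_com"

definition expand_com :: com where
  "expand_com = For ''x'' size_exp (For ''w'' size_exp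
     (Cond (Mul (member_exp ''x'') (Mul (adj_exp (Var ''x'') (Var ''w'')) (Sub (Const 1) (member_exp ''w''))))
        push_com Skip))"

section \<open>Unchanged arrays, queue entries and codes of states\<close>

definition agree :: "aname set \<Rightarrow> state \<Rightarrow> state \<Rightarrow> bool" where
  "agree X s s' \<longleftrightarrow> (\<forall>y. y \<notin> X \<longrightarrow> s' y = s y)"

lemma agreeD: "agree X s s' \<Longrightarrow> y \<notin> X \<Longrightarrow> s' y = s y"
  by (simp add: agree_def)

lemma agree_trans: "agree X s s' \<Longrightarrow> agree Y s' s'' \<Longrightarrow> X \<subseteq> Z \<Longrightarrow> Y \<subseteq> Z \<Longrightarrow> agree Z s s''"
  unfolding agree_def by (metis subsetD)

lemma agree_refl: "agree X s s"
  by (simp add: agree_def)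

lemma agree_upd: "agree X s s' \<Longrightarrow> x \<in> X \<Longrightarrow> agree X s (s'(x := f))"
  by (auto simp: agree_def)

definition cell :: "nat \<Rightarrow> nat set \<Rightarrow> nat set set \<Rightarrow> nat \<Rightarrow> nat" where
  "cell n S T k = of_bool ((k div n = k mod n \<and> k mod n \<in> S) \<or> {k div n, k mod n} \<in> T)"

type_synonym entry = "nat set \<times> nat \<times> nat \<times> nat set set"

fun rep :: "nat \<Rightarrow> state \<Rightarrow> nat \<Rightarrow> entry \<Rightarrow> bool" where
  "rep n s i (S, v, j, T) \<longleftrightarrow>
     (\<forall>k<n * n. s ''m'' (i * (n * n) + k) = cell n S T k) \<and> s ''v'' i = v \<and> s ''j'' i = j"

text \<open>The characteristic vector of \<open>S\<close> as a binary number with vertex 0 as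
  leading digit, matching the doubling of \<open>c\<close> in \<open>vertex_com\<close>.\<close>

fun pcode :: "nat set \<Rightarrow> nat \<Rightarrow> nat" where
  "pcode S 0 = 0"
| "pcode S (Suc i) = pcode S i + pcode S i + of_bool (i \<in> S)"

fun code :: "nat \<Rightarrow> nat set \<times> nat \<times> nat \<Rightarrow> nat" where
  "code n (S, v, j) = (pcode S n * n + v) * n + j"

lemma pcode_less: "pcode S i < 2 ^ i"
  by (induction i) auto

lemma pcode_inj: "pcode S i = pcode S' i \<Longrightarrow> S \<inter> {..<i} = S' \<inter> {..<i}"
proof (induction i)
  case (Suc i)
  have "(2 * a + of_bool P = 2 * c + of_bool Q) = (a = c \<and> P = Q)" for a c :: nat and P Q
    by (cases P; cases Q) (auto; presburger)+
  from this[of "pcode S i" "i \<in> S" "pcode S' i" "i \<in> S'"] Suc.prems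
  have "pcode S i = pcode S' i" "(i \<in> S) = (i \<in> S')" by (auto simp: mult_2)
  with Suc.IH show ?case by (auto simp: lessThan_Suc)
qed simp

lemma code_less:
  assumes "v < n" "j < n"
  shows "code n (S, v, j) < 2 ^ n * (n * n)"
proof -
  have 1: "pcode S n * n + v < 2 ^ n * n"
    using mult_le_mono1[of "Suc (pcode S n)" "2 ^ n" n] pcode_less[of S n] assms(1) by simp
  have "(pcode S n * n + v) * n + j < 2 ^ n * n * n"
    using mult_le_mono1[of "Suc (pcode S n * n + v)" "2 ^ n * n" n] 1 assms(2) by simp
  then show ?thesis by (simp add: mult.assoc)
qed

lemma div_mod_unique: "v < n \<Longrightarrow> (a * n + v) div n = a \<and> (a * n + v) mod n = (v::nat)"
  by simp

text \<open>As \<open>v\<close> and \<open>j\<close> are below \<open>n\<close>, division recovers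
  them as digits in base \<open>n\<close>. Hence a mark in the array \<open>V\<close> identifies
  exactly one state.\<close>

lemma code_inj:
  assumes "code n (S, v, j) = code n (S', v', j')" "v < n" "j < n" "v' < n" "j' < n" "S \<subseteq> {..<n}" "S' \<subseteq> {..<n}"
  shows "(S, v, j) = (S', v', j')"
proof -
  have eq: "(pcode S n * n + v) * n + j = (pcode S' n * n + v') * n + j'" using assms(1) by simp
  then have "j = j'" "pcode S n * n + v = pcode S' n * n + v'"
    using div_mod_unique[OF assms(3)] div_mod_unique[OF assms(5)] by metis+
  moreover from this(2) have "v = v'" "pcode S n = pcode S' n"
    using div_mod_unique[OF assms(2)] div_mod_unique[OF assms(4)] by metis+
  ultimately show ?thesis using pcode_inj[of S n S'] assms(6,7) by (auto simp: Int_absorb2)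
qed

text \<open>Partial counts up to the loop counter, the form in which accumulators enter the loop
  invariants.\<close>

definition count_below :: "nat set \<Rightarrow> nat \<Rightarrow> nat" where
  "count_below Y i = card (Y \<inter> {..<i})"

lemma count_below_0 [simp]: "count_below Y 0 = 0"
  by (simp add: count_below_def)

lemma count_below_Suc [simp]: "count_below Y (Suc i) = count_below Y i + of_bool (i \<in> Y)"
proof -
  have "Y \<inter> {..<Suc i} = (if i \<in> Y then insert i (Y \<inter> {..<i}) else Y \<inter> {..<i})"
    by (auto simp: lessThan_Suc)
  then show ?thesis by (simp add: count_below_def)
qed

lemma count_below_le: "count_below Y i \<le> i"
  by (induction i) auto

lemma count_below_eq: "Y \<subseteq> {..<n} \<Longrightarrow> count_below Y n = card Y"
  by (simp add: count_below_def Int_absorb2)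

lemma index_less:
  assumes "x < n" "w < n"
  shows "x * n + w < n * (n::nat)"
  using mult_le_mono1[of "Suc x" n n] assms by simp

text \<open>\<open>K\<close> dominates the weights of all expressions in the program; weights
  multiply under \<open>Mul\<close>, so \<open>10 ^ 9\<close> is generous. The first capacity covers
  the sums \<open>A\<close> and \<open>B\<close>, the second the codes of states.\<close>

locale mist = machine +
  fixes n E L
  assumes simple: "simple_graph {..<n} E"
    and big_K: "10 ^ 9 \<le> K"
    and L_le: "L \<le> 2 * n + 3"
    and cap: "n * n + 4 * n + 20 \<le> 2 ^ b" "2 ^ n * (n * n) + 2 ^ n \<le> 2 ^ b"
begin

lemma weight_le: "w \<le> 10 ^ 9 \<Longrightarrow> w \<le> K"
  using big_K by linarith

lemmas weight_simps = cell_exp_def adj_exp_def differ_exp_def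

section \<open>Reading the graph and testing sparsity\<close>

lemma nbrs_less: "nbrs E x \<subseteq> {..<n}"
  using nbrs_subset[OF simple, of x] by blast

definition inp :: "state \<Rightarrow> bool" where
  "inp s \<longleftrightarrow> s ''n'' 0 = n \<and> s ''adj'' = adjacency n E \<and> s ''L'' 0 = L"

lemma inp_agree: "inp s \<Longrightarrow> agree X s s' \<Longrightarrow> {''n'', ''adj'', ''L''} \<inter> X = {} \<Longrightarrow> inp s'"
  by (auto simp: inp_def agree_def)

lemma adj_val: "inp s \<Longrightarrow> x < n \<Longrightarrow> w < n \<Longrightarrow> s ''adj'' (x * n + w) = of_bool (w \<in> nbrs E x)"
  using index_less[of x n w] by (simp add: inp_def adjacency_def nbrs_def)

definition members :: "state \<Rightarrow> nat \<Rightarrow> nat set \<Rightarrow> bool" where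
  "members s h S \<longleftrightarrow> (\<forall>y<n. s ''m'' (h * (n * n) + (y * n + y)) = of_bool (y \<in> S))"

lemma members_agree: "members s h S \<Longrightarrow> agree X s s' \<Longrightarrow> ''m'' \<notin> X \<Longrightarrow> members s' h S"
  by (auto simp: members_def agree_def)

lemma cut_nbrs_less: "cut_nbrs E S x \<subseteq> {..<n}" "nbrs E x - cut_nbrs E S x \<subseteq> {..<n}"
  using nbrs_less by (auto simp: cut_nbrs_def)

lemma differ_val:
  assumes "members s h S" "s ''n'' 0 = n" "s ''h'' 0 = h" "s ''x'' 0 = x" "s ''w'' 0 = w" "x < n" "w < n"
  shows "val differ_exp s = of_bool ((w \<in> S) \<noteq> (x \<in> S))"
  using assms by (auto simp: differ_exp_def cell_exp_def members_def)

lemma runs_row: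
  assumes "inp s" "members s h S" "s ''h'' 0 = h" "s ''x'' 0 = x" "x < n"
    "s ''A'' 0 + n < 2 ^ b" "s ''B'' 0 + n < 2 ^ b" "s ''s'' 0 = 0"
  shows "runs row_com s (n * 5 + 2) (\<lambda>s'. agree {''w'', ''A'', ''B'', ''s''} s s' \<and>
    s' ''A'' 0 = s ''A'' 0 + card (cut_nbrs E S x) \<and> s' ''B'' 0 = s ''B'' 0 + card (nbrs E x) \<and>
    s' ''s'' 0 = card (nbrs E x - cut_nbrs E S x))"
proof -
  let ?I = "\<lambda>i s'. agree {''w'', ''A'', ''B'', ''s''} s s' \<and>
    s' ''A'' 0 = s ''A'' 0 + count_below (cut_nbrs E S x) i \<and>
    s' ''B'' 0 = s ''B'' 0 + count_below (nbrs E x) i \<and>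
    s' ''s'' 0 = count_below (nbrs E x - cut_nbrs E S x) i"
  have n2: "n < 2 ^ b" using cap by linarith
  have "runs row_com s (n * (Suc (Suc 1) + 2) + 2) (?I n)"
    unfolding row_com_def
  proof (rule runs_For[where I = ?I])
    fix i s' assume i: "i < n" and I: "?I i s'" and w: "s' ''w'' 0 = i"
    have ag: "agree {''w'', ''A'', ''B'', ''s''} s s'" using I by blast
    have s': "inp s'" "members s' h S" "s' ''h'' 0 = h" "s' ''x'' 0 = x" "s' ''n'' 0 = n"
      using assms inp_agree[OF assms(1) ag] members_agree[OF assms(2) ag] agreeD[OF ag] by (auto simp: inp_def)
    have upd: "inp (s'(y := f))" "members (s'(y := f)) h S" if "y \<in> {''A'', ''B''}" for y f
      using s' that by (auto simp: inp_def members_def)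
    have c1: "s ''A'' 0 + count_below (cut_nbrs E S x) i + 1 < 2 ^ b"
      and c2: "s ''B'' 0 + count_below (nbrs E x) i + 1 < 2 ^ b"
      and c3: "count_below (nbrs E x - cut_nbrs E S x) i + 1 < 2 ^ b"
      using count_below_le[of "cut_nbrs E S x" i] count_below_le[of "nbrs E x" i]
        count_below_le[of "nbrs E x - cut_nbrs E S x" i] assms(6,7) i cap by linarith+
    have adj_v: "val (adj_exp (Var ''x'') (Var ''w'')) r = of_bool (i \<in> nbrs E x)"
      if "inp r" "r ''x'' 0 = x" "r ''w'' 0 = i" for r
      using adj_val[OF that(1) assms(5) i] that by (simp add: adj_exp_def inp_def)
    have dv: "val differ_exp r = of_bool ((i \<in> S) \<noteq> (x \<in> S))"
      if "members r h S" "inp r" "r ''h'' 0 = h" "r ''x'' 0 = x" "r ''w'' 0 = i" for r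
      using differ_val[OF that(1) _ that(3,4,5) assms(5) i] that(2) by (simp add: inp_def)
    have cut: "i \<in> cut_nbrs E S x \<longleftrightarrow> i \<in> nbrs E x \<and> (i \<in> S) \<noteq> (x \<in> S)" by (auto simp: cut_nbrs_def)
    show "runs (Seq (Assign ''A'' (Add (Var ''A'') (Mul (adj_exp (Var ''x'') (Var ''w'')) differ_exp)))
      (Seq (Assign ''B'' (Add (Var ''B'') (adj_exp (Var ''x'') (Var ''w''))))
          (Assign ''s'' (Add (Var ''s'') (Mul (adj_exp (Var ''x'') (Var ''w'')) (Sub (Const 1) differ_exp))))))
      s' (Suc (Suc 1)) (\<lambda>s''. s'' ''w'' 0 = i \<and> ?I (Suc i) (s''(''w'' := (s'' ''w'')(0 := Suc i))))"
      apply (rule runs_Seq_Write)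
        apply (rule weight_le, simp add: weight_simps)
       subgoal using I c1 by (simp add: adj_v dv s' w)
      apply (rule runs_Seq_Write)
        apply (rule weight_le, simp add: weight_simps)
       subgoal using I c2 by (simp add: adj_v upd s' w)
      apply (rule runs_Write)
        apply (rule weight_le, simp add: weight_simps)
       subgoal using I c3 by (simp add: adj_v dv inp_def members_def s'(1,2)[unfolded inp_def members_def] s'(3,4) w)
      using I by (simp add: adj_v dv inp_def members_def s'(1,2)[unfolded inp_def members_def] s'(3,4) w cut
          agree_upd)
  next
    fix i s' assume "?I i s'"
    then show "val size_exp s' = n" using assms(1) by (simp add: agree_def inp_def)
  qed (use n2 assms(8) in \<open>auto simp: agree_def intro!: weight_le\<close>)
  then show ?thesis
    by (rule runs_mono) (auto simp: count_below_eq nbrs_less cut_nbrs_less)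
qed


lemma card_nbrs_le: "card (nbrs E x) \<le> n" "card (cut_nbrs E S x) \<le> n"
  using card_mono[OF _ nbrs_less[of x]] card_mono[OF _ cut_nbrs_less(1)[of S x]] by auto

lemma cut_all_iff: "card (nbrs E x - cut_nbrs E S x) = 0 \<longleftrightarrow> card (cut_nbrs E S x) = card (nbrs E x)"
proof -
  have fin: "finite (nbrs E x)" using nbrs_less finite_subset by blast
  have sub: "cut_nbrs E S x \<subseteq> nbrs E x" by (auto simp: cut_nbrs_def)
  then have "card (nbrs E x - cut_nbrs E S x) = card (nbrs E x) - card (cut_nbrs E S x)"
    using fin finite_subset by (intro card_Diff_subset) auto
  then show ?thesis using card_mono[OF fin sub] by linarith
qed

lemma runs_check:
  assumes "inp s" "members s h S" "s ''h'' 0 = h" "s ''v'' h = v" "s ''j'' h = j" "v < n" "j < n" "S \<subseteq> {..<n}"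
  shows "runs check_com s (n * (n * 5 + 8) + 8) (\<lambda>s'. agree {''c'', ''A'', ''B'', ''D'', ''z'', ''x'', ''w'', ''s''} s s' \<and>
    s' ''c'' 0 = code n (S, v, j) \<and>
    (s' ''A'' 0 \<le> s' ''B'' 0 \<and> s' ''D'' 0 \<le> L + L \<longleftrightarrow> sparse_cut {..<n} E L S) \<and> s' ''z'' 0 = card S)"
proof -
  let ?X = "{''c'', ''A'', ''B'', ''D'', ''z'', ''x'', ''w'', ''s''}"
  let ?bad = "{x. card (cut_nbrs E S x) = card (nbrs E x)}"
  let ?I = "\<lambda>i s'. agree ?X s s' \<and> s' ''c'' 0 = pcode S i \<and> s' ''z'' 0 = count_below S i \<and>
     s' ''A'' 0 = n + n + (\<Sum>x<i. card (cut_nbrs E S x)) \<and>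
     s' ''B'' 0 = L + L + 2 + (\<Sum>x<i. card (nbrs E x)) \<and> s' ''D'' 0 = count_below ?bad i"
  let ?loop = "For ''x'' size_exp vertex_com"
  have n2: "n < 2 ^ b" using cap by linarith
  have b0: "(0::nat) < 2 ^ b" by simp
  have sumA: "(\<Sum>x<i. card (cut_nbrs E S x)) \<le> i * n" and sumB: "(\<Sum>x<i. card (nbrs E x)) \<le> i * n" for i
    using sum_bounded_above[of "{..<i}" "\<lambda>x. card (cut_nbrs E S x)" n]
      sum_bounded_above[of "{..<i}" "\<lambda>x. card (nbrs E x)" n] card_nbrs_le by auto
  have loop: "runs ?loop r (n * (Suc (Suc (Suc (n * 5 + 2 + 1))) + 2) + 2) (?I n)" if r: "?I 0 r" for r
  proof (rule runs_For[where I = ?I])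
    fix i s' assume i: "i < n" and I: "?I i s'" and x: "s' ''x'' 0 = i"
    have ag: "agree ?X s s'" using I by blast
    have s': "inp s'" "members s' h S" "s' ''h'' 0 = h" "s' ''n'' 0 = n"
      using assms inp_agree[OF assms(1) ag] members_agree[OF assms(2) ag] agreeD[OF ag] by (auto simp: inp_def)
    have inn: "i * n + n \<le> n * n" using mult_le_mono1[of "Suc i" n n] i by simp
    have mem: "val (member_exp ''x'') r = of_bool (i \<in> S)"
      if "members r h S" "r ''n'' 0 = n" "r ''h'' 0 = h" "r ''x'' 0 = i" for r
      using that i by (simp add: members_def cell_exp_def)
    have c1: "pcode S i + pcode S i + of_bool (i \<in> S) < 2 ^ b"
    proof -
      have "pcode S (Suc i) < 2 ^ Suc i" by (rule pcode_less)
      also have "\<dots> \<le> 2 ^ n" using i by (intro power_increasing) auto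
      also have "\<dots> \<le> 2 ^ b" using cap(2) by linarith
      finally show ?thesis by simp
    qed
    have c2: "count_below S i + of_bool (i \<in> S) < 2 ^ b" "count_below ?bad i + 1 < 2 ^ b"
      using count_below_le[of S "Suc i"] count_below_le[of ?bad i] i cap(1) by auto
    let ?r = "s'(''c'' := (s' ''c'')(0 := pcode S (Suc i)), ''z'' := (s' ''z'')(0 := count_below S (Suc i)),
       ''s'' := (s' ''s'')(0 := 0))"
    have r': "inp ?r" "members ?r h S" "?r ''h'' 0 = h" "?r ''x'' 0 = i" "?r ''s'' 0 = 0"
      using s' x by (auto simp: inp_def members_def)
    have bA: "?r ''A'' 0 + n < 2 ^ b" "?r ''B'' 0 + n < 2 ^ b"
      using I sumA[of i] sumB[of i] inn cap(1) L_le by auto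
    have row: "runs row_com ?r (n * 5 + 2) (\<lambda>s''. agree {''w'', ''A'', ''B'', ''s''} ?r s'' \<and>
      s'' ''A'' 0 = ?r ''A'' 0 + card (cut_nbrs E S i) \<and> s'' ''B'' 0 = ?r ''B'' 0 + card (nbrs E i) \<and>
      s'' ''s'' 0 = card (nbrs E i - cut_nbrs E S i))"
      by (rule runs_row[OF r'(1-4) i bA r'(5)])
    have rest: "runs (Seq row_com (Assign ''D'' (Add (Var ''D'') (Sub (Const 1) (Var ''s''))))) ?r (n * 5 + 2 + 1)
      (\<lambda>s''. s'' ''x'' 0 = i \<and> ?I (Suc i) (s''(''x'' := (s'' ''x'')(0 := Suc i))))"
    proof (rule runs_Seq[OF row])
      fix s'' assume R: "agree {''w'', ''A'', ''B'', ''s''} ?r s'' \<and>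
        s'' ''A'' 0 = ?r ''A'' 0 + card (cut_nbrs E S i) \<and> s'' ''B'' 0 = ?r ''B'' 0 + card (nbrs E i) \<and>
        s'' ''s'' 0 = card (nbrs E i - cut_nbrs E S i)"
      then have ag': "agree {''w'', ''A'', ''B'', ''s''} ?r s''" by blast
      have sc: "s'' ''c'' = ?r ''c''" "s'' ''z'' = ?r ''z''" "s'' ''D'' = ?r ''D''" "s'' ''x'' = ?r ''x''"
        by (rule agreeD[OF ag'], simp)+
      have "agree ?X s s''"
        unfolding agree_def
      proof (intro allI impI)
        fix y assume y: "y \<notin> ?X"
        then show "s'' y = s y" using agreeD[OF ag', of y] agreeD[OF ag, of y] by simp
      qed
      \<comment> \<open>By truncated subtraction, \<open>1 - s\<close> is 1 exactly if no neighbour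
        lies on the own side.\<close>
      moreover have "Suc 0 - card (nbrs E i - cut_nbrs E S i) = of_bool (i \<in> ?bad)"
        using cut_all_iff[of i S] by auto
      ultimately show "runs (Assign ''D'' (Add (Var ''D'') (Sub (Const 1) (Var ''s'')))) s'' 1
         (\<lambda>s''. s'' ''x'' 0 = i \<and> ?I (Suc i) (s''(''x'' := (s'' ''x'')(0 := Suc i))))"
        using R I c2(2) x by (intro runs_Write weight_le) (simp_all add: sc agree_upd)
    qed
    show "runs vertex_com s' (Suc (Suc (Suc (n * 5 + 2 + 1))))
       (\<lambda>s''. s'' ''x'' 0 = i \<and> ?I (Suc i) (s''(''x'' := (s'' ''x'')(0 := Suc i))))"
      unfolding vertex_com_def
      apply (rule runs_Seq_Write)
        apply (rule weight_le, simp add: weight_simps)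
       subgoal using I c1 by (simp add: mem s' x)
      apply (rule runs_Seq_Write)
        apply (rule weight_le, simp add: weight_simps)
       subgoal using I c2 s' x by (subst val.simps, subst mem) (simp_all add: members_def)
      apply (rule runs_Seq_Write)
        apply (rule weight_le, simp)
       apply simp
      subgoal
      proof -
        let ?s1 = "s'(''c'' := (s' ''c'')(0 := pcode S (Suc i)))"
        have v1: "val (Add (Add (Var ''c'') (Var ''c'')) (member_exp ''x'')) s' = pcode S (Suc i)"
          using I by (simp add: mem s' x)
        have "members ?s1 h S" using s'(2) by (simp add: members_def)
        then have v2: "val (Add (Var ''z'') (member_exp ''x'')) ?s1 = count_below S (Suc i)"
          using I s' x by (simp add: mem)
        have st: "?s1(''z'' := (?s1 ''z'')(0 := count_below S (Suc i)),
            ''s'' := ((?s1(''z'' := (?s1 ''z'')(0 := count_below S (Suc i)))) ''s'')(0 := 0)) = ?r" by simp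
        show ?thesis unfolding v1 val.simps(1) v2 st by (rule rest)
      qed
      done
  next
    fix i s' assume "?I i s'"
    then show "val size_exp s' = n" using assms(1) by (simp add: agree_def inp_def)
  next
    show "?I 0 (r(''x'' := (r ''x'')(0 := 0)))" using r by (simp add: agree_upd)
  qed (use n2 in \<open>auto intro!: weight_le\<close>)
  let ?fin = "Assign ''c'' (Add (Mul (Add (Mul (Var ''c'') size_exp) (Read ''v'' (Var ''h''))) size_exp) (Read ''j'' (Var ''h'')))"
  let ?Q = "\<lambda>s'. agree ?X s s' \<and> s' ''c'' 0 = code n (S, v, j) \<and>
    (s' ''A'' 0 \<le> s' ''B'' 0 \<and> s' ''D'' 0 \<le> L + L \<longleftrightarrow> sparse_cut {..<n} E L S) \<and> s' ''z'' 0 = card S"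
  have fin: "runs (Seq ?loop ?fin) r (n * (Suc (Suc (Suc (n * 5 + 2 + 1))) + 2) + 2 + 1) ?Q" if r: "?I 0 r" for r
  proof (rule runs_Seq[OF loop[OF r]])
    fix s' assume I: "?I n s'"
    then have ag: "agree ?X s s'" by blast
    have sc: "s' ''h'' 0 = h" "s' ''v'' h = v" "s' ''j'' h = j" "s' ''n'' 0 = n"
      using agreeD[OF ag] assms by (auto simp: inp_def)
    have "code n (S, v, j) < 2 ^ b" using code_less[OF assms(6,7), of S] cap(2) by linarith
    moreover have "count_below ?bad n = card {v \<in> {..<n}. card (cut_nbrs E S v) = card (nbrs E v)}"
      unfolding count_below_def by (rule arg_cong[where f = card]) auto
    moreover have "count_below S n = card S" using assms(8) by (rule count_below_eq)
    ultimately show "runs ?fin s' 1 ?Q"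
      using I sc by (intro runs_Write weight_le) (auto simp: sparse_cut_def agree_upd)
  qed
  have c3: "n + n < 2 ^ b" "L + L + 2 < 2 ^ b" using cap(1) L_le by linarith+
  have nv: "s ''n'' 0 = n" "s ''L'' 0 = L" using assms(1) by (auto simp: inp_def)
  have "runs check_com s (Suc (Suc (Suc (Suc (Suc (n * (Suc (Suc (Suc (n * 5 + 2 + 1))) + 2) + 2 + 1)))))) ?Q"
    unfolding check_com_def
    apply (rule runs_Seq_Write, (rule weight_le, simp), simp)
    apply (rule runs_Seq_Write, (rule weight_le, simp), simp add: nv c3)
    apply (rule runs_Seq_Write, (rule weight_le, simp), use c3 in \<open>simp add: nv\<close>)
    apply (rule runs_Seq_Write, (rule weight_le, simp), simp)
    apply (rule runs_Seq_Write, (rule weight_le, simp), simp)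
    apply (rule fin)
    apply (simp add: nv agree_refl agree_upd)
    done
  then show ?thesis by (rule runs_mono) (simp_all add: algebra_simps)
qed


section \<open>Appending a successor to the queue\<close>

lemma cell_insert:
  assumes "k < n * n" "x < n" "w < n" "x \<noteq> w"
  shows "cell n (insert w S) (insert {x, w} T) k =
    (if k = x * n + w \<or> k = w * n + x \<or> k = w * n + w then 1 else cell n S T k)"
proof -
  define a c where "a = k div n" and "c = k mod n"
  have k: "k = a * n + c" unfolding a_def c_def by simp
  have c: "c < n" using assms(2) unfolding c_def by (intro mod_less_divisor) linarith
  have eq: "k = p * n + q \<longleftrightarrow> a = p \<and> c = q" if "q < n" for p q
    using div_mod_unique[OF that, of p] k unfolding a_def c_def by metis
  have e: "{a, c} = {x, w} \<longleftrightarrow> (a = x \<and> c = w) \<or> (a = w \<and> c = x)"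
    by (rule doubleton_eq_iff)
  have "(a = c \<and> c \<in> insert w S) \<or> {a, c} \<in> insert {x, w} T \<longleftrightarrow>
    (a = x \<and> c = w) \<or> (a = w \<and> c = x) \<or> (a = w \<and> c = w) \<or> (a = c \<and> c \<in> S) \<or> {a, c} \<in> T"
    unfolding insert_iff e by blast
  moreover have "k = x * n + w \<or> k = w * n + x \<or> k = w * n + w \<longleftrightarrow>
    (a = x \<and> c = w) \<or> (a = w \<and> c = x) \<or> (a = w \<and> c = w)"
    by (simp only: eq[OF assms(3), of x] eq[OF assms(2), of w] eq[OF assms(3), of w])
  ultimately have *: "(a = c \<and> c \<in> insert w S) \<or> {a, c} \<in> insert {x, w} T \<longleftrightarrow>
    (k = x * n + w \<or> k = w * n + x \<or> k = w * n + w) \<or> (a = c \<and> c \<in> S) \<or> {a, c} \<in> T" by argo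
  have cell: "cell n S' T' k = of_bool ((a = c \<and> c \<in> S') \<or> {a, c} \<in> T')" for S' T'
    unfolding cell_def a_def c_def ..
  have "of_bool (P \<or> Q) = (if P then 1 else of_bool Q :: nat)" for P Q by simp
  then show ?thesis unfolding cell * .
qed

lemma block_disjoint:
  assumes "i < q" "k < n * n"
  shows "i * (n * n) + k < q * (n * (n::nat))"
proof -
  have "Suc i * (n * n) \<le> q * (n * n)" using assms(1) by (intro mult_le_mono1) simp
  then show ?thesis using assms(2) by simp
qed

lemma runs_push:
  assumes "inp s" "s ''h'' 0 = h" "s ''q'' 0 = q" "s ''x'' 0 = x" "s ''w'' 0 = w" "h < q"
    "rep n s h (S, v, j, T)" "x < n" "w < n" "x \<noteq> w" "Suc q < 2 ^ b" "Suc j < 2 ^ b"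
  shows "runs push_com s (n * n * 3 + 8) (\<lambda>s'. agree {''k'', ''m'', ''v'', ''j'', ''q''} s s' \<and>
    s' ''q'' 0 = Suc q \<and> (\<forall>i<q. \<forall>e. rep n s i e \<longrightarrow> rep n s' i e) \<and>
    rep n s' q (insert w S, w, j + of_bool (x \<noteq> v), insert {x, w} T))"
proof -
  let ?I = "\<lambda>i s'. agree {''k'', ''m''} s s' \<and>
     s' ''m'' = (\<lambda>a. if q * (n * n) \<le> a \<and> a < q * (n * n) + i then s ''m'' (h * (n * n) + (a - q * (n * n))) else s ''m'' a)"
  have nv: "s ''n'' 0 = n" using assms(1) by (simp add: inp_def)
  have loop: "runs copy_com s ((n * n) * (1 + 2) + 2) (?I (n * n))"
    unfolding copy_com_def
  proof (rule runs_For[where I = ?I])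
    fix i s' assume i: "i < n * n" and I: "?I i s'" and k: "s' ''k'' 0 = i"
    have ag: "agree {''k'', ''m''} s s'" using I by blast
    have sc: "s' ''h'' 0 = h" "s' ''q'' 0 = q" "s' ''n'' 0 = n"
      using agreeD[OF ag] assms nv by auto
    have m: "s' ''m'' = (\<lambda>a. if q * (n * n) \<le> a \<and> a < q * (n * n) + i then s ''m'' (h * (n * n) + (a - q * (n * n))) else s ''m'' a)"
      using I by blast
    \<comment> \<open>The source block lies before the target block, so copying never reads a cell
      that it has overwritten.\<close>
    have lt: "h * (n * n) + i < q * (n * n)" using assms(6) i by (rule block_disjoint)
    then have src: "s' ''m'' (h * (n * n) + i) = s ''m'' (h * (n * n) + i)" unfolding m by simp
    have small: "s ''m'' (h * (n * n) + i) < 2 ^ b"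
    proof -
      have "s ''m'' (h * (n * n) + i) = cell n S T i" using assms(7) i by simp
      then have "s ''m'' (h * (n * n) + i) \<le> 1" by (simp add: cell_def)
      then show ?thesis using assms(11) by linarith
    qed
    show "runs (Write ''m'' (Add (Mul (Var ''q'') (Mul size_exp size_exp)) (Var ''k''))
          (Read ''m'' (Add (Mul (Var ''h'') (Mul size_exp size_exp)) (Var ''k'')))) s' 1
        (\<lambda>s''. s'' ''k'' 0 = i \<and> ?I (Suc i) (s''(''k'' := (s'' ''k'')(0 := Suc i))))"
    proof -
      let ?dst = "Add (Mul (Var ''q'') (Mul size_exp size_exp)) (Var ''k'')"
      let ?src = "Read ''m'' (Add (Mul (Var ''h'') (Mul size_exp size_exp)) (Var ''k''))"
      let ?s = "s'(''m'' := (s' ''m'')(q * (n * n) + i := s ''m'' (h * (n * n) + i)))"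
      have v: "val ?dst s' = q * (n * n) + i" "val ?src s' = s ''m'' (h * (n * n) + i)"
        by (simp_all add: sc src k)
      have "agree {''k'', ''m''} s (?s(''k'' := (?s ''k'')(0 := Suc i)))"
        using ag by (auto simp: agree_def)
      moreover have "?s ''m'' = (\<lambda>a. if q * (n * n) \<le> a \<and> a < q * (n * n) + Suc i
          then s ''m'' (h * (n * n) + (a - q * (n * n))) else s ''m'' a)"
        unfolding fun_upd_same m by (rule ext) auto
      ultimately have Q: "?s ''k'' 0 = i \<and> ?I (Suc i) (?s(''k'' := (?s ''k'')(0 := Suc i)))"
        using k by simp
      show ?thesis
        apply (rule runs_Write)
          apply (rule weight_le, simp)
        subgoal unfolding v by (rule small)
        subgoal unfolding v by (rule Q)
        done
    qed
  next
    fix i s' assume "?I i s'"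
    then show "val (Mul size_exp size_exp) s' = n * n" using nv by (simp add: agree_def)
  next
    show "n * n < 2 ^ b" using cap(1) by linarith
  qed (auto simp: agree_def intro!: weight_le)
  let ?Q = "\<lambda>s'. agree {''k'', ''m'', ''v'', ''j'', ''q''} s s' \<and>
    s' ''q'' 0 = Suc q \<and> (\<forall>i<q. \<forall>e. rep n s i e \<longrightarrow> rep n s' i e) \<and>
    rep n s' q (insert w S, w, j + of_bool (x \<noteq> v), insert {x, w} T)"
  have "runs push_com s ((n * n) * (1 + 2) + 2 + Suc (Suc (Suc (Suc (Suc 1))))) ?Q"
    unfolding push_com_def
  proof (rule runs_Seq[OF loop])
    fix s' assume I: "?I (n * n) s'"
    then have ag: "agree {''k'', ''m''} s s'" by blast
    have sc: "s' ''h'' 0 = h" "s' ''q'' 0 = q" "s' ''x'' 0 = x" "s' ''w'' 0 = w" "s' ''n'' 0 = n"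
      "s' ''v'' = s ''v''" "s' ''j'' = s ''j''" "s ''v'' h = v" "s ''j'' h = j"
      using agreeD[OF ag] assms nv by auto
    have m: "s' ''m'' = (\<lambda>a. if q * (n * n) \<le> a \<and> a < q * (n * n) + n * n then s ''m'' (h * (n * n) + (a - q * (n * n))) else s ''m'' a)"
      using I by blast
    define M where "M = (s' ''m'')(q * (n * n) + (x * n + w) := 1, q * (n * n) + (w * n + x) := 1, q * (n * n) + (w * n + w) := 1)"
    let ?j = "j + (Suc 0 - (Suc 0 - (x - v + (v - x))))"
    have j: "?j = j + of_bool (x \<noteq> v)" by auto
    let ?s = "s'(''m'' := M, ''v'' := (s' ''v'')(q := w), ''j'' := (s' ''j'')(q := ?j), ''q'' := (s' ''q'')(0 := Suc q))"
    have n2: "n < 2 ^ b" and one: "(1::nat) < 2 ^ b" using cap by linarith+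
    have ag2: "agree {''k'', ''m'', ''v'', ''j'', ''q''} s ?s"
      unfolding agree_def using agreeD[OF ag] by auto
    have old: "rep n ?s i e" if i: "i < q" and r: "rep n s i e" for i e
    proof (cases e)
      case (fields S' v' j' T')
      have "M (i * (n * n) + k) = s ''m'' (i * (n * n) + k)" if "k < n * n" for k
        using block_disjoint[OF i that] unfolding M_def m by simp
      then show ?thesis using r i fields by (simp add: sc)
    qed
    have new: "rep n ?s q (insert w S, w, ?j, insert {x, w} T)"
    proof -
      have "M (q * (n * n) + k) = cell n (insert w S) (insert {x, w} T) k" if k: "k < n * n" for k
      proof -
        have "s' ''m'' (q * (n * n) + k) = cell n S T k" using assms(7) k unfolding m by simp
        then show ?thesis unfolding cell_insert[OF k assms(8,9,10)] M_def by simp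
      qed
      then show ?thesis by simp
    qed
    have Q: "?Q ?s" using ag2 old new unfolding j by simp
    show "runs extend_com s' (Suc (Suc (Suc (Suc (Suc 1))))) ?Q"
      unfolding extend_com_def
      apply (rule runs_Seq_Write, (rule weight_le, simp), use one in simp)
      apply (rule runs_Seq_Write, (rule weight_le, simp), use one in simp)
      apply (rule runs_Seq_Write, (rule weight_le, simp), use one in simp)
      apply (rule runs_Seq_Write, (rule weight_le, simp), use assms(9) n2 in \<open>simp add: sc\<close>)
      apply (rule runs_Seq_Write, (rule weight_le, simp))
      subgoal using assms(12) assms(6) by (simp add: sc)
      apply (rule runs_Write, (rule weight_le, simp))
      subgoal using assms(11) by (simp add: sc)
      subgoal by (rule back_subst[where P = ?Q, OF Q]) (use assms(6) in \<open>simp add: sc M_def\<close>)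
      done
  qed
  then show ?thesis by (rule runs_mono) auto
qed

end

section \<open>Expanding a queue entry\<close>

fun triple :: "entry \<Rightarrow> nat set \<times> nat \<times> nat" where
  "triple (S, v, j, T) = (S, v, j)"

fun successor :: "nat set \<times> nat \<times> nat \<Rightarrow> nat \<Rightarrow> nat \<Rightarrow> nat set \<times> nat \<times> nat" where
  "successor (S, v, j) x w = (insert w S, w, j + of_bool (x \<noteq> v))"

context mist
begin

definition entries :: "state \<Rightarrow> entry list \<Rightarrow> bool" where
  "entries s es \<longleftrightarrow> s ''q'' 0 = length es \<and> (\<forall>i<length es. rep n s i (es ! i)) \<and>
     (\<forall>(S, v, j, T)\<in>set es. search {..<n} E S v j T)"

lemma rep_agree: "rep n s i e \<Longrightarrow> agree X s s' \<Longrightarrow> {''m'', ''v'', ''j''} \<inter> X = {} \<Longrightarrow> rep n s' i e"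
  by (cases e) (auto simp: agree_def)

lemma entries_agree:
  "entries s es \<Longrightarrow> agree X s s' \<Longrightarrow> {''m'', ''v'', ''j'', ''q''} \<inter> X = {} \<Longrightarrow> entries s' es"
  using rep_agree[of s _ _ X s'] agreeD[of X s s' "''q''"] by (auto simp: entries_def)

lemma members_rep:
  assumes "rep n s i (S, v, j, T)" "T \<subseteq> E"
  shows "members s i S"
  unfolding members_def
proof (intro allI impI)
  fix y assume y: "y < n"
  \<comment> \<open>\<open>T\<close> has no loops, so the diagonal of the block shows
    \<open>S\<close> alone.\<close>
  have "{y} \<notin> T" using simple assms(2) by (force simp: simple_graph_def)
  then show "s ''m'' (i * (n * n) + (y * n + y)) = of_bool (y \<in> S)"
    using assms(1) index_less[OF y y] y by (simp add: cell_def)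
qed

lemma search_bounds:
  assumes "search {..<n} E S v j T"
  shows "v < n" "j < n" "S \<subseteq> {..<n}" "T \<subseteq> E" "v \<in> S"
proof -
  note * = search_props[OF assms]
  show "v < n" "S \<subseteq> {..<n}" "T \<subseteq> E" "v \<in> S" using * by auto
  have "card S \<le> n" using card_mono[OF _ *(1)] by simp
  then show "j < n" using *(5) by linarith
qed

abbreviation expand_step_time :: nat where
  "expand_step_time \<equiv> n * n * 3 + 9"

text \<open>Progress of the double loop in lexicographic order. At \<open>a = n\<close> and
  \<open>c = 0\<close> it is the closure property that \<open>search_complete\<close> asks for. Only
  triples are compared, so it does not matter which tree realises a state.\<close>

definition covers :: "nat set \<times> nat \<times> nat \<Rightarrow> entry list \<Rightarrow> nat \<Rightarrow> nat \<Rightarrow> bool" where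
  "covers t es a c \<longleftrightarrow> (\<forall>x w. x \<in> fst t \<longrightarrow> w < n \<longrightarrow> (x < a \<or> x = a \<and> w < c) \<longrightarrow> w \<notin> fst t \<longrightarrow>
     {x, w} \<in> E \<longrightarrow> successor t x w \<in> triple ` set es)"

lemma covers_mono: "covers t es a c \<Longrightarrow> set es \<subseteq> set es' \<Longrightarrow> covers t es' a c"
  unfolding covers_def using image_mono[of "set es" "set es'" triple] by blast

lemma covers_Suc:
  assumes "covers t es x i" "x \<in> fst t \<Longrightarrow> i \<notin> fst t \<Longrightarrow> {x, i} \<in> E \<Longrightarrow> successor t x i \<in> triple ` set es"
  shows "covers t es x (Suc i)"
  unfolding covers_def
proof (intro allI impI)
  fix a c assume *: "a \<in> fst t" "c < n" "a < x \<or> a = x \<and> c < Suc i" "c \<notin> fst t" "{a, c} \<in> E"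
  show "successor t a c \<in> triple ` set es"
  proof (cases "a = x \<and> c = i")
    case True
    then show ?thesis using assms(2) * by simp
  next
    case False
    then have "a < x \<or> a = x \<and> c < i" using *(3) by linarith
    then show ?thesis using assms(1) * unfolding covers_def by blast
  qed
qed

lemma covers_row:
  assumes "covers t es x n"
  shows "covers t es (Suc x) 0"
  unfolding covers_def
proof (intro allI impI)
  fix a c assume *: "a \<in> fst t" "c < n" "a < Suc x \<or> a = Suc x \<and> c < 0" "c \<notin> fst t" "{a, c} \<in> E"
  then have "a < x \<or> a = x \<and> c < n" by linarith
  then show "successor t a c \<in> triple ` set es" using assms * unfolding covers_def by blast
qed

text \<open>Successors are appended without a test for duplicates or sparsity, which is postponed
  until they are reached; so one expansion adds at most one entry per pair of vertices.\<close>

lemma runs_expand: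
  assumes "inp s" "entries s es" "s ''h'' 0 = h" "h < length es" "length es + n * n < 2 ^ b"
  shows "runs expand_com s (n * (n * (expand_step_time + 2) + 4) + 2)
    (\<lambda>s'. agree {''k'', ''m'', ''v'', ''j'', ''q'', ''x'', ''w''} s s' \<and>
      (\<exists>fs. entries s' (es @ fs) \<and> length fs \<le> n * n \<and> covers (triple (es ! h)) (es @ fs) n 0))"
proof -
  obtain S v j T where e: "es ! h = (S, v, j, T)" by (metis prod_cases4)
  have "(S, v, j, T) \<in> set es" using e assms(4) by (metis nth_mem)
  then have srch: "search {..<n} E S v j T" using assms(2) by (auto simp: entries_def)
  note S = search_bounds[OF srch]
  let ?X = "{''k'', ''m'', ''v'', ''j'', ''q'', ''x'', ''w''}"
  let ?J = "\<lambda>a c s'. agree ?X s s' \<and>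
    (\<exists>fs. entries s' (es @ fs) \<and> length fs \<le> a * n + c \<and> covers (triple (es ! h)) (es @ fs) a c)"
  have J_upd: "?J a c (s'(y := f))" if J: "?J a c s'" and y: "y \<in> {''x'', ''w''}" for a c s' y f
  proof -
    obtain fs where fs: "agree ?X s s'" "entries s' (es @ fs)" "length fs \<le> a * n + c" "covers (triple (es ! h)) (es @ fs) a c"
      using J by blast
    have "agree {y} s' (s'(y := f))" by (simp add: agree_def)
    then have "entries (s'(y := f)) (es @ fs)"
      using y by (intro entries_agree[OF fs(2)]) auto
    moreover have "agree ?X s (s'(y := f))" using fs(1) y by (intro agree_upd) auto
    ultimately show ?thesis using fs by blast
  qed
  have n2: "n < 2 ^ b" using cap by linarith
  let ?guard = "Mul (member_exp ''x'') (Mul (adj_exp (Var ''x'') (Var ''w'')) (Sub (Const 1) (member_exp ''w'')))"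
  have inner: "runs (For ''w'' size_exp (Cond ?guard push_com Skip)) s1 (n * (expand_step_time + 2) + 2)
      (\<lambda>s'. s' ''x'' 0 = x \<and> ?J x n s')" if x: "x < n" and s1: "?J x 0 s1" "s1 ''x'' 0 = x" for x s1
  proof (rule runs_For[where I = "\<lambda>c s'. s' ''x'' 0 = x \<and> ?J x c s'"])
    fix i s' assume i: "i < n" and I: "s' ''x'' 0 = x \<and> ?J x i s'" and w: "s' ''w'' 0 = i"
    then obtain fs where fs: "agree ?X s s'" "entries s' (es @ fs)" "length fs \<le> x * n + i"
        "covers (triple (es ! h)) (es @ fs) x i" by blast
    have inps: "inp s'" using inp_agree[OF assms(1) fs(1)] by simp
    have sc: "s' ''h'' 0 = h" "s' ''n'' 0 = n" using agreeD[OF fs(1)] assms(3) inps by (auto simp: inp_def)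
    have reph: "rep n s' h (S, v, j, T)"
      using fs(2) assms(4) e unfolding entries_def by (metis length_append nth_append trans_less_add1)
    have mem: "members s' h S" using reph S(4) by (rule members_rep)
    have guard: "val ?guard s' \<noteq> 0 \<longleftrightarrow> x \<in> S \<and> i \<in> nbrs E x \<and> i \<notin> S"
      using mem adj_val[OF inps x i] x i sc w I by (simp add: cell_exp_def adj_exp_def members_def) blast
    have xi: "x * n + i < n * n" using x i by (rule index_less)
    show "runs (Cond ?guard push_com Skip) s' expand_step_time
      (\<lambda>s''. s'' ''w'' 0 = i \<and> (s''(''w'' := (s'' ''w'')(0 := Suc i))) ''x'' 0 = x \<and>
        ?J x (Suc i) (s''(''w'' := (s'' ''w'')(0 := Suc i))))"
    proof -
      have "runs (Cond ?guard push_com Skip) s' (Suc (n * n * 3 + 8))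
        (\<lambda>s''. s'' ''w'' 0 = i \<and> s'' ''x'' 0 = x \<and> ?J x (Suc i) s'')"
      proof (rule runs_Cond)
        show "weight ?guard \<le> K" by (rule weight_le) (simp add: weight_simps)
      next
        assume "val ?guard s' \<noteq> 0"
        then have g: "x \<in> S" "i \<in> nbrs E x" "i \<notin> S" using guard by auto
        then have edge: "{x, i} \<in> E" "x \<noteq> i" by (auto simp: nbrs_def)
        let ?new = "(insert i S, i, j + of_bool (x \<noteq> v), insert {x, i} T)"
        have q: "s' ''q'' 0 = length (es @ fs)" using fs(2) by (simp add: entries_def)
        have len: "Suc (length (es @ fs)) < 2 ^ b" using assms(5) fs(3) xi by simp
        have "runs push_com s' (n * n * 3 + 8) (\<lambda>s''. agree {''k'', ''m'', ''v'', ''j'', ''q''} s' s'' \<and>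
          s'' ''q'' 0 = Suc (length (es @ fs)) \<and> (\<forall>i<length (es @ fs). \<forall>e. rep n s' i e \<longrightarrow> rep n s'' i e) \<and>
          rep n s'' (length (es @ fs)) ?new)"
          using inps sc(1) q I w reph x i edge(2) len S(2) cap(1) assms(4)
          by (intro runs_push) auto
        then show "runs push_com s' (n * n * 3 + 8)
          (\<lambda>s''. s'' ''w'' 0 = i \<and> s'' ''x'' 0 = x \<and> ?J x (Suc i) s'')"
        proof (rule runs_mono[OF _ order_refl])
          fix s'' assume R: "agree {''k'', ''m'', ''v'', ''j'', ''q''} s' s'' \<and>
            s'' ''q'' 0 = Suc (length (es @ fs)) \<and> (\<forall>i<length (es @ fs). \<forall>e. rep n s' i e \<longrightarrow> rep n s'' i e) \<and>
            rep n s'' (length (es @ fs)) ?new"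
          then have ag: "agree {''k'', ''m'', ''v'', ''j'', ''q''} s' s''" by blast
          have "search {..<n} E (insert i S) i (j + of_bool (x \<noteq> v)) (insert {x, i} T)"
            using srch g i edge by (intro search.step) auto
          moreover have "rep n s'' k ((es @ fs @ [?new]) ! k)" if "k < length (es @ fs @ [?new])" for k
          proof (cases "k < length (es @ fs)")
            case True
            then have "rep n s' k ((es @ fs) ! k)" using fs(2) by (simp add: entries_def)
            then show ?thesis using R True by (metis append_assoc nth_append)
          next
            case False
            then have "k = length (es @ fs)" using that by simp
            then show ?thesis using R by (metis append_assoc nth_append_length)
          qed
          ultimately have "entries s'' (es @ (fs @ [?new]))"
            using fs(2) R by (auto simp: entries_def)
          moreover have "covers (triple (es ! h)) (es @ (fs @ [?new])) x (Suc i)"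
          proof (rule covers_Suc)
            show "covers (triple (es ! h)) (es @ (fs @ [?new])) x i"
              by (rule covers_mono[OF fs(4)]) auto
            have "successor (triple (es ! h)) x i = triple ?new" by (simp add: e)
            then show "successor (triple (es ! h)) x i \<in> triple ` set (es @ (fs @ [?new]))" by auto
          qed
          moreover have "length (fs @ [?new]) \<le> x * n + Suc i" using fs(3) by simp
          moreover have "agree ?X s s''" by (rule agree_trans[OF fs(1) ag]) auto
          moreover have "s'' ''w'' 0 = i" "s'' ''x'' 0 = x" using agreeD[OF ag] I w by auto
          ultimately show "s'' ''w'' 0 = i \<and> s'' ''x'' 0 = x \<and> ?J x (Suc i) s''" by blast
        qed
      next
        assume "val ?guard s' = 0"
        then have "\<not> (x \<in> S \<and> i \<in> nbrs E x \<and> i \<notin> S)" using guard by blast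
        then have "covers (triple (es ! h)) (es @ fs) x (Suc i)"
          using fs(4) e by (intro covers_Suc) (auto simp: nbrs_def)
        then have "s' ''w'' 0 = i \<and> s' ''x'' 0 = x \<and> ?J x (Suc i) s'" using fs I w by fastforce
        then show "runs Skip s' (n * n * 3 + 8) (\<lambda>s''. s'' ''w'' 0 = i \<and> s'' ''x'' 0 = x \<and> ?J x (Suc i) s'')"
          by (intro runs_mono[OF runs_Skip]) auto
      qed
      then have "runs (Cond ?guard push_com Skip) s' expand_step_time
        (\<lambda>s''. s'' ''w'' 0 = i \<and> s'' ''x'' 0 = x \<and> ?J x (Suc i) s'')" by (rule runs_mono) simp_all
      then show ?thesis
      proof (rule runs_mono[OF _ order_refl])
        fix s'' assume R: "s'' ''w'' 0 = i \<and> s'' ''x'' 0 = x \<and> ?J x (Suc i) s''"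
        then have "?J x (Suc i) s''" by blast
        then have "?J x (Suc i) (s''(''w'' := (s'' ''w'')(0 := Suc i)))" by (rule J_upd) simp
        moreover have "(s''(''w'' := (s'' ''w'')(0 := Suc i))) ''x'' 0 = x" using R by simp
        ultimately show "s'' ''w'' 0 = i \<and> (s''(''w'' := (s'' ''w'')(0 := Suc i))) ''x'' 0 = x \<and>
          ?J x (Suc i) (s''(''w'' := (s'' ''w'')(0 := Suc i)))" using R by blast
      qed
    qed
  next
    show "(s1(''w'' := (s1 ''w'')(0 := 0))) ''x'' 0 = x \<and> ?J x 0 (s1(''w'' := (s1 ''w'')(0 := 0)))"
      using s1 J_upd[where a = x and c = 0 and s' = s1 and y = "''w''"] by simp
  next
    fix i s' assume "s' ''x'' 0 = x \<and> ?J x i s'"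
    then have "agree ?X s s'" by blast
    then show "val size_exp s' = n" using assms(1) agreeD[of ?X s s' "''n''"] by (simp add: inp_def)
  qed (use n2 in \<open>auto intro!: weight_le\<close>)
  have "runs expand_com s (n * ((n * (expand_step_time + 2) + 2) + 2) + 2) (?J n 0)"
    unfolding expand_com_def
  proof (rule runs_For[where I = "\<lambda>x s'. ?J x 0 s'"])
    fix i s' assume i: "i < n" and I: "?J i 0 s'" and x: "s' ''x'' 0 = i"
    show "runs (For ''w'' size_exp (Cond ?guard push_com Skip)) s' (n * (expand_step_time + 2) + 2)
      (\<lambda>s''. s'' ''x'' 0 = i \<and> ?J (Suc i) 0 (s''(''x'' := (s'' ''x'')(0 := Suc i))))"
    proof (rule runs_mono[OF inner[OF i I x] order_refl])
      fix s'' assume R: "s'' ''x'' 0 = i \<and> ?J i n s''"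
      then obtain fs where fs: "agree ?X s s''" "entries s'' (es @ fs)" "length fs \<le> i * n + n"
        "covers (triple (es ! h)) (es @ fs) i n" by blast
      have "covers (triple (es ! h)) (es @ fs) (Suc i) 0"
        using fs(4) by (rule covers_row)
      moreover have "length fs \<le> Suc i * n + 0" using fs(3) by simp
      ultimately have "?J (Suc i) 0 s''" using fs by blast
      then have "?J (Suc i) 0 (s''(''x'' := (s'' ''x'')(0 := Suc i)))" by (rule J_upd) simp
      then show "s'' ''x'' 0 = i \<and> ?J (Suc i) 0 (s''(''x'' := (s'' ''x'')(0 := Suc i)))"
        using R by blast
    qed
  next
    have "?J 0 0 s"
      using assms(2) by (intro conjI agree_refl exI[of _ "[]"]) (auto simp: covers_def e)
    then show "?J 0 0 (s(''x'' := (s ''x'')(0 := 0)))" using J_upd[where a = 0 and c = 0 and s' = s and y = "''x''"] by blast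
  next
    fix i s' assume "?J i 0 s'"
    then have "agree ?X s s'" by blast
    then show "val size_exp s' = n" using assms(1) agreeD[of ?X s s' "''n''"] by (simp add: inp_def)
  qed (use n2 in \<open>auto intro!: weight_le\<close>)
  then show ?thesis by (rule runs_mono) (auto simp: algebra_simps)
qed

end

section \<open>The main loop and the best complete entry\<close>

definition record_com :: com where
  "record_com = Cond (Sub size_exp (Var ''z'')) Skip
     (Cond (Add (Sub (Const 1) (Var ''found'')) (Sub (Read ''j'' (Var ''i'')) (Read ''j'' (Var ''h''))))
        (Seq (Assign ''i'' (Var ''h'')) (Assign ''found'' (Const 1))) Skip)"

text \<open>The guard is a sum of naturals, so it vanishes exactly if the state is unmarked and both
  inequalities of \<open>sparse_cut\<close> hold.\<close>

definition visit_com :: com where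
  "visit_com = Cond (Add (Read ''V'' (Var ''c'')) (Add (Sub (Var ''A'') (Var ''B'')) (Sub (Var ''D'') (Add (Var ''L'') (Var ''L'')))))
     Skip (Seq (Write ''V'' (Var ''c'') (Const 1)) (Seq record_com expand_com))"

definition main_com :: com where
  "main_com = Seq (Assign ''h'' (Const 0)) (Loop (Sub (Var ''q'') (Var ''h''))
     (Seq check_com (Seq visit_com (Assign ''h'' (Add (Var ''h'') (Const 1))))))"

definition init_com :: com where
  "init_com = For ''q'' size_exp
     (Seq (Write ''m'' (Add (Mul (Var ''q'') (Mul size_exp size_exp)) (Add (Mul (Var ''q'') size_exp) (Var ''q''))) (Const 1))
          (Write ''v'' (Var ''q'') (Var ''q'')))"

definition output_com :: com where
  "output_com = For ''k'' (Mul size_exp size_exp)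
     (Write ''tree'' (Var ''k'') (Mul (Read ''m'' (Add (Mul (Var ''i'') (Mul size_exp size_exp)) (Var ''k''))) (Read ''adj'' (Var ''k''))))"

context machine
begin

lemma runs_bounded: "(bounded b s \<Longrightarrow> runs c s t Q) \<Longrightarrow> runs c s t Q"
  by (auto simp: runs_def)

end

text \<open>At most \<open>n * n * 2 ^ n\<close> states are expanded, each adding at most
  \<open>n * n\<close> entries to the initial \<open>n\<close>. The crude count of all subsets is
  good enough here, because the capacity affects only bit lengths.\<close>

locale mist_search = mist +
  assumes cap_queue: "n + n * n * (n * n * 2 ^ n) + n * n + 1 < 2 ^ b"
begin

abbreviation good :: "nat set \<Rightarrow> bool" where
  "good \<equiv> sparse_cut {..<n} E L"

definition best :: "state \<Rightarrow> entry list \<Rightarrow> (nat set \<times> nat \<times> nat) set \<Rightarrow> bool" where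
  "best s es X \<longleftrightarrow> s ''found'' 0 \<le> 1 \<and>
     (s ''found'' 0 = 0 \<longrightarrow> (\<forall>t\<in>X. fst t \<noteq> {..<n})) \<and>
     (s ''found'' 0 = 1 \<longrightarrow> s ''i'' 0 < length es \<and> fst (triple (es ! s ''i'' 0)) = {..<n} \<and>
        (\<forall>t\<in>X. fst t = {..<n} \<longrightarrow> snd (snd (triple (es ! s ''i'' 0))) \<le> snd (snd t)))"

text \<open>\<open>X\<close> is the set of expanded states, and the entries before \<open>h\<close>
  are processed. At \<open>h = length es\<close>, every good state of the queue is in
  \<open>X\<close>, and \<open>X\<close> is closed under good successors. The bound on
  \<open>length es\<close> turns a bound on \<open>card X\<close> into one on the number of
  iterations, although the queue may hold duplicates and states that are not sparse.\<close>

definition invar :: "state \<Rightarrow> nat \<Rightarrow> entry list \<Rightarrow> (nat set \<times> nat \<times> nat) set \<Rightarrow> bool" where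
  "invar s h es X \<longleftrightarrow> inp s \<and> entries s es \<and> h \<le> length es \<and>
     (\<forall>c. s ''V'' c = of_bool (c \<in> code n ` X)) \<and>
     (\<forall>t\<in>X. good (fst t) \<and> t \<in> triple ` set (take h es) \<and> covers t es n 0) \<and>
     (\<forall>e\<in>set (take h es). good (fst (triple e)) \<longrightarrow> triple e \<in> X) \<and>
     (\<forall>v<n. ({v}, v, 0) \<in> triple ` set es) \<and>
     length es \<le> n + n * n * card X \<and> best s es X"

lemma entry_search:
  assumes "entries s es" "e \<in> set es"
  obtains S v j T where "e = (S, v, j, T)" "search {..<n} E S v j T"
proof -
  obtain S v j T where e: "e = (S, v, j, T)" by (metis prod_cases4)
  have "search {..<n} E S v j T" using assms unfolding entries_def e by blast
  with e show thesis by (rule that)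
qed

text \<open>Only states with a sparse visited set are expanded. Through this inclusion the number of
  sparse cuts enters the running time, with a factor \<open>n * n\<close> for the last vertex and
  the jumps.\<close>

lemma visited_subset:
  assumes "invar s h es X"
  shows "X \<subseteq> {S \<in> Pow {..<n}. good S} \<times> {..<n} \<times> {..<n}"
proof
  fix t assume t: "t \<in> X"
  then obtain e where e: "e \<in> set es" "t = triple e" "good (fst t)"
    using assms unfolding invar_def by (meson imageE in_set_takeD)
  have "entries s es" using assms by (simp add: invar_def)
  from this e(1) obtain S v j T where T: "e = (S, v, j, T)" "search {..<n} E S v j T"
    by (rule entry_search)
  then show "t \<in> {S \<in> Pow {..<n}. good S} \<times> {..<n} \<times> {..<n}"
    using search_bounds[OF T(2)] e(2,3) by auto
qed

definition num_good :: nat where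
  "num_good = card {S \<in> Pow {..<n}. good S}"

lemma card_visited:
  assumes "invar s h es X"
  shows "finite X" "card X \<le> n * n * num_good"
proof -
  let ?Y = "{S \<in> Pow {..<n}. good S} \<times> {..<n} \<times> {..<n}"
  have fin: "finite ?Y" by (intro finite_cartesian_product) auto
  then show "finite X" using visited_subset[OF assms] by (rule rev_finite_subset)
  have "card X \<le> card ?Y" using fin visited_subset[OF assms] by (rule card_mono)
  then show "card X \<le> n * n * num_good" by (simp add: card_cartesian_product num_good_def mult_ac)
qed

lemma num_good_le: "num_good \<le> 2 ^ n"
proof -
  have "num_good \<le> card (Pow {..<n})" unfolding num_good_def by (intro card_mono) auto
  then show ?thesis by (simp add: card_Pow)
qed

lemma length_le:
  assumes "invar s h es X"
  shows "length es \<le> n + n * n * (n * n * num_good)" "length es + n * n + 1 < 2 ^ b"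
proof -
  have "length es \<le> n + n * n * card X" using assms by (simp add: invar_def)
  also have "\<dots> \<le> n + n * n * (n * n * num_good)"
    by (intro add_left_mono mult_le_mono2 card_visited[OF assms])
  finally show 1: "length es \<le> n + n * n * (n * n * num_good)" .
  have "n * n * (n * n * num_good) \<le> n * n * (n * n * 2 ^ n)"
    by (intro mult_le_mono2 num_good_le)
  then show "length es + n * n + 1 < 2 ^ b" using 1 cap_queue by linarith
qed

lemma triple_rep:
  assumes "entries s es" "k < length es"
  shows "s ''j'' k = snd (snd (triple (es ! k)))"
proof -
  obtain S v j T where e: "es ! k = (S, v, j, T)" by (metis prod_cases4)
  have "rep n s k (es ! k)" using assms by (simp add: entries_def)
  then show ?thesis unfolding e by simp
qed

lemma runs_record:
  assumes "inp s" "entries s es" "h < length es" "s ''h'' 0 = h" "best s es X" "finite X"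
    and z: "s ''z'' 0 = card (fst (triple (es ! h)))"
    and len: "length es < 2 ^ b"
  shows "runs record_com s 4 (\<lambda>s'. agree {''i'', ''found''} s s' \<and> best s' es (insert (triple (es ! h)) X))"
proof -
  have "es ! h \<in> set es" using assms(3) by simp
  with assms(2) obtain S v j T where T: "es ! h = (S, v, j, T)" "search {..<n} E S v j T"
    by (rule entry_search)
  have S: "S \<subseteq> {..<n}" using search_bounds[OF T(2)] by blast
  have full: "card S = n \<longleftrightarrow> S = {..<n}"
    using S card_subset_eq[of "{..<n}" S] by auto
  have "card S \<le> n" using card_mono[OF _ S] by simp
  then have v1: "val (Sub size_exp (Var ''z'')) s = 0 \<longleftrightarrow> S = {..<n}"
    using z T(1) full assms(1) by (auto simp: inp_def)
  have jh: "s ''j'' h = j" using triple_rep[OF assms(2,3)] T(1) by simp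
  let ?Q = "\<lambda>s'. agree {''i'', ''found''} s s' \<and> best s' es (insert (triple (es ! h)) X)"
  have one: "(1::nat) < 2 ^ b" using cap by linarith
  have "runs record_com s (Suc (Suc (Suc 1))) ?Q"
    unfolding record_com_def
  proof (rule runs_Cond)
    assume "val (Sub size_exp (Var ''z'')) s \<noteq> 0"
    then have "S \<noteq> {..<n}" using v1 by blast
    then have "?Q s" using assms(5) T(1) by (auto simp: best_def agree_refl)
    then show "runs Skip s (Suc (Suc 1)) ?Q" by (intro runs_mono[OF runs_Skip]) auto
  next
    assume "val (Sub size_exp (Var ''z'')) s = 0"
    then have Sfull: "S = {..<n}" using v1 by blast
    let ?g = "Add (Sub (Const 1) (Var ''found'')) (Sub (Read ''j'' (Var ''i'')) (Read ''j'' (Var ''h'')))"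
    show "runs (Cond ?g (Seq (Assign ''i'' (Var ''h'')) (Assign ''found'' (Const 1))) Skip) s (Suc (Suc 1)) ?Q"
    proof (rule runs_Cond)
      assume g: "val ?g s \<noteq> 0"
      have Q: "?Q (s(''i'' := (s ''i'')(0 := h), ''found'' := (s ''found'')(0 := 1)))"
      proof -
        \<comment> \<open>A complete state in \<open>X\<close> forces \<open>found = 1\<close>; the
          guard is then nonzero only because the recorded entry has strictly more jumps.\<close>
        have "snd (snd (triple (es ! h))) \<le> snd (snd t)" if t: "t \<in> X" "fst t = {..<n}" for t
        proof -
          have "s ''found'' 0 = 1" using assms(5) t unfolding best_def by (metis le_neq_implies_less less_one)
          then have b: "s ''i'' 0 < length es" "snd (snd (triple (es ! s ''i'' 0))) \<le> snd (snd t)"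
            using assms(5) t unfolding best_def by auto
          moreover have "s ''j'' (s ''i'' 0) > s ''j'' h"
            using g \<open>s ''found'' 0 = 1\<close> assms(4) by simp
          ultimately show ?thesis using triple_rep[OF assms(2) b(1)] triple_rep[OF assms(2,3)] by linarith
        qed
        then show ?thesis using assms(3) T(1) Sfull by (auto simp: best_def agree_def)
      qed
      show "runs (Seq (Assign ''i'' (Var ''h'')) (Assign ''found'' (Const 1))) s (Suc 1) ?Q"
        apply (rule runs_Seq_Write, (rule weight_le, simp), use assms(3,4) len in simp)
        apply (rule runs_Write, (rule weight_le, simp), use one in simp)
        using Q assms(4) by simp
    next
      assume g: "val ?g s = 0"
      then have f: "s ''found'' 0 = 1" "s ''j'' (s ''i'' 0) \<le> s ''j'' h"
        using assms(4,5) by (auto simp: best_def)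
      then have "s ''i'' 0 < length es" using assms(5) by (simp add: best_def)
      then have "snd (snd (triple (es ! s ''i'' 0))) \<le> snd (snd (triple (es ! h)))"
        using f(2) triple_rep[OF assms(2)] assms(3) by metis
      then have "?Q s" using assms(5) f(1) by (auto simp: best_def agree_refl)
      then show "runs Skip s (Suc 1) ?Q" by (intro runs_mono[OF runs_Skip]) auto
    qed (rule weight_le, simp)
  qed (rule weight_le, simp)
  then show ?thesis by (rule runs_mono) auto
qed

abbreviation visit_time :: nat where
  "visit_time \<equiv> n * (n * (expand_step_time + 2) + 4) + 8"

lemma best_agree:
  "best s es X \<Longrightarrow> agree Y s s' \<Longrightarrow> {''found'', ''i''} \<inter> Y = {} \<Longrightarrow> best s' es X"
  using agreeD[of Y s s' "''found''"] agreeD[of Y s s' "''i''"] by (simp add: best_def)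

lemma best_append: "best s es X \<Longrightarrow> best s (es @ fs) X"
  by (auto simp: best_def nth_append)

lemma runs_visit:
  assumes inv: "invar s h es X" and h: "h < length es" "s ''h'' 0 = h"
    and chk: "s ''c'' 0 = code n (triple (es ! h))"
      "s ''A'' 0 \<le> s ''B'' 0 \<and> s ''D'' 0 \<le> L + L \<longleftrightarrow> good (fst (triple (es ! h)))"
      "s ''z'' 0 = card (fst (triple (es ! h)))"
  shows "runs visit_com s visit_time (\<lambda>s'. s' ''h'' 0 = h \<and> (\<exists>es' X'. invar s' (Suc h) es' X'))"
proof -
  let ?t = "triple (es ! h)"
  have inp: "inp s" and ent: "entries s es" and best: "best s es X"
    and Vis: "\<And>c. s ''V'' c = of_bool (c \<in> code n ` X)"
    and X1: "\<And>t. t \<in> X \<Longrightarrow> good (fst t) \<and> t \<in> triple ` set (take h es) \<and> covers t es n 0"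
    and X2: "\<And>e. e \<in> set (take h es) \<Longrightarrow> good (fst (triple e)) \<Longrightarrow> triple e \<in> X"
    and st: "\<And>v. v < n \<Longrightarrow> ({v}, v, 0) \<in> triple ` set es"
    and len: "length es \<le> n + n * n * card X"
    using inv unfolding invar_def by blast+
  have finX: "finite X" using card_visited[OF inv] by blast
  have tk: "take (Suc h) es = take h es @ [es ! h]" using h(1) by (rule take_Suc_conv_app_nth)
  have mem: "es ! h \<in> set es" using h(1) by simp
  with ent obtain S v j T where T: "es ! h = (S, v, j, T)" "search {..<n} E S v j T" by (rule entry_search)
  note sb = search_bounds[OF T(2)]
  have code_X: "code n ?t \<in> code n ` X \<longleftrightarrow> ?t \<in> X"
  proof
    assume "code n ?t \<in> code n ` X"
    then obtain t' where t': "t' \<in> X" "code n ?t = code n t'" by auto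
    obtain S' v' j' where s': "t' = (S', v', j')" by (metis prod_cases3)
    have "S' \<subseteq> {..<n}" "v' < n" "j' < n" using visited_subset[OF inv] t'(1) s' by auto
    then have "?t = t'" using code_inj[of n S v j S' v' j'] t'(2) sb T(1) s' by simp
    then show "?t \<in> X" using t'(1) by simp
  qed auto
  have nL: "s ''L'' 0 = L" using inp by (simp add: inp_def)
  let ?g = "Add (Read ''V'' (Var ''c'')) (Add (Sub (Var ''A'') (Var ''B'')) (Sub (Var ''D'') (Add (Var ''L'') (Var ''L''))))"
  have g: "val ?g s = 0 \<longleftrightarrow> ?t \<notin> X \<and> good (fst ?t)"
    using Vis[of "code n ?t"] chk(1,2) code_X by (auto simp: nL)
  let ?Q = "\<lambda>s'. s' ''h'' 0 = h \<and> (\<exists>es' X'. invar s' (Suc h) es' X')"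
  have one: "(1::nat) < 2 ^ b" using cap by linarith
  have "runs visit_com s (Suc (Suc (4 + (n * (n * (expand_step_time + 2) + 4) + 2)))) ?Q"
    unfolding visit_com_def
  proof (rule runs_Cond)
    assume "val ?g s \<noteq> 0"
    then have skip: "good (fst ?t) \<longrightarrow> ?t \<in> X" unfolding g by blast
    \<comment> \<open>A skipped entry is not sparse or was expanded before, so \<open>h\<close>
      advances while the queue and \<open>X\<close> stay.\<close>
    have "invar s (Suc h) es X"
      unfolding invar_def
    proof (intro conjI ballI allI impI)
      fix t assume t: "t \<in> X"
      show "good (fst t)" "covers t es n 0" using X1[OF t] by blast+
      show "t \<in> triple ` set (take (Suc h) es)" using X1[OF t] unfolding tk by auto
    next
      fix e assume "e \<in> set (take (Suc h) es)" "good (fst (triple e))"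
      then have "e \<in> set (take h es) \<or> e = es ! h" unfolding tk by auto
      then show "triple e \<in> X" using X2 skip \<open>good (fst (triple e))\<close> by blast
    qed (use inp ent h Vis st len best in auto)
    then show "runs Skip s (Suc (4 + (n * (n * (expand_step_time + 2) + 4) + 2))) ?Q"
      using h(2) by (intro runs_mono[OF runs_Skip]) auto
  next
    assume "val ?g s = 0"
    then have new: "?t \<notin> X" and gd: "good (fst ?t)" unfolding g by blast+
    let ?s = "s(''V'' := (s ''V'')(code n ?t := 1))"
    have ag1: "agree {''V''} s ?s" by (simp add: agree_def)
    have 1: "inp ?s" "entries ?s es" "best ?s es X" "?s ''h'' 0 = h" "?s ''z'' 0 = card (fst ?t)"
      using inp_agree[OF inp ag1] entries_agree[OF ent ag1] best_agree[OF best ag1] h(2) chk(3) by auto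
    have rec: "runs record_com ?s 4 (\<lambda>s'. agree {''i'', ''found''} ?s s' \<and> best s' es (insert ?t X))"
      using length_le(2)[OF inv] by (intro runs_record[OF 1(1,2) h(1) 1(4) 1(3) finX 1(5)]) linarith
    have seq: "runs (Seq record_com expand_com) ?s (4 + (n * (n * (expand_step_time + 2) + 4) + 2)) ?Q"
    proof (rule runs_Seq[OF rec])
      fix s2 assume R: "agree {''i'', ''found''} ?s s2 \<and> best s2 es (insert ?t X)"
      then have ag2: "agree {''i'', ''found''} ?s s2" by blast
      have 2: "inp s2" "entries s2 es" "s2 ''h'' 0 = h"
        using inp_agree[OF 1(1) ag2] entries_agree[OF 1(2) ag2] agreeD[OF ag2] 1(4) by auto
      have "length es + n * n < 2 ^ b" using length_le(2)[OF inv] by linarith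
      from runs_expand[OF 2 h(1) this]
      show "runs expand_com s2 (n * (n * (expand_step_time + 2) + 4) + 2) ?Q"
      proof (rule runs_mono[OF _ order_refl])
        fix s3 assume "agree {''k'', ''m'', ''v'', ''j'', ''q'', ''x'', ''w''} s2 s3 \<and>
          (\<exists>fs. entries s3 (es @ fs) \<and> length fs \<le> n * n \<and> covers ?t (es @ fs) n 0)"
        then obtain fs where ag3: "agree {''k'', ''m'', ''v'', ''j'', ''q'', ''x'', ''w''} s2 s3"
          and fs: "entries s3 (es @ fs)" "length fs \<le> n * n" "covers ?t (es @ fs) n 0" by blast
        have h3: "s3 ''h'' 0 = h" using agreeD[OF ag3] 2(3) by simp
        have V3: "s3 ''V'' = (s ''V'')(code n ?t := 1)"
          using agreeD[OF ag3, of "''V''"] agreeD[OF ag2, of "''V''"] by simp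
        have "invar s3 (Suc h) (es @ fs) (insert ?t X)"
          unfolding invar_def
        proof (intro conjI allI ballI impI)
          show "inp s3" using inp_agree[OF 2(1) ag3] by simp
          show "Suc h \<le> length (es @ fs)" using h(1) by simp
          show "s3 ''V'' c = of_bool (c \<in> code n ` insert ?t X)" for c
            unfolding V3 using Vis[of c] by simp
          show "({v}, v, 0) \<in> triple ` set (es @ fs)" if "v < n" for v
            using st[OF that] by auto
          show "length (es @ fs) \<le> n + n * n * card (insert ?t X)"
            using len fs(2) new finX by simp
          have "best s3 es (insert ?t X)" using best_agree[OF _ ag3, of es "insert ?t X"] R by simp
          then show "best s3 (es @ fs) (insert ?t X)" by (rule best_append)
        next
          fix t assume t: "t \<in> insert ?t X"
          show "good (fst t)" using t gd X1 by blast
          have tk': "take (Suc h) (es @ fs) = take h es @ [es ! h]" using h(1) tk by simp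
          show "covers t (es @ fs) n 0"
          proof (cases "t = ?t")
            case False
            then have "covers t es n 0" using t X1 by blast
            then show ?thesis by (rule covers_mono) simp
          qed (use fs(3) in simp)
          show "t \<in> triple ` set (take (Suc h) (es @ fs))"
          proof (cases "t = ?t")
            case False
            then have "t \<in> triple ` set (take h es)" using t X1 by blast
            then show ?thesis unfolding tk' by auto
          next
            case True
            then show ?thesis unfolding tk' by simp
          qed
        next
          fix e assume e: "e \<in> set (take (Suc h) (es @ fs))" "good (fst (triple e))"
          then have "e \<in> set (take h es) \<or> e = es ! h" using h(1) tk by auto
          then show "triple e \<in> insert ?t X" using X2 e(2) by blast
        qed (rule fs(1))
        then show "?Q s3" using h3 by blast
      qed
    qed
    show "runs (Seq (Write ''V'' (Var ''c'') (Const 1)) (Seq record_com expand_com)) s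
      (Suc (4 + (n * (n * (expand_step_time + 2) + 4) + 2))) ?Q"
      apply (rule runs_Seq_Write, (rule weight_le, simp), use one in simp)
      using seq chk(1) by simp
  qed (rule weight_le, simp)
  then show ?thesis by (rule runs_mono) auto
qed

end

definition log_com :: com where
  "log_com = Seq (Assign ''P'' (Const 1)) (Seq (Assign ''L'' (Const 3))
     (Loop (Sub size_exp (Var ''P''))
        (Seq (Assign ''P'' (Add (Var ''P'') (Var ''P''))) (Assign ''L'' (Add (Var ''L'') (Const 2))))))"

text \<open>Doubling finds the least \<open>k\<close> with \<open>n \<le> 2 ^ k\<close>, and
  \<open>2 * k + 3\<close> is the cut bound of \<open>rtree_layout\<close>. Since
  \<open>2 ^ k \<le> 2 * n + 1\<close>, any constant to the power \<open>k\<close> is polynomially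
  bounded in \<open>n\<close>; the added 1 covers \<open>n = 0\<close>.\<close>

lemma (in machine) runs_log:
  assumes "s ''n'' 0 = n" "100 \<le> K" "2 * n + 10 \<le> 2 ^ b"
  shows "runs log_com s (n * 3 + 3) (\<lambda>s'. agree {''P'', ''L''} s s' \<and>
    (\<exists>k. s' ''L'' 0 = 2 * k + 3 \<and> n \<le> 2 ^ k \<and> k \<le> n \<and> 2 ^ k \<le> 2 * n + 1))"
proof -
  let ?J = "\<lambda>s'. agree {''P'', ''L''} s s' \<and>
     (\<exists>k. s' ''P'' 0 = 2 ^ k \<and> s' ''L'' 0 = 2 * k + 3 \<and> k \<le> n \<and> 2 ^ k \<le> 2 * n + 1)"
  have wK: "w \<le> 100 \<Longrightarrow> w \<le> K" for w using assms(2) by linarith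
  let ?body = "Seq (Assign ''P'' (Add (Var ''P'') (Var ''P''))) (Assign ''L'' (Add (Var ''L'') (Const 2)))"
  let ?Q = "\<lambda>s'. agree {''P'', ''L''} s s' \<and>
    (\<exists>k. s' ''L'' 0 = 2 * k + 3 \<and> n \<le> 2 ^ k \<and> k \<le> n \<and> 2 ^ k \<le> 2 * n + 1)"
  let ?s = "s(''P'' := (s ''P'')(0 := 1), ''L'' := (s ''L'')(0 := 3))"
  have n_val: "s' ''n'' 0 = n" if "agree {''P'', ''L''} s s'" for s'
    using agreeD[OF that] assms(1) by simp
  have "runs (Loop (Sub size_exp (Var ''P'')) ?body) ?s (n * Suc 2 + 1) ?Q"
  proof (rule runs_Loop[where I = ?J and m = "\<lambda>s'. n - s' ''P'' 0"])
    fix s' assume J: "?J s'" and g: "val (Sub size_exp (Var ''P'')) s' \<noteq> 0"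
    then obtain k where ag: "agree {''P'', ''L''} s s'" and
      k: "s' ''P'' 0 = 2 ^ k" "s' ''L'' 0 = 2 * k + 3" "k \<le> n" "2 ^ k \<le> 2 * n + 1" by blast
    have lt: "2 ^ k < n" using g n_val[OF ag] k(1) by simp
    then have "k < n" using less_exp[of k] by linarith
    have pos: "(0::nat) < 2 ^ k" by simp
    let ?s' = "s'(''P'' := (s' ''P'')(0 := 2 ^ k + 2 ^ k), ''L'' := (s' ''L'')(0 := 2 * k + 3 + 2))"
    have "agree {''P'', ''L''} s ?s'" using ag by (simp add: agree_def)
    moreover have "?s' ''P'' 0 = 2 ^ Suc k" "?s' ''L'' 0 = 2 * Suc k + 3" by simp_all
    moreover have "Suc k \<le> n" "2 ^ Suc k \<le> 2 * n + 1" using \<open>k < n\<close> lt by simp_all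
    ultimately have "?J ?s'" by blast
    moreover have "n - ?s' ''P'' 0 < n - s' ''P'' 0" unfolding k(1) fun_upd_same
      using lt pos by (simp; linarith)
    ultimately have Q: "?J ?s' \<and> n - ?s' ''P'' 0 < n - s' ''P'' 0" by blast
    have "runs ?body s' (Suc 1) (\<lambda>s''. ?J s'' \<and> n - s'' ''P'' 0 < n - s' ''P'' 0)"
      apply (rule runs_Seq_Write, (rule wK, simp), use k lt assms(3) in simp)
      apply (rule runs_Write, (rule wK, simp), use k \<open>k < n\<close> assms(3) in simp)
      apply (rule back_subst[where P = "\<lambda>s''. ?J s'' \<and> n - s'' ''P'' 0 < n - s' ''P'' 0", OF Q])
      apply (simp add: k)
      done
    then show "runs ?body s' 2 (\<lambda>s''. ?J s'' \<and> n - s'' ''P'' 0 < n - s' ''P'' 0)"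
      by (simp only: numeral_2_eq_2 One_nat_def)
  next
    fix s' assume J: "?J s'" and g: "val (Sub size_exp (Var ''P'')) s' = 0"
    then obtain k where ag: "agree {''P'', ''L''} s s'" and
      k: "s' ''P'' 0 = 2 ^ k" "s' ''L'' 0 = 2 * k + 3" "k \<le> n" "2 ^ k \<le> 2 * n + 1" by blast
    have "n \<le> 2 ^ k" using g n_val[OF ag] k(1) by simp
    then show "?Q s'" using ag k by blast
  next
    have "agree {''P'', ''L''} s ?s" by (simp add: agree_def)
    moreover have "?s ''P'' 0 = 2 ^ 0" "?s ''L'' 0 = 2 * 0 + 3" "(2::nat) ^ 0 \<le> 2 * n + 1" by simp_all
    ultimately show "?J ?s" by blast
  qed (rule wK, simp, simp)
  then have "runs log_com s (Suc (Suc (n * Suc 2 + 1))) ?Q"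
    unfolding log_com_def
    apply (intro runs_Seq_Write)
    using assms(3) by (auto intro!: wK)
  then show ?thesis by (rule runs_mono) auto
qed

section \<open>Initial queue, output and assembly\<close>

definition mist_com :: com where
  "mist_com = Seq log_com (Seq init_com (Seq main_com output_com))"

context mist
begin

lemma cell_singleton:
  assumes "k < n * n" "i < n"
  shows "cell n {i} {} k = of_bool (k = i * n + i)"
proof -
  have "k div n = k mod n \<and> k mod n = i \<longleftrightarrow> k = i * n + i"
  proof
    assume "k div n = k mod n \<and> k mod n = i"
    then show "k = i * n + i" using div_mult_mod_eq[of k n] by simp
  next
    assume "k = i * n + i"
    then show "k div n = k mod n \<and> k mod n = i" using div_mod_unique[OF assms(2), of i] by simp
  qed
  then show ?thesis by (simp add: cell_def)
qed

abbreviation start_entries :: "entry list" where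
  "start_entries \<equiv> map (\<lambda>v. ({v}, v, 0, {})) [0..<n]"

text \<open>The memory starts at 0, so one diagonal cell per block suffices, and the jump counters
  of the initial entries keep their default.\<close>

lemma runs_init:
  assumes "inp s" "s ''m'' = (\<lambda>_. 0)" "s ''j'' = (\<lambda>_. 0)"
  shows "runs init_com s (n * 4 + 2) (\<lambda>s'. agree {''q'', ''m'', ''v''} s s' \<and> entries s' start_entries)"
proof -
  let ?J = "\<lambda>i s'. agree {''q'', ''m'', ''v''} s s' \<and> (\<forall>u<i. rep n s' u ({u}, u, 0, {})) \<and>
    (\<forall>u\<ge>i. \<forall>k<n * n. s' ''m'' (u * (n * n) + k) = 0)"
  have n2: "n < 2 ^ b" and one: "(1::nat) < 2 ^ b" using cap by linarith+
  have n_val: "s' ''n'' 0 = n" "s' ''j'' = (\<lambda>_. 0)" if "agree {''q'', ''m'', ''v''} s s'" for s'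
    using agreeD[OF that] assms by (auto simp: inp_def)
  have "runs init_com s (n * (Suc 1 + 2) + 2) (\<lambda>s'. agree {''q'', ''m'', ''v''} s s' \<and> entries s' start_entries)"
    unfolding init_com_def
  proof (rule runs_For[where I = ?J])
    fix i s' assume i: "i < n" and J: "?J i s'" and q: "s' ''q'' 0 = i"
    have ag: "agree {''q'', ''m'', ''v''} s s'" using J by blast
    note nv = n_val[OF ag]
    let ?s = "s'(''m'' := (s' ''m'')(i * (n * n) + (i * n + i) := 1), ''v'' := (s' ''v'')(i := i))"
    let ?s2 = "?s(''q'' := (?s ''q'')(0 := Suc i))"
    have "agree {''q'', ''m'', ''v''} s ?s2" using ag by (simp add: agree_def)
    moreover have "rep n ?s2 u ({u}, u, 0, {})" if "u < Suc i" for u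
    proof (cases "u = i")
      case True
      have "s' ''m'' (i * (n * n) + k) = 0" if "k < n * n" for k using J that by blast
      then show ?thesis using True nv i by (simp add: cell_singleton)
    next
      case False
      then have u: "u < i" using that by simp
      have "u * (n * n) + k \<noteq> i * (n * n) + (i * n + i)" if "k < n * n" for k
        using block_disjoint[OF u that] by linarith
      then have "?s2 ''m'' (u * (n * n) + k) = s' ''m'' (u * (n * n) + k)" if "k < n * n" for k using that by simp
      moreover have "rep n s' u ({u}, u, 0, {})" using J u by blast
      ultimately show ?thesis using False by simp
    qed
    moreover have "?s2 ''m'' (u * (n * n) + k) = 0" if "Suc i \<le> u" "k < n * n" for u k
    proof -
      have "i < u" using that(1) by simp
      then have "i * (n * n) + (i * n + i) < u * (n * n)" by (rule block_disjoint[OF _ index_less[OF i i]])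
      then have "?s2 ''m'' (u * (n * n) + k) = s' ''m'' (u * (n * n) + k)" by simp
      also have "\<dots> = 0" using J that by simp
      finally show ?thesis .
    qed
    ultimately have Q: "?s ''q'' 0 = i \<and> ?J (Suc i) ?s2" using q by simp
    show "runs (Seq (Write ''m'' (Add (Mul (Var ''q'') (Mul size_exp size_exp)) (Add (Mul (Var ''q'') size_exp) (Var ''q''))) (Const 1))
          (Write ''v'' (Var ''q'') (Var ''q''))) s' (Suc 1)
       (\<lambda>s''. s'' ''q'' 0 = i \<and> ?J (Suc i) (s''(''q'' := (s'' ''q'')(0 := Suc i))))"
      apply (rule runs_Seq_Write, (rule weight_le, simp), use one in simp)
      apply (rule runs_Write, (rule weight_le, simp), use i q n2 in simp)
      apply (rule back_subst[where P = "\<lambda>s''. s'' ''q'' 0 = i \<and> ?J (Suc i) (s''(''q'' := (s'' ''q'')(0 := Suc i)))", OF Q])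
      apply (simp add: q nv)
      done
  next
    fix s' assume J: "?J n s'" and q: "s' ''q'' 0 = n"
    have "search {..<n} E {v} v 0 {}" if "v < n" for v using that by (intro search.start) simp
    then show "agree {''q'', ''m'', ''v''} s s' \<and> entries s' start_entries"
      using J q by (auto simp: entries_def)
  next
    fix i s' assume "?J i s'"
    then show "val size_exp s' = n" using n_val(1)[of s'] by simp
  next
    show "?J 0 (s(''q'' := (s ''q'')(0 := 0)))" using assms(2) by (simp add: agree_def)
  qed (use n2 in \<open>auto intro!: weight_le\<close>)
  then show ?thesis by (rule runs_mono) auto
qed

text \<open>Multiplying by the adjacency matrix of \<open>E\<close>, whose diagonal is zero, removes
  the visited set from the block. If no tree was found, \<open>i\<close> need not point to a
  complete entry; that the copied values fit therefore comes from the boundedness of the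
  state.\<close>

lemma runs_output:
  assumes "inp s"
  shows "runs output_com s (n * n * 3 + 2) (\<lambda>s'. agree {''k'', ''tree''} s s' \<and>
    (\<forall>k<n * n. s' ''tree'' k = s ''m'' (s ''i'' 0 * (n * n) + k) * adjacency n E k))"
proof (rule runs_bounded)
  assume bnd: "bounded b s"
  let ?f = "\<lambda>k. s ''m'' (s ''i'' 0 * (n * n) + k) * adjacency n E k"
  let ?J = "\<lambda>i s'. agree {''k'', ''tree''} s s' \<and> (\<forall>k<i. s' ''tree'' k = ?f k)"
  have vals: "s' ''n'' 0 = n" "s' ''adj'' = adjacency n E" "s' ''m'' = s ''m''" "s' ''i'' = s ''i''"
    if "agree {''k'', ''tree''} s s'" for s'
    using agreeD[OF that] assms by (auto simp: inp_def)
  have small: "?f k < 2 ^ b" for k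
  proof -
    have "?f k \<le> s ''m'' (s ''i'' 0 * (n * n) + k)" by (simp add: adjacency_def)
    then show ?thesis using bnd le_less_trans unfolding bounded_def by blast
  qed
  have nn: "n * n < 2 ^ b" using cap by linarith
  have "runs output_com s (n * n * (1 + 2) + 2) (?J (n * n))"
    unfolding output_com_def
  proof (rule runs_For[where I = ?J])
    fix i s' assume i: "i < n * n" and J: "?J i s'" and k: "s' ''k'' 0 = i"
    then have ag: "agree {''k'', ''tree''} s s'" by blast
    note v = vals[OF ag]
    let ?e = "Mul (Read ''m'' (Add (Mul (Var ''i'') (Mul size_exp size_exp)) (Var ''k''))) (Read ''adj'' (Var ''k''))"
    have val_e: "val ?e s' = ?f i" by (simp only: val.simps v k)
    let ?s = "s'(''tree'' := (s' ''tree'')(i := ?f i))"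
    let ?s2 = "?s(''k'' := (?s ''k'')(0 := Suc i))"
    have "agree {''k'', ''tree''} s ?s2" using ag by (simp add: agree_def)
    moreover have "?s2 ''tree'' j = ?f j" if "j < Suc i" for j
      using J that by (cases "j = i") simp_all
    ultimately have Q: "?s ''k'' 0 = i \<and> ?J (Suc i) ?s2" using k by simp
    show "runs (Write ''tree'' (Var ''k'') ?e) s' 1 (\<lambda>s''. s'' ''k'' 0 = i \<and> ?J (Suc i) (s''(''k'' := (s'' ''k'')(0 := Suc i))))"
    proof (rule runs_Write)
      show "weight (Var ''k'') + weight ?e \<le> K" by (rule weight_le) simp
      show "val ?e s' < 2 ^ b" unfolding val_e by (rule small)
      have st: "s'(''tree'' := (s' ''tree'')(val (Var ''k'') s' := val ?e s')) = ?s"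
        unfolding val_e by (simp only: val.simps k)
      show "(s'(''tree'' := (s' ''tree'')(val (Var ''k'') s' := val ?e s'))) ''k'' 0 = i \<and>
        ?J (Suc i) ((s'(''tree'' := (s' ''tree'')(val (Var ''k'') s' := val ?e s')))
          (''k'' := ((s'(''tree'' := (s' ''tree'')(val (Var ''k'') s' := val ?e s'))) ''k'')(0 := Suc i)))"
        unfolding st by (rule Q)
    qed
  next
    fix i s' assume "?J i s'"
    then show "val (Mul size_exp size_exp) s' = n * n" using vals(1)[of s'] by simp
  qed (use nn in \<open>auto simp: agree_def intro!: weight_le\<close>)
  then show "runs output_com s (n * n * 3 + 2) (?J (n * n))" by (rule runs_mono) auto
qed

end

context mist_search
begin

abbreviation iteration_time :: nat where
  "iteration_time \<equiv> (n * (n * 5 + 8) + 8) + (visit_time + 1)"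

lemma invar_agree:
  assumes "invar s h es X" "agree Y s s'"
    "Y \<inter> {''n'', ''adj'', ''L'', ''m'', ''v'', ''j'', ''q'', ''V'', ''found'', ''i''} = {}"
  shows "invar s' h es X"
proof -
  have "inp s'" by (rule inp_agree[OF _ assms(2)]) (use assms in \<open>auto simp: invar_def\<close>)
  moreover have "entries s' es" by (rule entries_agree[OF _ assms(2)]) (use assms in \<open>auto simp: invar_def\<close>)
  moreover have "best s' es X" by (rule best_agree[OF _ assms(2)]) (use assms in \<open>auto simp: invar_def\<close>)
  moreover have "s' ''V'' = s ''V''" using assms(3) by (intro agreeD[OF assms(2)]) auto
  ultimately show ?thesis using assms(1) unfolding invar_def by simp
qed

lemma runs_main:
  assumes "inp s" "entries s start_entries" "s ''V'' = (\<lambda>_. 0)" "s ''found'' 0 = 0"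
  shows "runs main_com s ((n + n * n * (n * n * num_good)) * Suc iteration_time + 2)
    (\<lambda>s'. \<exists>es X. invar s' (length es) es X)"
proof -
  let ?J = "\<lambda>s'. \<exists>es X. invar s' (s' ''h'' 0) es X"
  let ?N = "n + n * n * (n * n * num_good)"
  let ?s = "s(''h'' := (s ''h'')(0 := 0))"
  let ?body = "Seq check_com (Seq visit_com (Assign ''h'' (Add (Var ''h'') (Const 1))))"
  have "runs (Loop (Sub (Var ''q'') (Var ''h'')) ?body) ?s (?N * Suc iteration_time + 1)
    (\<lambda>s'. \<exists>es X. invar s' (length es) es X)"
  \<comment> \<open>The queue grows during the loop, so the measure refers to the a priori bound
    \<open>?N\<close> on its length.\<close>
  proof (rule runs_Loop[where I = ?J and m = "\<lambda>s'. ?N - s' ''h'' 0"])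
    fix s1 assume J: "?J s1" and g: "val (Sub (Var ''q'') (Var ''h'')) s1 \<noteq> 0"
    then obtain es X where inv: "invar s1 (s1 ''h'' 0) es X" by blast
    define h where "h = s1 ''h'' 0"
    have inv: "invar s1 h es X" using inv unfolding h_def .
    have inp: "inp s1" and ent: "entries s1 es" using inv by (auto simp: invar_def)
    have h: "h < length es" using g ent unfolding h_def by (simp add: entries_def)
    then have "es ! h \<in> set es" by simp
    with ent obtain S v j T where T: "es ! h = (S, v, j, T)" "search {..<n} E S v j T"
      by (rule entry_search)
    note sb = search_bounds[OF T(2)]
    have rep: "rep n s1 h (S, v, j, T)" using ent h T(1) unfolding entries_def by metis
    have chk: "runs check_com s1 (n * (n * 5 + 8) + 8)
      (\<lambda>s'. agree {''c'', ''A'', ''B'', ''D'', ''z'', ''x'', ''w'', ''s''} s1 s' \<and>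
        s' ''c'' 0 = code n (S, v, j) \<and>
        (s' ''A'' 0 \<le> s' ''B'' 0 \<and> s' ''D'' 0 \<le> L + L \<longleftrightarrow> good S) \<and> s' ''z'' 0 = card S)"
      using rep by (intro runs_check[OF inp members_rep[OF rep sb(4)] h_def[symmetric] _ _ sb(1,2,3)]) auto
    have hN: "h < ?N" using h length_le(1)[OF inv] by linarith
    have hb: "Suc h < 2 ^ b" using h length_le(2)[OF inv] by linarith
    have "runs ?body s1 iteration_time (\<lambda>s'. s' ''h'' 0 = Suc h \<and> ?J s')"
    proof (rule runs_Seq[OF chk])
      fix s2 assume R: "agree {''c'', ''A'', ''B'', ''D'', ''z'', ''x'', ''w'', ''s''} s1 s2 \<and>
        s2 ''c'' 0 = code n (S, v, j) \<and>
        (s2 ''A'' 0 \<le> s2 ''B'' 0 \<and> s2 ''D'' 0 \<le> L + L \<longleftrightarrow> good S) \<and> s2 ''z'' 0 = card S"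
      then have ag: "agree {''c'', ''A'', ''B'', ''D'', ''z'', ''x'', ''w'', ''s''} s1 s2" by blast
      have inv2: "invar s2 h es X" by (rule invar_agree[OF inv ag]) simp
      have h2: "s2 ''h'' 0 = h" using agreeD[OF ag] by (simp add: h_def)
      show "runs (Seq visit_com (Assign ''h'' (Add (Var ''h'') (Const 1)))) s2 (visit_time + 1)
        (\<lambda>s'. s' ''h'' 0 = Suc h \<and> ?J s')"
      proof (rule runs_Seq[OF runs_visit[OF inv2 h h2]])
        fix s3 assume R3: "s3 ''h'' 0 = h \<and> (\<exists>es' X'. invar s3 (Suc h) es' X')"
        then obtain es' X' where inv3: "invar s3 (Suc h) es' X'" by blast
        let ?s3 = "s3(''h'' := (s3 ''h'')(0 := Suc h))"
        have "invar ?s3 (Suc h) es' X'"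
          by (rule invar_agree[OF inv3, of "{''h''}"]) (simp_all add: agree_def)
        then have Q: "?s3 ''h'' 0 = Suc h \<and> ?J ?s3" by auto
        show "runs (Assign ''h'' (Add (Var ''h'') (Const 1))) s3 1 (\<lambda>s'. s' ''h'' 0 = Suc h \<and> ?J s')"
          apply (rule runs_Write, (rule weight_le, simp), use R3 hb in simp)
          apply (rule back_subst[where P = "\<lambda>s'. s' ''h'' 0 = Suc h \<and> ?J s'", OF Q])
          using R3 by simp
      qed (use R T(1) in auto)
    qed
    then show "runs ?body s1 iteration_time (\<lambda>s'. ?J s' \<and> ?N - s' ''h'' 0 < ?N - s1 ''h'' 0)"
    proof (rule runs_mono[OF _ order_refl])
      fix s' assume "s' ''h'' 0 = Suc h \<and> ?J s'"
      moreover from this have "?N - s' ''h'' 0 < ?N - s1 ''h'' 0" using hN unfolding h_def by linarith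
      ultimately show "?J s' \<and> ?N - s' ''h'' 0 < ?N - s1 ''h'' 0" by blast
    qed
  next
    fix s1 assume J: "?J s1" and g: "val (Sub (Var ''q'') (Var ''h'')) s1 = 0"
    then obtain es X where inv: "invar s1 (s1 ''h'' 0) es X" by blast
    then have "s1 ''q'' 0 = length es" "s1 ''h'' 0 \<le> length es" by (auto simp: invar_def entries_def)
    then have "s1 ''h'' 0 = length es" using g by simp
    then show "\<exists>es X. invar s1 (length es) es X" using inv by metis
  next
    have ag: "agree {''h''} s ?s" by (simp add: agree_def)
    have "invar ?s 0 start_entries {}"
      unfolding invar_def best_def
      using inp_agree[OF assms(1) ag] entries_agree[OF assms(2) ag] assms(3,4) by (auto simp: image_iff)
    then show "?J ?s" by auto
  next
    show "?N - ?s ''h'' 0 \<le> ?N" by simp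
  qed (rule weight_le, simp)
  then have "runs main_com s (Suc (?N * Suc iteration_time + 1)) (\<lambda>s'. \<exists>es X. invar s' (length es) es X)"
    unfolding main_com_def by (intro runs_Seq_Write weight_le) simp_all
  then show ?thesis by (rule runs_mono) auto
qed

text \<open>With the queue exhausted, \<open>X\<close> meets the closure conditions of
  \<open>search_complete\<close>, so every spanning tree is matched by a complete state in
  \<open>X\<close>. If none is recorded, there is no spanning tree, as for \<open>n = 0\<close>.
  Otherwise the recorded one has the fewest jumps, which \<open>search_optimal\<close> turns into
  optimality.\<close>

lemma invar_correct:
  assumes "invar s (length es) es X" "subcubic {..<n} E" "L = 2 * k + 3" "n \<le> 2 ^ k"
    and out: "s' ''found'' = s ''found''"
      "\<forall>k<n * n. s' ''tree'' k = s ''m'' (s ''i'' 0 * (n * n) + k) * adjacency n E k"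
  shows "correct_output n E s'"
proof -
  have ent: "entries s es" and best: "best s es X"
    and X1: "\<And>t. t \<in> X \<Longrightarrow> covers t es n 0"
    and X2: "\<And>e. e \<in> set es \<Longrightarrow> good (fst (triple e)) \<Longrightarrow> triple e \<in> X"
    and st: "\<And>v. v < n \<Longrightarrow> ({v}, v, 0) \<in> triple ` set es"
    using assms(1) unfolding invar_def by auto
  have complete: "\<exists>v j. ({..<n}, v, j) \<in> X \<and> (2 \<le> card {..<n} \<longrightarrow> j + 2 \<le> card {u \<in> {..<n}. leaf T u})"
    if T: "spanning_tree {..<n} E T" for T
  proof (rule search_complete[OF simple assms(2) _ T, where k = k])
    show "card {..<n} \<le> 2 ^ k" using assms(4) by simp
  next
    fix v assume "v \<in> {..<n}" "sparse_cut {..<n} E (2 * k + 3) {v}"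
    then show "({v}, v, 0) \<in> X" using st[of v] X2 assms(3) by fastforce
  next
    fix S v j x w assume *: "(S, v, j) \<in> X" "x \<in> S" "w \<in> {..<n}" "w \<notin> S" "{x, w} \<in> E"
      "sparse_cut {..<n} E (2 * k + 3) (insert w S)"
    have "S \<subseteq> {..<n}" using visited_subset[OF assms(1)] *(1) by auto
    then have "x < n" using *(2) by auto
    then have "successor (S, v, j) x w \<in> triple ` set es"
      using X1[OF *(1)] * unfolding covers_def by simp
    then obtain e where e: "e \<in> set es" "triple e = (insert w S, w, j + of_bool (x \<noteq> v))" by auto
    then show "(insert w S, w, j + of_bool (x \<noteq> v)) \<in> X" using X2[OF e(1)] *(6) assms(3) by simp
  qed
  show ?thesis
  proof (cases "s ''found'' 0 = 0")
    case True
    then have none: "fst t \<noteq> {..<n}" if "t \<in> X" for t using best that by (simp add: best_def)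
    have "\<not> (\<exists>T. spanning_tree {..<n} E T)"
    proof
      assume "\<exists>T. spanning_tree {..<n} E T"
      then obtain v j where "({..<n}, v, j) \<in> X" using complete by blast
      then show False using none by fastforce
    qed
    then show ?thesis using True out(1) by (simp add: correct_output_def)
  next
    case False
    then have f1: "s ''found'' 0 = 1" using best by (simp add: best_def)
    define i where "i = s ''i'' 0"
    have i: "i < length es" "fst (triple (es ! i)) = {..<n}"
      "\<And>t. t \<in> X \<Longrightarrow> fst t = {..<n} \<Longrightarrow> snd (snd (triple (es ! i))) \<le> snd (snd t)"
      using best f1 unfolding best_def i_def by auto
    have "es ! i \<in> set es" using i(1) by simp
    with ent obtain S v j T where T: "es ! i = (S, v, j, T)" "search {..<n} E S v j T"
      by (rule entry_search)
    have S: "S = {..<n}" using i(2) T(1) by simp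
    have opt: "max_internal_spanning_tree {..<n} E T"
    proof (rule search_optimal[OF simple])
      show "search {..<n} E {..<n} v j T" using T(2) S by simp
    next
      fix T' assume T': "spanning_tree {..<n} E T'" "2 \<le> card {..<n}"
      then obtain v' j' where "({..<n}, v', j') \<in> X" "j' + 2 \<le> card {u \<in> {..<n}. leaf T' u}"
        using complete by blast
      then show "j + 2 \<le> card {u \<in> {..<n}. leaf T' u}" using i(3)[of "({..<n}, v', j')"] T(1) by simp
    qed
    have "rep n s i (es ! i)" using ent i(1) by (simp add: entries_def)
    then have m: "s ''m'' (i * (n * n) + k) = cell n S T k" if "k < n * n" for k using that T(1) by simp
    have TE: "T \<subseteq> E" using search_bounds[OF T(2)] by blast
    have no_loop: "{a} \<notin> E" for a using simple by (force simp: simple_graph_def)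
    have "s' ''tree'' k = adjacency n T k" if k: "k < n * n" for k
    proof -
      have "s' ''tree'' k = cell n S T k * adjacency n E k" using out(2) k m by (simp add: i_def)
      also have "\<dots> = adjacency n T k"
      proof (cases "{k div n, k mod n} \<in> E")
        case True
        then have "k div n \<noteq> k mod n" using no_loop by auto
        then show ?thesis using True k by (simp add: cell_def adjacency_def)
      next
        case False
        then show ?thesis using TE by (auto simp: adjacency_def)
      qed
      finally show ?thesis .
    qed
    moreover have "\<exists>T. spanning_tree {..<n} E T" using opt by (auto simp: max_internal_spanning_tree_def)
    ultimately show ?thesis using opt f1 out(1) by (auto simp: correct_output_def)
  qed
qed

lemma runs_search:
  assumes "inp s" "\<And>y. y \<notin> {''n'', ''adj'', ''L'', ''P''} \<Longrightarrow> s y = (\<lambda>_. 0)"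
    "subcubic {..<n} E" "L = 2 * k + 3" "n \<le> 2 ^ k"
  shows "runs (Seq init_com (Seq main_com output_com)) s
    (n * 4 + 2 + ((n + n * n * (n * n * num_good)) * Suc iteration_time + 2 + (n * n * 3 + 2)))
    (correct_output n E)"
proof (rule runs_Seq[OF runs_init])
  fix s1 assume R: "agree {''q'', ''m'', ''v''} s s1 \<and> entries s1 start_entries"
  then have ag: "agree {''q'', ''m'', ''v''} s s1" by blast
  have 1: "inp s1" by (rule inp_agree[OF assms(1) ag]) simp
  have 2: "s1 ''V'' = (\<lambda>_. 0)" "s1 ''found'' 0 = 0" using agreeD[OF ag] assms(2) by auto
  show "runs (Seq main_com output_com) s1
    ((n + n * n * (n * n * num_good)) * Suc iteration_time + 2 + (n * n * 3 + 2)) (correct_output n E)"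
  proof (rule runs_Seq[OF runs_main[OF 1 _ 2]])
    fix s2 assume "\<exists>es X. invar s2 (length es) es X"
    then obtain es X where inv: "invar s2 (length es) es X" by blast
    then have "inp s2" by (simp add: invar_def)
    then have "runs output_com s2 (n * n * 3 + 2) (\<lambda>s'. agree {''k'', ''tree''} s2 s' \<and>
      (\<forall>k<n * n. s' ''tree'' k = s2 ''m'' (s2 ''i'' 0 * (n * n) + k) * adjacency n E k))"
      by (rule runs_output)
    then show "runs output_com s2 (n * n * 3 + 2) (correct_output n E)"
    proof (rule runs_mono[OF _ order_refl])
      fix s3 assume O: "agree {''k'', ''tree''} s2 s3 \<and>
        (\<forall>k<n * n. s3 ''tree'' k = s2 ''m'' (s2 ''i'' 0 * (n * n) + k) * adjacency n E k)"
      then have "s3 ''found'' = s2 ''found''" by (intro agreeD[of "{''k'', ''tree''}" s2 s3]) auto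
      then show "correct_output n E s3" using O by (intro invar_correct[OF inv assms(3-5)]) auto
    qed
  qed (use R in blast)
qed (use assms(1,2) in auto)

end

section \<open>The time bound\<close>

lemma power_62_le: "(101/100 :: real) ^ 62 \<le> 1.8669"
proof -
  note sq = power_double_le
  have p2: "(101/100 :: real) ^ 2 \<le> 10201/10^4" by (simp add: power2_eq_square)
  have p4: "(101/100 :: real) ^ 4 \<le> 10407/10^4" using sq[OF p2, of "10407/10^4"] by (simp add: power2_eq_square)
  have p8: "(101/100 :: real) ^ 8 \<le> 10831/10^4" using sq[OF p4, of "10831/10^4"] by (simp add: power2_eq_square)
  have p16: "(101/100 :: real) ^ 16 \<le> 11732/10^4" using sq[OF p8, of "11732/10^4"] by (simp add: power2_eq_square)
  have p32: "(101/100 :: real) ^ 32 \<le> 13765/10^4" using sq[OF p16, of "13765/10^4"] by (simp add: power2_eq_square)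
  define x :: real where "x = 101/100"
  have "x ^ 62 = x ^ 32 * (x ^ 16 * (x ^ 8 * (x ^ 4 * x ^ 2)))" by (simp add: power_add[symmetric])
  also have "\<dots> \<le> 13765/10^4 * (11732/10^4 * (10831/10^4 * (10407/10^4 * (10201/10^4))))"
    using p2 p4 p8 p16 p32 unfolding x_def[symmetric]
    by (intro mult_mono mult_nonneg_nonneg zero_le_power) (simp_all add: x_def)
  also have "\<dots> \<le> 1.8669" by simp
  finally show ?thesis unfolding x_def .
qed

text \<open>Apart from \<open>62 * n\<close>, the exponent is \<open>2096 * k + 3192\<close>.
  Bounding 101/100 by 2 in this part gives \<open>(2 ^ k) ^ 2096 * 2 ^ 3192\<close>, which the
  premise on \<open>k\<close> bounds by a polynomial of large but fixed degree.\<close>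

lemma num_sparse_bound:
  "\<exists>p :: real poly. \<forall>n k. 2 ^ k \<le> 2 * n + 1 \<longrightarrow>
     (101/100) ^ (62 * n + 1048 * (2 * k + 3) + 48) \<le> poly p (real n) * 1.8669 ^ n"
proof -
  have main: "(101/100 :: real) ^ (62 * n + (a * k + c)) \<le> poly ([:2 ^ c:] * [:1, 2:] ^ a) (real n) * 1.8669 ^ n"
    if k: "2 ^ k \<le> 2 * n + 1" for n k a c :: nat
  proof -
    have "(101/100 :: real) ^ (62 * n) \<le> 1.8669 ^ n"
      unfolding power_mult by (intro power_mono power_62_le) simp
    moreover have "(101/100 :: real) ^ (a * k + c) \<le> 2 ^ (a * k + c)" by (intro power_mono) simp_all
    moreover have "(2 :: real) ^ (a * k + c) = (2 ^ k) ^ a * 2 ^ c"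
      unfolding power_add mult.commute[of a k] power_mult ..
    moreover have "(2 :: real) ^ k \<le> 1 + 2 * real n"
      using of_nat_mono[OF k, where 'a = real] by simp
    then have "((2 :: real) ^ k) ^ a * 2 ^ c \<le> (1 + 2 * real n) ^ a * 2 ^ c"
      by (intro mult_right_mono power_mono) simp_all
    ultimately have "(101/100 :: real) ^ (62 * n) \<le> 1.8669 ^ n"
      and "(101/100 :: real) ^ (a * k + c) \<le> (1 + 2 * real n) ^ a * 2 ^ c" by linarith+
    then have "(101/100 :: real) ^ (62 * n) * (101/100) ^ (a * k + c) \<le> 1.8669 ^ n * ((1 + 2 * real n) ^ a * 2 ^ c)"
      by (intro mult_mono) simp_all
    then show ?thesis by (simp add: power_add mult_ac)
  qed
  have "62 * n + 1048 * (2 * k + 3) + 48 = 62 * n + (2096 * k + 3192)" for n k :: nat by simp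
  then show ?thesis using main[where a = 2096 and c = 3192] by (intro exI allI impI) (simp only:)
qed

text \<open>Equality with a polynomial, in place of an upper bound, makes closure under products
  immediate.\<close>

definition polynomially :: "(nat \<Rightarrow> nat) \<Rightarrow> bool" where
  "polynomially f \<longleftrightarrow> (\<exists>p :: real poly. \<forall>n. real (f n) = poly p (real n))"

lemma polynomially_const: "polynomially (\<lambda>_. c)"
  unfolding polynomially_def by (rule exI[of _ "[:real c:]"]) simp

lemma polynomially_id: "polynomially (\<lambda>n. n)"
  unfolding polynomially_def by (rule exI[of _ "[:0, 1:]"]) simp

lemma polynomially_add: "polynomially f \<Longrightarrow> polynomially g \<Longrightarrow> polynomially (\<lambda>n. f n + g n)"
  unfolding polynomially_def by (metis of_nat_add poly_add)

lemma polynomially_mult: "polynomially f \<Longrightarrow> polynomially g \<Longrightarrow> polynomially (\<lambda>n. f n * g n)"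
  unfolding polynomially_def by (metis of_nat_mult poly_mult)

definition iteration_bound :: "nat \<Rightarrow> nat" where
  "iteration_bound n = n * (n * 5 + 8) + 8 + (n * (n * (n * n * 3 + 9 + 2) + 4) + 8 + 1) + 1"

definition unit_bound :: "nat \<Rightarrow> nat" where
  "unit_bound n = 10 ^ 9 * ((5 * n + 8) * (5 * n + 8))"

definition base_bound :: "nat \<Rightarrow> nat" where
  "base_bound n = n * 3 + 3 + (n * 4 + 2 + (n * iteration_bound n + 2 + (n * n * 3 + 2)))"

definition state_bound :: "nat \<Rightarrow> nat" where
  "state_bound n = n * n * (n * n) * iteration_bound n"

lemma polynomially_bounds: "polynomially unit_bound" "polynomially base_bound" "polynomially state_bound"
  unfolding unit_bound_def[abs_def] base_bound_def[abs_def] state_bound_def[abs_def] iteration_bound_def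
  by (intro polynomially_add polynomially_mult polynomially_id polynomially_const)+

text \<open>With \<open>u = 2 ^ n\<close> and \<open>n \<le> u\<close>, the largest number,
  \<open>n * n * (n * n * 2 ^ n)\<close>, is at most \<open>u ^ 5\<close>. This is the 5 in
  \<open>b\<close>; the factor \<open>2 ^ 8\<close> absorbs the number of summands and the additive
  constants. So cells have linearly many bits.\<close>

lemma caps:
  fixes n :: nat
  defines "b \<equiv> 5 * n + 8"
  shows "n * n + 4 * n + 20 \<le> 2 ^ b" "2 ^ n * (n * n) + 2 ^ n \<le> (2::nat) ^ b"
    "n + n * n * (n * n * 2 ^ n) + n * n + 1 < 2 ^ b" "2 * n + 10 \<le> 2 ^ b"
proof -
  define u :: nat where "u = 2 ^ n"
  have u1: "1 \<le> u" by (simp add: u_def)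
  have nu: "n \<le> u" using less_exp[of n] by (simp add: u_def)
  have b: "2 ^ b = 256 * u ^ 5"
    by (simp add: b_def u_def power_add power_mult[symmetric] mult.commute)
  have n2: "n * n \<le> u * u" using nu by (intro mult_le_mono)
  have pw: "u ^ i \<le> u ^ 5" if "i \<le> 5" for i using that u1 by (intro power_increasing)
  have u2: "u * u \<le> u ^ 5" using pw[of 2] by (simp add: power2_eq_square)
  have u3: "u \<le> u ^ 5" using pw[of 1] by simp
  have u0: "1 \<le> u ^ 5" using pw[of 0] by simp
  have "n * n * (n * n * u) \<le> u * u * (u * u * u)" by (intro n2 order_refl mult_le_mono)
  then have u5: "n * n * (n * n * u) \<le> u ^ 5" by (simp add: eval_nat_numeral mult.assoc)
  have "u * (n * n) \<le> u * (u * u)" using n2 by (rule mult_le_mono2)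
  also have "\<dots> \<le> u ^ 5" using pw[of 3] by (simp add: power3_eq_cube mult.assoc)
  finally have u4: "u * (n * n) \<le> u ^ 5" .
  show "n * n + 4 * n + 20 \<le> 2 ^ b" "2 * n + 10 \<le> 2 ^ b"
    unfolding b using n2 nu u0 u2 u3 by linarith+
  show "2 ^ n * (n * n) + 2 ^ n \<le> (2::nat) ^ b"
    unfolding b u_def[symmetric] using u4 u3 by linarith
  show "n + n * n * (n * n * 2 ^ n) + n * n + 1 < 2 ^ b"
    unfolding b u_def[symmetric] using n2 nu u0 u2 u3 u5 by linarith
qed

text \<open>\<open>k\<close> is known only after \<open>log_com\<close> has run, so \<open>G\<close>
  has to bound the count for every possible \<open>k\<close>, and the locale of the search is
  entered in the middle of the run.\<close>

lemma mist_com_correct: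
  fixes n G :: nat and E :: "nat set set"
  assumes "simple_graph {..<n} E" "subcubic {..<n} E"
    and G: "\<And>k. 2 ^ k \<le> 2 * n + 1 \<Longrightarrow> card {S \<in> Pow {..<n}. sparse_cut {..<n} E (2 * k + 3) S} \<le> G"
  shows "\<exists>t s. exec mist_com (input_state n E) t s \<and>
    t \<le> unit_bound n * (base_bound n + state_bound n * G) \<and> correct_output n E s"
proof -
  define b where "b = 5 * n + 8"
  define K :: nat where "K = 10 ^ 9"
  note caps = caps[of n, folded b_def]
  interpret machine b K by unfold_locales (simp_all add: b_def K_def)
  let ?s = "input_state n E"
  let ?t2 = "n * 4 + 2 + ((n + n * n * (n * n * G)) * iteration_bound n + 2 + (n * n * 3 + 2))"
  have s: "?s ''n'' 0 = n" "?s ''adj'' = adjacency n E"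
    "\<And>y. y \<notin> {''n'', ''adj''} \<Longrightarrow> ?s y = (\<lambda>_. 0)"
    by (auto simp: input_state_def)
  have small: "?s x i < 2 ^ b" for x i
  proof -
    have "?s x i \<le> n + 1" by (auto simp: input_state_def adjacency_def)
    then show ?thesis using caps(4) by linarith
  qed
  have "runs mist_com ?s (n * 3 + 3 + ?t2) (correct_output n E)"
    unfolding mist_com_def
  proof (rule runs_Seq[OF runs_log])
    fix s' assume R: "agree {''P'', ''L''} ?s s' \<and>
      (\<exists>k. s' ''L'' 0 = 2 * k + 3 \<and> n \<le> 2 ^ k \<and> k \<le> n \<and> 2 ^ k \<le> 2 * n + 1)"
    then obtain k where ag: "agree {''P'', ''L''} ?s s'" and
      k: "s' ''L'' 0 = 2 * k + 3" "n \<le> 2 ^ k" "k \<le> n" "2 ^ k \<le> 2 * n + 1" by blast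
    interpret mist_search b K n E "2 * k + 3"
      using assms(1) caps k(3) by unfold_locales (simp_all add: K_def)
    have "s' ''n'' = ?s ''n''" "s' ''adj'' = ?s ''adj''" by (rule agreeD[OF ag], simp)+
    then have inp: "inp s'" using s k(1) by (simp add: inp_def)
    have zero: "s' y = (\<lambda>_. 0)" if "y \<notin> {''n'', ''adj'', ''L'', ''P''}" for y
      using agreeD[OF ag, of y] s(3)[of y] that by simp
    have "num_good \<le> G" unfolding num_good_def using k(4) by (rule G)
    then have "(n + n * n * (n * n * num_good)) * iteration_bound n \<le> (n + n * n * (n * n * G)) * iteration_bound n"
      by (intro mult_le_mono1 add_left_mono mult_le_mono2)
    moreover have "Suc iteration_time = iteration_bound n" by (simp add: iteration_bound_def)
    ultimately have time: "n * 4 + 2 + ((n + n * n * (n * n * num_good)) * Suc iteration_time + 2 + (n * n * 3 + 2)) \<le> ?t2"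
      by simp
    show "runs (Seq init_com (Seq main_com output_com)) s' ?t2 (correct_output n E)"
      by (rule runs_mono[OF runs_search[OF inp _ assms(2) refl k(2)] time]) (rule zero)
  qed (use s caps in \<open>simp_all add: K_def\<close>)
  then obtain t s' where t: "exec mist_com ?s t s'" "t \<le> K * b\<^sup>2 * (n * 3 + 3 + ?t2)" "correct_output n E s'"
    using small unfolding runs_def bounded_def by blast
  have "K * b\<^sup>2 = unit_bound n" by (simp only: K_def b_def unit_bound_def power2_eq_square)
  moreover have "n * 3 + 3 + ?t2 = base_bound n + state_bound n * G"
    by (simp add: base_bound_def state_bound_def algebra_simps)
  ultimately show ?thesis using t by metis
qed

theorem theorem1:
  shows "\<exists>(c :: com) (f :: nat \<Rightarrow> nat).
           solves_MIST_on subcubic c f \<and>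
           (\<lambda>n. real (f n)) \<in> O_star (\<lambda>n. (1.8669 :: real) ^ n)"
proof -
  obtain p :: "real poly" where p: "\<And>n k. 2 ^ k \<le> 2 * n + 1 \<Longrightarrow>
     (101/100) ^ (62 * n + 1048 * (2 * k + 3) + 48) \<le> poly p (real n) * 1.8669 ^ n"
    using num_sparse_bound by blast
  \<comment> \<open>The time bound has to be a natural number that depends on \<open>n\<close>
    alone; rounding down is harmless, because the counted number of sets is an integer.\<close>
  define G where "G n = nat \<lfloor>poly p (real n) * 1.8669 ^ n\<rfloor>" for n :: nat
  define f where "f n = unit_bound n * (base_bound n + state_bound n * G n)" for n
  \<comment> \<open>Taking \<open>k = 0\<close> gives nonnegativity, without which
    \<open>nat\<close> would lift the value to 0.\<close>
  have pos: "0 \<le> poly p (real n) * 1.8669 ^ n" for n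
    using order.trans[OF _ p[of 0 n]] by simp
  have "solves_MIST_on subcubic mist_com f"
    unfolding solves_MIST_on_def
  proof (intro allI impI)
    fix n :: nat and E :: "nat set set"
    assume E: "simple_graph {..<n} E \<and> subcubic {..<n} E"
    have "card {S \<in> Pow {..<n}. sparse_cut {..<n} E (2 * k + 3) S} \<le> G n" if "2 ^ k \<le> 2 * n + 1" for k
    proof -
      have "real (card {S \<in> Pow {..<n}. sparse_cut {..<n} E (2 * k + 3) S}) \<le> poly p (real n) * 1.8669 ^ n"
        using card_sparse_cut[of "{..<n}" E "2 * k + 3"] E p[OF that] by simp
      then show ?thesis unfolding G_def by linarith
    qed
    then show "\<exists>t s. exec mist_com (input_state n E) t s \<and> t \<le> f n \<and> correct_output n E s"
      unfolding f_def using E by (intro mist_com_correct) auto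
  qed
  moreover have "(\<lambda>n. real (f n)) \<in> O_star (\<lambda>n. (1.8669 :: real) ^ n)"
  proof -
    obtain pu pb ps :: "real poly" where P: "\<And>n. real (unit_bound n) = poly pu (real n)"
      "\<And>n. real (base_bound n) = poly pb (real n)" "\<And>n. real (state_bound n) = poly ps (real n)"
      using polynomially_bounds unfolding polynomially_def by metis
    have "real (f n) \<le> poly (pu * (pb + ps * p)) (real n) * 1.8669 ^ n" for n
    proof -
      have 1: "(1 :: real) \<le> 1.8669 ^ n" by (intro one_le_power) simp
      have "real (G n) \<le> poly p (real n) * 1.8669 ^ n" unfolding G_def using pos[of n] by linarith
      then have "real (state_bound n) * real (G n) \<le> real (state_bound n) * (poly p (real n) * 1.8669 ^ n)"
        by (rule mult_left_mono) simp
      moreover have "real (base_bound n) * 1 \<le> real (base_bound n) * 1.8669 ^ n"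
        using 1 by (rule mult_left_mono) simp
      ultimately have "real (base_bound n) + real (state_bound n) * real (G n) \<le>
        (real (base_bound n) + real (state_bound n) * poly p (real n)) * 1.8669 ^ n"
        by (simp only: distrib_right mult.assoc mult_1_right)
      then have "real (unit_bound n) * (real (base_bound n) + real (state_bound n) * real (G n)) \<le>
        real (unit_bound n) * ((real (base_bound n) + real (state_bound n) * poly p (real n)) * 1.8669 ^ n)"
        by (rule mult_left_mono) simp
      then show ?thesis
        by (simp only: f_def of_nat_mult of_nat_add P poly_mult poly_add mult.assoc)
    qed
    then show ?thesis unfolding O_star_def by blast
  qed
  ultimately show ?thesis by blast
qed

end
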